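(* Let $n\ge2$, $m\ge1$, and let $\mathbf{B}^n\subset\mathbb{R}^n$, $\mathbf{B}^m\subset\mathbb{R}^m$ be the open Euclidean unit balls. Suppose that $f:\mathbf{B}^n\to\mathbf{B}^m$ is a harmonic function with $f(0)=a_0$, and that $f$ has a continuous extension to a point $x_0\in\partial\mathbf{B}^n$ with $f(x_0)=y_0\in\partial\mathbf{B}^m$. Let $a=\langle a_0,y_0\rangle$. Then $$\limsup_{r\to1^-}|D_rf(rx_0)|\ \ge\ D_n(a).$$ If, in addition, $f$ has a differentiable extension to the point $x_0$, then there exists a positive number $\lambda\in\mathbb{R}$ such that $Df(x_0)^*y_0=\lambda x_0$ and $$\lambda\ \ge\ D_n(a).$$ This is sharp (i.e. for each $a\in(-1,1)$, $D_n(a)$ cannot be replaced by a larger constant valid for all such $f,x_0,y_0$ with $\langle f(0),y_0\rangle=a$).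
   Context: For $a\in(-1,1)$ put $c=\frac{a+1}{2}\in(0,1)$ and $$D_n(a)=\frac{2^{2-n}}{\sqrt{\pi}}\,\frac{\Gamma(n/2)}{\Gamma((n-1)/2)}\int_{\alpha(c)}^{\pi}\frac{\sin^{n-2}t}{\sin^{n}(t/2)}\,dt,$$ where $\alpha(c)\in(0,\pi)$ is the spherical angle (angular radius) of a polar cap of normalized surface measure $c$ on the unit sphere $\mathbf{S}^{n-1}$: the cap $\{\eta\in\mathbf{S}^{n-1}:\angle(\eta,e)\le\alpha(c)\}$ ($e$ a unit vector) has normalized surface measure $c$, i.e. $\frac{1}{\sqrt\pi}\frac{\Gamma(n/2)}{\Gamma((n-1)/2)}\int_0^{\alpha(c)}\sin^{n-2}t\,dt=c$. Harmonic means each component of $f$ is $C^2$ and annihilated by the Euclidean Laplacian. The radial derivative is $D_rf(rx_0)=Df(rx_0)x_0=\frac{d}{dr}f(rx_0)$ for $0<r<1$. "Differentiable extension to $x_0$" means that the extension of $f$ to $\mathbf{B}^n\cup\{x_0\}$ with $f(x_0)=y_0$ satisfies $f(x_0+h)=f(x_0)+Df(x_0)h+o(|h|)$ as $h\to0$ with $x_0+h\in\mathbf{B}^n$, for a linear map $Df(x_0):\mathbb{R}^n\to\mathbb{R}^m$; $Df(x_0)^*$ is its transpose. *)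

theory Defs
  imports "HOL-Analysis.Analysis"
begin

definition partial_deriv :: "'n \<Rightarrow> (real^'n::finite \<Rightarrow> real) \<Rightarrow> real^'n \<Rightarrow> real" where
  "partial_deriv i u x = frechet_derivative u (at x) (axis i 1)"

(* C1_on, C2_on and harmonic_on are meant for open S. *)

definition C1_on :: "(real^'n::finite) set \<Rightarrow> (real^'n \<Rightarrow> real) \<Rightarrow> bool" where
  "C1_on S u \<longleftrightarrow> u differentiable_on S \<and> (\<forall>i. continuous_on S (partial_deriv i u))"

definition C2_on :: "(real^'n::finite) set \<Rightarrow> (real^'n \<Rightarrow> real) \<Rightarrow> bool" where
  "C2_on S u \<longleftrightarrow> C1_on S u \<and> (\<forall>i. C1_on S (partial_deriv i u))"

definition laplacian :: "(real^'n::finite \<Rightarrow> real) \<Rightarrow> real^'n \<Rightarrow> real" where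
  "laplacian u x = (\<Sum>i\<in>UNIV. partial_deriv i (partial_deriv i u) x)"

definition harmonic_on :: "(real^'n::finite) set \<Rightarrow> (real^'n \<Rightarrow> real^'m::finite) \<Rightarrow> bool" where
  "harmonic_on S f \<longleftrightarrow>
     (\<forall>k. C2_on S (\<lambda>x. f x $ k) \<and> (\<forall>x\<in>S. laplacian (\<lambda>x. f x $ k) x = 0))"

definition radial_deriv :: "(real^'n::finite \<Rightarrow> real^'m::finite) \<Rightarrow> real^'n \<Rightarrow> real \<Rightarrow> real^'m" where
  "radial_deriv f x\<^sub>0 r = frechet_derivative f (at (r *\<^sub>R x\<^sub>0)) x\<^sub>0"

(* The normalized surface measure of a cap of angular radius \<alpha> on the unit sphere of R^n (n \<ge> 2);
   it increases continuously from 0 to 1 as \<alpha> runs from 0 to pi. *)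
definition cap_measure :: "nat \<Rightarrow> real \<Rightarrow> real" where
  "cap_measure n \<alpha> =
     1 / sqrt pi * (Gamma (real n / 2) / Gamma ((real n - 1) / 2)) *
     integral {0..\<alpha>} (\<lambda>t. sin t ^ (n - 2))"

definition cap_angle :: "nat \<Rightarrow> real \<Rightarrow> real" where
  "cap_angle n c = (THE \<alpha>. 0 < \<alpha> \<and> \<alpha> < pi \<and> cap_measure n \<alpha> = c)"

(* D_n(a), for n \<ge> 2 and -1 < a < 1. *)
definition schwarz_const :: "nat \<Rightarrow> real \<Rightarrow> real" where
  "schwarz_const n a =
     2 powr (2 - real n) / sqrt pi * (Gamma (real n / 2) / Gamma ((real n - 1) / 2)) *
     integral {cap_angle n ((a + 1) / 2)..pi} (\<lambda>t. sin t ^ (n - 2) / sin (t / 2) ^ n)"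

(* Only the values of f on the open unit ball matter; f x\<^sub>0 itself is arbitrary, and the
   extension of f to x\<^sub>0 is f(x\<^sub>0 := y\<^sub>0). *)
definition harmonic_ball_map ::
    "(real^'n::finite \<Rightarrow> real^'m::finite) \<Rightarrow> real^'n \<Rightarrow> real^'m \<Rightarrow> bool" where
  "harmonic_ball_map f x\<^sub>0 y\<^sub>0 \<longleftrightarrow>
     f ` ball 0 1 \<subseteq> ball 0 1 \<and> harmonic_on (ball 0 1) f \<and>
     x\<^sub>0 \<in> sphere 0 1 \<and> y\<^sub>0 \<in> sphere 0 1 \<and>
     continuous_on (insert x\<^sub>0 (ball 0 1)) (f(x\<^sub>0 := y\<^sub>0))"

definition has_boundary_derivative ::
    "(real^'n::finite \<Rightarrow> real^'m::finite) \<Rightarrow> real^'n \<Rightarrow> real^'m \<Rightarrow> (real^'n \<Rightarrow> real^'m) \<Rightarrow> bool" where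
  "has_boundary_derivative f x\<^sub>0 y\<^sub>0 f' \<longleftrightarrow>
     (f(x\<^sub>0 := y\<^sub>0) has_derivative f') (at x\<^sub>0 within insert x\<^sub>0 (ball 0 1))"

end

(*
  Put v = 1 - <f, y0>, a harmonic function with values in [0, 2] and v(0) = 1 - a. By Poisson's
  formula v(r x0) / (1 - r) is the mean over the sphere of k_r v, where k_r is a decreasing function
  of the angle to x0. Under the constraints 0 <= v <= 2 and mean(v) = 1 - a, this mean is smallest
  when v = 2 on the cap opposite to x0 and v = 0 elsewhere (compare k_r with its value on the rim of
  the cap), and that minimum tends to D_n(a) as r -> 1. The mean value theorem along the radius turns
  the estimate of v into one of the radial derivative; for a boundary derivative it bounds the normal
  derivative, and the tangential part of Df(x0)^* y0 vanishes since <f, y0> is maximal at x0.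
  For sharpness take f = (1 - 2 w) y0, where w is the Poisson integral of a continuous function of
  the angle that vanishes near x0 and approximates the indicator of the opposite cap; w is smooth
  across the boundary near x0.
  Poisson's formula on an axis follows from Green's identity: for harmonic a and b the mean of
  a(s z) b(t z) over |z| = 1 depends only on s t. With a the Poisson kernel with pole x0, let s -> 1.
*)
theory Submission
  imports Defs
begin

section \<open>Means over the unit sphere\<close>

text \<open>The factor \<open>1 - r\<close> is split off before any limit. Divided by it, the
  Poisson kernel at \<open>r x\<^sub>0\<close> becomes \<open>(1 + r) / |r x\<^sub>0 - z|^n\<close>,
  which blows up only at the pole. The minimizing cap is the far one, so its integral is continuous
  up to \<open>r = 1\<close>, and the limit r -> 1 needs no exchange argument.

  \<open>f\<close> has a limit at a single boundary point, so boundary values of \<open>v\<close>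
  cannot enter the Poisson formula. It samples \<open>v\<close> on a sphere of radius \<rho> < 1,
  and \<rho> tends to 1 only once a lower bound independent of \<rho> is available.

  Means are taken of continuous functions only, which excludes the extremal boundary values, an
  indicator. The comparison on the cap is therefore phrased with the positive part of \<kappa> -
  \<open>k\<close>, where \<kappa> is the kernel on the rim. For sharpness the indicator is replaced
  by a cutoff that starts at a slightly smaller angle but has exactly the prescribed mean. The
  constant is then approached and not attained, which is enough because every larger
  \<open>C\<close> leaves a gap to work in.\<close>

lemma continuous_on_closed_cover:
  fixes f :: "'a::topological_space \<Rightarrow> 'b::topological_space"
  assumes A: "closed A" "continuous_on (S \<inter> A) f" and B: "closed B" "continuous_on (S \<inter> B) f"
    and S: "S \<subseteq> A \<union> B"
  shows "continuous_on S f"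
proof -
  have eq: "S = (S \<inter> A) \<union> (S \<inter> B)" using S by auto
  have "closedin (top_of_set S) (S \<inter> A)" "closedin (top_of_set S) (S \<inter> B)"
    using A B by (auto intro: closedin_closed_Int)
  then have "continuous_on ((S \<inter> A) \<union> (S \<inter> B)) f"
    using A B eq by (intro continuous_on_Un_local) simp_all
  then show ?thesis using eq by simp
qed

text \<open>In place of surface measure, a function on the sphere is extended to be constant along rays and
  integrated against a radial \<open>C\<^sup>1\<close> weight that lives on the shell between radii 1/2 and 1.\<close>

definition ring_weight :: "real^'n::finite \<Rightarrow> real" where
  "ring_weight y = (max 0 ((y \<bullet> y - 1/4) * (1 - y \<bullet> y)))\<^sup>2"

text \<open>The cube contains the ball of radius 2, so a function supported in the unit ball stays
  supported in it after any translation by less than 1. The factor in front gives the constant 1 the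
  mean 1.\<close>

definition sphere_mean :: "(real^'n::finite \<Rightarrow> 'b::banach) \<Rightarrow> 'b" where
  "sphere_mean g =
     (1 / integral (cbox (vec (- 2)) (vec 2)) (ring_weight :: real^'n \<Rightarrow> real)) *\<^sub>R
     integral (cbox (vec (- 2)) (vec 2)) (\<lambda>y. ring_weight y *\<^sub>R g (y /\<^sub>R norm y))"

lemma ring_weight_nonneg [simp]: "ring_weight y \<ge> 0"
  by (simp add: ring_weight_def)

lemma ring_weight_inner: "norm y \<le> 1/2 \<Longrightarrow> ring_weight y = 0"
  and ring_weight_outer: "norm y \<ge> 1 \<Longrightarrow> ring_weight y = 0"
proof -
  assume "norm y \<le> 1/2"
  then have "(norm y)\<^sup>2 \<le> (1/2)\<^sup>2" by (intro power_mono) auto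
  then have "y \<bullet> y \<le> 1/4" by (simp only: power2_norm_eq_inner) (simp add: power2_eq_square)
  then have "(y \<bullet> y - 1/4) * (1 - y \<bullet> y) \<le> 0" by (intro mult_nonpos_nonneg) auto
  then show "ring_weight y = 0" by (simp add: ring_weight_def max_def)
next
  assume "norm y \<ge> 1"
  then have "(norm y)\<^sup>2 \<ge> 1\<^sup>2" by (intro power_mono) auto
  then have "y \<bullet> y \<ge> 1" by (simp add: power2_norm_eq_inner)
  then have "(y \<bullet> y - 1/4) * (1 - y \<bullet> y) \<le> 0" by (intro mult_nonneg_nonpos) auto
  then show "ring_weight y = 0" by (simp add: ring_weight_def max_def)
qed

lemma continuous_on_ring_weight [continuous_intros]:
  "continuous_on S f \<Longrightarrow> continuous_on S (\<lambda>x. ring_weight (f x))"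
  unfolding ring_weight_def by (intro continuous_intros)

text \<open>The normalized vector has no limit at the origin, but the weight vanishes up to radius
  1/2. On one closed piece the formula is continuous, on the other it is identically 0.\<close>

lemma continuous_on_ring_extension:
  fixes g :: "'a::t2_space \<Rightarrow> real^'n::finite \<Rightarrow> 'b::real_normed_vector"
  assumes "continuous_on (U \<times> sphere 0 1) (\<lambda>(x, z). g x z)"
  shows "continuous_on (U \<times> V) (\<lambda>(x, y). ring_weight y *\<^sub>R g x (y /\<^sub>R norm y))"
proof (rule continuous_on_closed_cover[of "{p. norm (snd p) \<ge> 1/2}" _ _ "{p. norm (snd p) \<le> 1/2}"])
  let ?f = "\<lambda>(x, y). ring_weight y *\<^sub>R g x (y /\<^sub>R norm y)"
  have "inverse (norm z) * norm z = 1" if "1 \<le> norm z * 2" for z :: "real^'n"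
    using that by (intro left_inverse) auto
  then show "continuous_on (U \<times> V \<inter> {p. norm (snd p) \<ge> 1/2}) ?f"
    unfolding split_beta
    by (intro continuous_intros continuous_on_compose2[OF assms[unfolded split_beta],
        of _ "\<lambda>p. (fst p, snd p /\<^sub>R norm (snd p))", simplified]) auto
  show "continuous_on (U \<times> V \<inter> {p. norm (snd p) \<le> 1/2}) ?f"
    by (rule continuous_on_eq[of _ "\<lambda>_. 0"]) (auto simp: ring_weight_inner)
qed (auto intro!: closed_Collect_le continuous_intros)

lemma ring_extension_integrable:
  fixes g :: "real^'n::finite \<Rightarrow> 'b::banach"
  assumes "continuous_on (sphere 0 1) g"
  shows "(\<lambda>y. ring_weight y *\<^sub>R g (y /\<^sub>R norm y)) integrable_on cbox a b"
proof (rule integrable_continuous)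
  have "continuous_on ({0::real} \<times> sphere 0 1) (\<lambda>(x, z). g z)"
    unfolding split_beta by (intro continuous_on_compose2[OF assms] continuous_intros) auto
  from continuous_on_compose2[OF continuous_on_ring_extension[OF this, of "cbox a b"],
      of "cbox a b" "\<lambda>y. (0, y)"]
  show "continuous_on (cbox a b) (\<lambda>y. ring_weight y *\<^sub>R g (y /\<^sub>R norm y))"
    by (simp add: continuous_on_Pair image_subset_iff)
qed

lemma integral_ring_weight_pos:
  "integral (cbox (vec (- 2)) (vec 2)) (ring_weight :: real^'n::finite \<Rightarrow> real) > 0"
proof -
  let ?C = "cbox (vec (- 2)) (vec 2) :: (real^'n) set"
  have int: "ring_weight integrable_on ?C"
    by (intro integrable_continuous continuous_intros)
  have "integral ?C ring_weight \<noteq> 0"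
  proof
    assume "integral ?C ring_weight = 0"
    then have hi: "(ring_weight has_integral 0) ?C"
      using integrable_integral[OF int] by simp
    \<comment> \<open>Radius 3/4 lies strictly between the radii 1/2 and 1 at which the weight
      becomes 0.\<close>
    define y :: "real^'n" where "y = (3/4) *\<^sub>R axis undefined 1"
    have ny: "norm y = 3/4" by (simp add: y_def)
    have "0 \<in> box (vec (- 2)) (vec 2 :: real^'n)" by (simp add: mem_box_cart)
    moreover have "y \<in> ?C" by (simp add: mem_box_cart y_def axis_def)
    ultimately have "ring_weight y = 0"
      using hi by (intro has_integral_0_cbox_imp_0[of "vec (- 2)" "vec 2" ring_weight]
          continuous_on_ring_weight continuous_on_id) auto
    moreover have "y \<bullet> y = (3/4)\<^sup>2" unfolding ny[symmetric] by (rule power2_norm_eq_inner[symmetric])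
    ultimately show False by (simp add: ring_weight_def power2_eq_square)
  qed
  moreover have "integral ?C ring_weight \<ge> 0" by (intro integral_nonneg int) auto
  ultimately show ?thesis by linarith
qed

lemma sphere_mean_const [simp]: "sphere_mean (\<lambda>z::real^'n::finite. c :: real) = c"
proof -
  have "integral (cbox (vec (- 2)) (vec 2)) (\<lambda>y::real^'n. ring_weight y *\<^sub>R c) =
      integral (cbox (vec (- 2)) (vec 2)) (ring_weight :: real^'n \<Rightarrow> real) * c"
    by simp
  then show ?thesis using integral_ring_weight_pos[where 'n='n] by (simp add: sphere_mean_def)
qed

lemma sphere_mean_cong:
  assumes "\<And>z. norm z = 1 \<Longrightarrow> f z = g z"
  shows "sphere_mean f = sphere_mean g"
proof -
  \<comment> \<open>At \<open>y = 0\<close> the normalized vector is \<open>0\<close> and not a unit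
    vector, but the weight is 0 there.\<close>
  have "ring_weight y *\<^sub>R f (y /\<^sub>R norm y) = ring_weight y *\<^sub>R g (y /\<^sub>R norm y)" for y
    by (cases "y = 0") (auto simp: ring_weight_inner assms)
  then show ?thesis by (simp only: sphere_mean_def)
qed

lemma sphere_mean_linear:
  fixes g :: "real^'n::finite \<Rightarrow> 'b::banach" and L :: "'b \<Rightarrow> 'c::banach"
  assumes "continuous_on (sphere 0 1) g" "bounded_linear L"
  shows "sphere_mean (\<lambda>z. L (g z)) = L (sphere_mean g)"
proof -
  interpret L: bounded_linear L by fact
  have "integral (cbox (vec (- 2)) (vec 2)) (L \<circ> (\<lambda>y. ring_weight y *\<^sub>R g (y /\<^sub>R norm y))) =
     L (integral (cbox (vec (- 2)) (vec 2)) (\<lambda>y. ring_weight y *\<^sub>R g (y /\<^sub>R norm y)))"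
    by (intro integral_linear ring_extension_integrable assms)
  then show ?thesis by (simp add: sphere_mean_def o_def L.scaleR)
qed

lemma sphere_mean_add:
  fixes f g :: "real^'n::finite \<Rightarrow> 'b::banach"
  assumes "continuous_on (sphere 0 1) f" "continuous_on (sphere 0 1) g"
  shows "sphere_mean (\<lambda>z. f z + g z) = sphere_mean f + sphere_mean g"
proof -
  let ?C = "cbox (vec (- 2)) (vec 2) :: (real^'n) set"
  have "integral ?C (\<lambda>y. ring_weight y *\<^sub>R f (y /\<^sub>R norm y) + ring_weight y *\<^sub>R g (y /\<^sub>R norm y)) =
    integral ?C (\<lambda>y. ring_weight y *\<^sub>R f (y /\<^sub>R norm y)) +
    integral ?C (\<lambda>y. ring_weight y *\<^sub>R g (y /\<^sub>R norm y))"
    using Henstock_Kurzweil_Integration.integral_add[OF ring_extension_integrable[OF assms(1)]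
        ring_extension_integrable[OF assms(2)]] .
  then show ?thesis by (simp only: sphere_mean_def scaleR_add_right)
qed

lemma sphere_mean_diff:
  fixes f g :: "real^'n::finite \<Rightarrow> 'b::banach"
  assumes "continuous_on (sphere 0 1) f" "continuous_on (sphere 0 1) g"
  shows "sphere_mean (\<lambda>z. f z - g z) = sphere_mean f - sphere_mean g"
proof -
  let ?C = "cbox (vec (- 2)) (vec 2) :: (real^'n) set"
  have "integral ?C (\<lambda>y. ring_weight y *\<^sub>R f (y /\<^sub>R norm y) - ring_weight y *\<^sub>R g (y /\<^sub>R norm y)) =
    integral ?C (\<lambda>y. ring_weight y *\<^sub>R f (y /\<^sub>R norm y)) -
    integral ?C (\<lambda>y. ring_weight y *\<^sub>R g (y /\<^sub>R norm y))"
    using Henstock_Kurzweil_Integration.integral_diff[OF ring_extension_integrable[OF assms(1)]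
        ring_extension_integrable[OF assms(2)]] .
  then show ?thesis by (simp only: sphere_mean_def scaleR_diff_right)
qed

lemma sphere_mean_cmult:
  fixes f :: "real^'n::finite \<Rightarrow> real"
  assumes "continuous_on (sphere 0 1) f"
  shows "sphere_mean (\<lambda>z. c * f z) = c * sphere_mean f"
  by (intro sphere_mean_linear assms bounded_linear_mult_right)

lemma sphere_mean_sum:
  fixes f :: "'i \<Rightarrow> real^'n::finite \<Rightarrow> real"
  assumes "\<And>i. i \<in> I \<Longrightarrow> continuous_on (sphere 0 1) (f i)"
  shows "sphere_mean (\<lambda>z. \<Sum>i\<in>I. f i z) = (\<Sum>i\<in>I. sphere_mean (f i))"
  using assms
proof (induction I rule: infinite_finite_induct)
  case (insert i I)
  have "sphere_mean (\<lambda>z. f i z + (\<Sum>i\<in>I. f i z)) = sphere_mean (f i) + sphere_mean (\<lambda>z. \<Sum>i\<in>I. f i z)"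
    using insert.prems by (intro sphere_mean_add continuous_on_sum) auto
  then show ?case using insert by simp
qed auto

lemma sphere_mean_mono:
  fixes f g :: "real^'n::finite \<Rightarrow> real"
  assumes "continuous_on (sphere 0 1) f" "continuous_on (sphere 0 1) g"
    and "\<And>z. norm z = 1 \<Longrightarrow> f z \<le> g z"
  shows "sphere_mean f \<le> sphere_mean g"
proof -
  have "ring_weight y *\<^sub>R f (y /\<^sub>R norm y) \<le> ring_weight y *\<^sub>R g (y /\<^sub>R norm y)" for y
    by (cases "y = 0") (auto simp: ring_weight_inner assms intro!: mult_left_mono)
  then have "integral (cbox (vec (- 2)) (vec 2)) (\<lambda>y. ring_weight y *\<^sub>R f (y /\<^sub>R norm y)) \<le>
      integral (cbox (vec (- 2)) (vec 2)) (\<lambda>y. ring_weight y *\<^sub>R g (y /\<^sub>R norm y))"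
    by (intro integral_le ring_extension_integrable assms)
  then show ?thesis
    unfolding sphere_mean_def using integral_ring_weight_pos[where 'n='n]
    by (intro scaleR_left_mono) auto
qed

lemma sphere_mean_continuous_on:
  fixes g :: "'a::t2_space \<Rightarrow> real^'n::finite \<Rightarrow> 'b::banach"
  assumes "continuous_on (U \<times> sphere 0 1) (\<lambda>(x, z). g x z)"
  shows "continuous_on U (\<lambda>x. sphere_mean (g x))"
proof -
  have "continuous_on U (\<lambda>x. integral (cbox (vec (- 2)) (vec 2)) (\<lambda>y. ring_weight y *\<^sub>R g x (y /\<^sub>R norm y)))"
    by (rule integral_continuous_on_param[OF continuous_on_ring_extension[OF assms]])
  then show ?thesis unfolding sphere_mean_def by (rule continuous_on_scaleR[OF continuous_on_const])
qed

text \<open>Differentiation under the integral sign. The gradient is kept as a vector field, so the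
  derivative is again given by a mean, now vector valued, and its components can be differentiated
  once more in the same way.\<close>

lemma sphere_mean_has_derivative:
  fixes K :: "'a::euclidean_space \<Rightarrow> real^'n::finite \<Rightarrow> real"
  assumes U: "open U" "x \<in> U"
    and der: "\<And>x z. x \<in> U \<Longrightarrow> norm z = 1 \<Longrightarrow> ((\<lambda>x. K x z) has_derivative (\<lambda>h. G x z \<bullet> h)) (at x)"
    and K: "\<And>x. x \<in> U \<Longrightarrow> continuous_on (sphere 0 1) (K x)"
    and G: "continuous_on (U \<times> sphere 0 1) (\<lambda>(x, z). G x z)"
  shows "((\<lambda>x. sphere_mean (K x)) has_derivative (\<lambda>h. sphere_mean (G x) \<bullet> h)) (at x)"
proof -
  obtain d where d: "d > 0" "ball x d \<subseteq> U" using U openE by blast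
  let ?B = "ball x d" and ?C = "cbox (vec (- 2)) (vec 2) :: (real^'n) set"
  let ?G = "\<lambda>x y. ring_weight y *\<^sub>R G x (y /\<^sub>R norm y)"
  have cG: "continuous_on (ball x d \<times> sphere 0 1) (\<lambda>(x, z). G x z)"
    by (rule continuous_on_subset[OF G]) (use d in auto)
  have cGx: "continuous_on (sphere 0 1) (G x)"
    using continuous_on_compose2[OF G, of "sphere 0 1" "\<lambda>z. (x, z)"] U
    by (simp add: continuous_on_Pair image_subset_iff)
  have "((\<lambda>x. integral ?C (\<lambda>y. ring_weight y *\<^sub>R K x (y /\<^sub>R norm y))) has_derivative
     integral ?C (\<lambda>y. blinfun_inner_right (?G x y))) (at x within ?B)"
  proof (rule leibniz_rule[where fx = "\<lambda>x y. blinfun_inner_right (?G x y)"])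
    fix x' y assume "x' \<in> ball x d" and "y \<in> ?C"
    then have "x' \<in> U" using d by auto
    show "((\<lambda>x. ring_weight y *\<^sub>R K x (y /\<^sub>R norm y)) has_derivative
        blinfun_apply (blinfun_inner_right (?G x' y))) (at x' within ball x d)"
    proof (cases "y = 0")
      case False
      then show ?thesis
        using der[OF \<open>x' \<in> U\<close>, of "y /\<^sub>R norm y"]
        by (auto intro!: derivative_eq_intros has_derivative_at_withinI[where s = "ball x d"])
    qed (auto intro!: derivative_eq_intros simp: ring_weight_inner)
  next
    show "continuous_on (?B \<times> ?C) (\<lambda>(x, y). blinfun_inner_right (?G x y))"
      using continuous_on_ring_extension[OF cG, of ?C] unfolding split_beta
      by (intro bounded_linear.continuous_on[OF bounded_linear_blinfun_inner_right])
  next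
    fix x' assume "x' \<in> ?B"
    then have "x' \<in> U" using d by auto
    then show "(\<lambda>y. ring_weight y *\<^sub>R K x' (y /\<^sub>R norm y)) integrable_on ?C"
      by (intro ring_extension_integrable K)
  qed (use d in auto)
  also have "integral ?C (\<lambda>y. blinfun_inner_right (?G x y)) = blinfun_inner_right (integral ?C (?G x))"
    using integral_linear[OF ring_extension_integrable[OF cGx] bounded_linear_blinfun_inner_right]
    by (simp add: o_def)
  finally have "((\<lambda>x. integral ?C (\<lambda>y. ring_weight y *\<^sub>R K x (y /\<^sub>R norm y))) has_derivative
     (\<lambda>h. integral ?C (?G x) \<bullet> h)) (at x)"
    using d by (simp add: at_within_open[of x "ball x d"])
  from has_derivative_scaleR_right[OF this,
      of "1 / integral ?C (ring_weight :: real^'n \<Rightarrow> real)"]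
  show ?thesis by (simp add: sphere_mean_def)
qed

lemma sphere_mean_DERIV:
  fixes K :: "real \<Rightarrow> real^'n::finite \<Rightarrow> real"
  assumes U: "open U" "x \<in> U"
    and der: "\<And>x z. x \<in> U \<Longrightarrow> norm z = 1 \<Longrightarrow> ((\<lambda>x. K x z) has_real_derivative G x z) (at x)"
    and K: "\<And>x. x \<in> U \<Longrightarrow> continuous_on (sphere 0 1) (K x)"
    and G: "continuous_on (U \<times> sphere 0 1) (\<lambda>(x, z). G x z)"
  shows "((\<lambda>x. sphere_mean (K x)) has_real_derivative sphere_mean (G x)) (at x)"
  using sphere_mean_has_derivative[OF U _ K G] der
  by (simp add: has_field_derivative_def)

section \<open>Integration by parts along rotation fields\<close>

text \<open>Translation invariance of the integral replaces the divergence theorem.\<close>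

lemma integral_directional_derivative_eq_0:
  fixes f :: "real^'n::finite \<Rightarrow> real"
  assumes der: "\<And>y. (f has_derivative (\<lambda>h. F y \<bullet> h)) (at y)"
    and cont: "continuous_on UNIV F"
    and supp: "\<And>y. norm y \<ge> 1 \<Longrightarrow> f y = 0"
    and e: "norm e = 1"
  shows "integral (cbox (vec (- 2)) (vec 2)) (\<lambda>y. F y \<bullet> e) = 0"
proof -
  let ?C = "cbox (vec (- 2)) (vec 2) :: (real^'n) set"
  define I where "I = integral ?C f"
  have cf: "continuous_on UNIV f"
    using der by (meson continuous_on_eq_continuous_within has_derivative_at_withinI has_derivative_continuous)
  have fI: "(f has_integral I) ?C"
    unfolding I_def by (intro integrable_integral integrable_continuous continuous_on_subset[OF cf]) auto
  have inC: "y \<in> ?C" if "norm y \<le> 2" for y :: "real^'n"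
    using that component_le_norm_cart[of y] by (auto simp: mem_box_cart abs_le_iff) (smt (verit))+
  \<comment> \<open>The translated function is supported in radius
    \<open>1 + \<bar>t\<bar> < 2\<close>. Hence the cube and its translate both carry the whole
    integral, which therefore does not depend on \<open>t\<close>.\<close>
  have shift: "integral ?C (\<lambda>y. f (y + t *\<^sub>R e)) = I" if t: "\<bar>t\<bar> < 1" for t
  proof -
    have far: "f (y + t *\<^sub>R e) = 0" if "norm y \<ge> 2" for y
      using that t e norm_triangle_ineq4[of "y + t *\<^sub>R e" "t *\<^sub>R e"] by (intro supp) simp
    have "((\<lambda>y. f (y + t *\<^sub>R e)) has_integral I) ((\<lambda>y. y + - (t *\<^sub>R e)) ` ?C)"
      using has_integral_affinity[OF fI, of 1 "t *\<^sub>R e"] by simp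
    moreover have "f (y + t *\<^sub>R e) = 0" if "y \<notin> (\<lambda>y. y + - (t *\<^sub>R e)) ` ?C" for y
    proof (rule supp, rule ccontr)
      assume "\<not> 1 \<le> norm (y + t *\<^sub>R e)"
      then have "y + t *\<^sub>R e \<in> ?C" by (intro inC) simp
      then have "y \<in> (\<lambda>y. y + - (t *\<^sub>R e)) ` ?C" by (intro image_eqI[of _ _ "y + t *\<^sub>R e"]) auto
      then show False using that by blast
    qed
    ultimately have "((\<lambda>y. f (y + t *\<^sub>R e)) has_integral I) UNIV"
      by (rule has_integral_on_superset) simp_all
    then have "((\<lambda>y. if y \<in> ?C then f (y + t *\<^sub>R e) else 0) has_integral I) UNIV"
    proof (rule has_integral_eq[rotated])
      fix y show "f (y + t *\<^sub>R e) = (if y \<in> ?C then f (y + t *\<^sub>R e) else 0)"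
      proof (cases "y \<in> ?C")
        case False
        then have "norm y \<ge> 2" using inC[of y] by linarith
        then show ?thesis using False far by simp
      qed (simp only: if_True)
    qed
    then have "((\<lambda>y. f (y + t *\<^sub>R e)) has_integral I) ?C"
      by (simp only: has_integral_restrict_UNIV)
    then show ?thesis by (rule integral_unique)
  qed
  have "((\<lambda>t. integral ?C (\<lambda>y. f (y + t *\<^sub>R e))) has_real_derivative
      integral ?C (\<lambda>y. F (y + 0 *\<^sub>R e) \<bullet> e)) (at 0 within ball 0 1)"
  proof (rule leibniz_rule_field_derivative)
    fix t y
    have "((\<lambda>t. y + t *\<^sub>R e) has_derivative (\<lambda>h. h *\<^sub>R e)) (at t within ball 0 1)"
      by (auto intro!: derivative_eq_intros)
    from has_derivative_compose[OF this der]
    show "((\<lambda>t. f (y + t *\<^sub>R e)) has_real_derivative F (y + t *\<^sub>R e) \<bullet> e) (at t within ball 0 1)"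
      by (simp add: has_field_derivative_def mult_commute_abs)
    show "(\<lambda>y. f (y + t *\<^sub>R e)) integrable_on ?C"
      by (intro integrable_continuous continuous_on_compose2[OF cf] continuous_intros) auto
  next
    show "continuous_on (ball 0 1 \<times> ?C) (\<lambda>(t, y). F (y + t *\<^sub>R e) \<bullet> e)"
      unfolding split_beta by (intro continuous_intros continuous_on_compose2[OF cont]) auto
  qed auto
  then have "((\<lambda>t. integral ?C (\<lambda>y. f (y + t *\<^sub>R e))) has_real_derivative
      integral ?C (\<lambda>y. F y \<bullet> e)) (at 0)"
    by (simp add: at_within_open[of "0 :: real" "ball 0 1"])
  moreover have "((\<lambda>t. integral ?C (\<lambda>y. f (y + t *\<^sub>R e))) has_real_derivative 0) (at 0)"
    by (rule has_field_derivative_transform_within[where d = 1 and f = "\<lambda>_. I"])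
       (auto simp: shift dist_real_def intro!: derivative_eq_intros)
  ultimately show ?thesis by (rule DERIV_unique)
qed

text \<open>This is the reason for the square in \<open>ring_weight\<close>: the positive part has a
  corner at 0, while its square has a continuous derivative.\<close>

lemma DERIV_max_0_square: "((\<lambda>x::real. (max 0 x)\<^sup>2) has_real_derivative 2 * max 0 x) (at x)"
proof -
  have eq: "(\<lambda>x::real. (max 0 x)\<^sup>2) = (\<lambda>x. if 0 \<le> x then x\<^sup>2 else 0)" by (auto simp: max_def)
  consider "x > 0" | "x < 0" | "x = 0" by linarith
  then show ?thesis
  proof cases
    case 1
    have "((\<lambda>x. x\<^sup>2) has_real_derivative 2 * x) (at x)" by (auto intro!: derivative_eq_intros)
    then show ?thesis
      by - (rule has_field_derivative_transform_within[where d = x and f = "\<lambda>x. x\<^sup>2"], use 1 in \<open>auto simp: max_def dist_real_def\<close>)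
  next
    case 2
    then show ?thesis
      by - (rule has_field_derivative_transform_within[where d = "- x" and f = "\<lambda>_. 0"],
          auto simp: max_def dist_real_def)
  next
    case 3
    have "((\<lambda>h::real. (max 0 h)\<^sup>2 / h) \<longlongrightarrow> 0) (at 0)"
    proof (rule tendsto_0_le[where K = 1])
      show "((\<lambda>h::real. h) \<longlongrightarrow> 0) (at 0)" by (rule tendsto_ident_at)
      show "\<forall>\<^sub>F h::real in at 0. norm ((max 0 h)\<^sup>2 / h) \<le> norm h * 1"
        by (rule always_eventually) (auto simp: max_def power2_eq_square)
    qed
    then show ?thesis using 3 by (simp add: DERIV_def)
  qed
qed

text \<open>The gradient of \<open>ring_weight\<close> at \<open>y\<close> is this scalar times
  \<open>y\<close>. The last factor is the derivative of \<open>(q - 1/4) * (1 - q)\<close> at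
  \<open>q = y \<bullet> y\<close>.\<close>

definition ring_weight_slope :: "real^'n::finite \<Rightarrow> real" where
  "ring_weight_slope y = 4 * max 0 ((y \<bullet> y - 1/4) * (1 - y \<bullet> y)) * (5/4 - 2 * (y \<bullet> y))"

lemma ring_weight_has_derivative:
  "(ring_weight has_derivative (\<lambda>h. ring_weight_slope y * (y \<bullet> h))) (at y)"
proof -
  have "((\<lambda>y::real^'a. (y \<bullet> y - 1/4) * (1 - y \<bullet> y)) has_derivative
      (\<lambda>h. (5/4 - 2 * (y \<bullet> y)) * (2 * (y \<bullet> h)))) (at y)"
    by (auto intro!: derivative_eq_intros simp: fun_eq_iff inner_commute algebra_simps)
  from has_derivative_compose[OF this DERIV_max_0_square[unfolded has_field_derivative_def]]
  show ?thesis
    unfolding ring_weight_def[abs_def]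
    by (rule has_derivative_eq_rhs) (simp add: ring_weight_slope_def fun_eq_iff field_simps)
qed

lemma ring_weight_slope_inner:
  fixes y :: "real^'n::finite"
  assumes "norm y \<le> 1/2" shows "ring_weight_slope y = 0"
proof -
  have "(max 0 ((y \<bullet> y - 1/4) * (1 - y \<bullet> y)))\<^sup>2 = 0"
    using ring_weight_inner[OF assms] by (simp only: ring_weight_def)
  then show ?thesis by (simp add: ring_weight_slope_def)
qed

lemma sgn_has_derivative:
  fixes y :: "'a::real_inner"
  assumes "y \<noteq> 0"
  shows "((\<lambda>y. y /\<^sub>R norm y) has_derivative
    (\<lambda>h. (1 / norm y) *\<^sub>R (h - ((y /\<^sub>R norm y) \<bullet> h) *\<^sub>R (y /\<^sub>R norm y)))) (at y)"
proof -
  have 1: "((\<lambda>y. inverse (norm y)) has_derivative (\<lambda>h. - (inverse (norm y) * (sgn y \<bullet> h) * inverse (norm y)))) (at y)"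
    using assms has_derivative_norm[OF assms] by (intro Deriv.has_derivative_inverse) (auto simp: inner_commute)
  have "((\<lambda>y. inverse (norm y) *\<^sub>R y) has_derivative
     (\<lambda>h. inverse (norm y) *\<^sub>R h + (- (inverse (norm y) * (sgn y \<bullet> h) * inverse (norm y))) *\<^sub>R y)) (at y)"
    by (rule has_derivative_scaleR[OF 1 has_derivative_ident])
  then show ?thesis
    by (rule has_derivative_eq_rhs) (simp add: fun_eq_iff sgn_div_norm algebra_simps divide_inverse)
qed

text \<open>The gradient splits into a multiple of \<open>y\<close>, which comes from the weight,
  and a tangential part, which comes from \<open>g\<close>. The multiple of \<open>y\<close> and the
  subtracted multiple of \<open>p y\<close> both drop out once the gradient is antisymmetrized
  against \<open>y\<close>.\<close>

lemma ring_extension_has_derivative: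
  fixes g :: "real^'n::finite \<Rightarrow> real"
  assumes der: "\<And>z. norm z = 1 \<Longrightarrow> (g has_derivative (\<lambda>h. G z \<bullet> h)) (at z)"
  defines "\<And>y. p y \<equiv> y /\<^sub>R norm y"
  shows "((\<lambda>y. ring_weight y * g (p y)) has_derivative
      (\<lambda>h. ((ring_weight_slope y * g (p y)) *\<^sub>R y
        + (ring_weight y / norm y) *\<^sub>R (G (p y) - (p y \<bullet> G (p y)) *\<^sub>R p y)) \<bullet> h)) (at y)"
proof (cases "norm y < 1/2")
  case True
  have "((\<lambda>y. ring_weight y * g (p y)) has_derivative (\<lambda>_. 0)) (at y)"
  proof (rule has_derivative_transform_within_open)
    show "((\<lambda>_. 0) has_derivative (\<lambda>_. 0)) (at y)" by simp
    show "y \<in> ball 0 (1/2)" using True by simp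
    fix x :: "real^'n" assume "x \<in> ball 0 (1/2)"
    then show "0 = ring_weight x * g (p x)" by (simp add: ring_weight_inner)
  qed simp
  then show ?thesis using True by (simp add: ring_weight_inner ring_weight_slope_inner)
next
  case False
  then have "y \<noteq> 0" by auto
  then have "norm (p y) = 1" by (simp add: p_def)
  have "(p has_derivative (\<lambda>h. (1 / norm y) *\<^sub>R (h - (p y \<bullet> h) *\<^sub>R p y))) (at y)"
    unfolding p_def by (rule sgn_has_derivative) fact
  from has_derivative_compose[OF this der[OF \<open>norm (p y) = 1\<close>]]
  have "((\<lambda>y. g (p y)) has_derivative
      (\<lambda>h. (1 / norm y) * (G (p y) \<bullet> h - (p y \<bullet> h) * (p y \<bullet> G (p y))))) (at y)"
    by (simp add: inner_diff_right inner_commute)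
  from has_derivative_mult[OF ring_weight_has_derivative this]
  show ?thesis
  proof (rule has_derivative_eq_rhs, intro ext)
    fix h
    show "ring_weight y * (1 / norm y * (G (p y) \<bullet> h - p y \<bullet> h * (p y \<bullet> G (p y)))) +
        ring_weight_slope y * (y \<bullet> h) * g (p y) =
      ((ring_weight_slope y * g (p y)) *\<^sub>R y +
        (ring_weight y / norm y) *\<^sub>R (G (p y) - (p y \<bullet> G (p y)) *\<^sub>R p y)) \<bullet> h"
      by (simp only: inner_add_left inner_diff_left inner_scaleR_left) (simp add: mult_ac)
  qed
qed

text \<open>For i \<noteq> j the field z_i d_j - z_j d_i is divergence free and annihilates radial
  functions. The weight thus passes through it, and integration by parts over the whole space leaves
  nothing.\<close>

lemma sphere_mean_rotation_derivative:
  fixes g :: "real^'n::finite \<Rightarrow> real"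
  assumes der: "\<And>z. norm z = 1 \<Longrightarrow> (g has_derivative (\<lambda>h. G z \<bullet> h)) (at z)"
    and cont: "continuous_on (sphere 0 1) G"
  shows "sphere_mean (\<lambda>z. z $ i * G z $ j - z $ j * G z $ i) = 0"
proof (cases "i = j")
  case False
  let ?C = "cbox (vec (- 2)) (vec 2) :: (real^'n) set"
  define p where "p y = y /\<^sub>R norm y" for y :: "real^'n"
  define f where "f y = ring_weight y * g (p y)" for y
  define F where "F y = (ring_weight_slope y * g (p y)) *\<^sub>R y
        + (ring_weight y / norm y) *\<^sub>R (G (p y) - (p y \<bullet> G (p y)) *\<^sub>R p y)" for y
  have f: "(f has_derivative (\<lambda>h. F y \<bullet> h)) (at y)" for y
    unfolding f_def[abs_def] F_def p_def by (rule ring_extension_has_derivative[OF der])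
  have cg: "continuous_on (sphere 0 1) g"
    using der by (metis continuous_at_imp_continuous_on has_derivative_continuous mem_sphere_0)
  have cF: "continuous_on UNIV F"
  proof -
    let ?A = "{y::real^'n. norm y \<ge> 1/2}" and ?B = "{y::real^'n. norm y \<le> 1/2}"
    have nz: "norm y \<noteq> 0" if "y \<in> ?A" for y using that by auto
    have cp: "continuous_on ?A p" unfolding p_def by (intro continuous_intros) (use nz in auto)
    have "continuous_on ?A F"
      unfolding F_def ring_weight_slope_def using nz
      by (intro continuous_intros cp continuous_on_compose2[OF cg] continuous_on_compose2[OF cont])
         (auto simp: p_def)
    moreover have "continuous_on ?B F"
      by (rule continuous_on_eq[of _ "\<lambda>_. 0"]) (auto simp: F_def ring_weight_inner ring_weight_slope_inner)
    moreover have "closed ?A" "closed ?B" by (intro closed_Collect_le continuous_intros)+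
    ultimately have "continuous_on (?A \<union> ?B) F" by (intro continuous_on_closed_Un)
    moreover have "?A \<union> ?B = UNIV" by auto
    ultimately show ?thesis by simp
  qed
  \<comment> \<open>Differentiating \<open>y $ k * f y\<close> in direction \<open>l\<close>
    produces \<open>f y\<close> itself only when \<open>k = l\<close>.\<close>
  have zero: "integral ?C (\<lambda>y. y $ k * F y $ l) = 0" if "k \<noteq> l" for k l
  proof -
    have cf: "continuous_on UNIV f"
      using f by (meson continuous_on_eq_continuous_within has_derivative_at_withinI has_derivative_continuous)
    have "integral ?C (\<lambda>y. (y $ k *\<^sub>R F y + f y *\<^sub>R axis k 1) \<bullet> axis l 1) = 0"
    proof (rule integral_directional_derivative_eq_0[where f = "\<lambda>y. y $ k * f y"])
      have "((\<lambda>y. y $ k) has_derivative (\<lambda>h. h $ k)) (at y)" for y :: "real^'n"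
        by (rule bounded_linear_imp_has_derivative[OF bounded_linear_vec_nth])
      from has_derivative_mult[OF this f]
      show "((\<lambda>y. y $ k * f y) has_derivative (\<lambda>h. (y $ k *\<^sub>R F y + f y *\<^sub>R axis k 1) \<bullet> h)) (at y)" for y
        by (simp add: inner_add_left inner_axis' algebra_simps)
      show "continuous_on UNIV (\<lambda>y. y $ k *\<^sub>R F y + f y *\<^sub>R axis k 1)"
        by (intro continuous_intros cF cf)
    qed (auto simp: f_def ring_weight_outer)
    moreover have "axis k (1::real) $ l = 0" using that by (simp add: axis_def)
    ultimately show ?thesis by (simp add: inner_add_left inner_axis)
  qed
  \<comment> \<open>The radial parts of \<open>F\<close> cancel, and the factor
    \<open>1 / norm y\<close> turns \<open>y\<close> into \<open>p y\<close>.\<close>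
  have "F y $ j * y $ i - F y $ i * y $ j = ring_weight y *\<^sub>R (p y $ i * G (p y) $ j - p y $ j * G (p y) $ i)" for y
    by (simp add: F_def p_def algebra_simps divide_inverse)
  then have "integral ?C (\<lambda>y. ring_weight y *\<^sub>R (p y $ i * G (p y) $ j - p y $ j * G (p y) $ i)) =
    integral ?C (\<lambda>y. y $ i * F y $ j - y $ j * F y $ i)"
    by (simp add: mult.commute)
  also have "\<dots> = integral ?C (\<lambda>y. y $ i * F y $ j) - integral ?C (\<lambda>y. y $ j * F y $ i)"
    by (intro Henstock_Kurzweil_Integration.integral_diff integrable_continuous
        continuous_intros continuous_on_subset[OF cF]) auto
  also have "\<dots> = 0" using zero False by simp
  finally show ?thesis by (simp only: sphere_mean_def p_def scaleR_zero_right)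
qed simp

section \<open>Green's identity on the sphere\<close>

text \<open>Gradient and Hessian are explicit functions, so that scaling, linear combinations and
  means act on them by formulas. Continuity is asked of the Hessian; that of \<open>u\<close> and
  its gradient follows.\<close>

definition has_hessian ::
    "(real^'n::finite) set \<Rightarrow> (real^'n \<Rightarrow> real) \<Rightarrow> (real^'n \<Rightarrow> real^'n) \<Rightarrow> (real^'n \<Rightarrow> real^'n^'n) \<Rightarrow> bool" where
  "has_hessian S u G H \<longleftrightarrow>
     (\<forall>x\<in>S. (u has_derivative (\<lambda>h. G x \<bullet> h)) (at x)) \<and>
     (\<forall>x\<in>S. \<forall>i. ((\<lambda>x. G x $ i) has_derivative (\<lambda>h. H x $ i \<bullet> h)) (at x)) \<and>
     continuous_on S H"

definition quadratic_form :: "real^'n^'n::finite \<Rightarrow> real^'n \<Rightarrow> real" where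
  "quadratic_form H z = (\<Sum>i\<in>UNIV. z $ i * (H $ i \<bullet> z))"

lemma has_hessianD:
  assumes "has_hessian S u G H"
  shows "x \<in> S \<Longrightarrow> (u has_derivative (\<lambda>h. G x \<bullet> h)) (at x)"
    and "x \<in> S \<Longrightarrow> ((\<lambda>x. G x $ i) has_derivative (\<lambda>h. H x $ i \<bullet> h)) (at x)"
    and "continuous_on S u" "continuous_on S G" "continuous_on S H"
proof -
  show u: "x \<in> S \<Longrightarrow> (u has_derivative (\<lambda>h. G x \<bullet> h)) (at x)" for x
    using assms by (simp add: has_hessian_def)
  show G: "x \<in> S \<Longrightarrow> ((\<lambda>x. G x $ i) has_derivative (\<lambda>h. H x $ i \<bullet> h)) (at x)" for x i
    using assms by (simp add: has_hessian_def)
  show "continuous_on S u"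
    by (intro continuous_at_imp_continuous_on ballI has_derivative_continuous[OF u])
  have "continuous_on S (\<lambda>x. \<chi> i. G x $ i)"
    by (intro continuous_on_vec_lambda continuous_at_imp_continuous_on ballI has_derivative_continuous[OF G])
  then show "continuous_on S G" by simp
  show "continuous_on S H" using assms by (simp add: has_hessian_def)
qed

lemma has_hessian_subset: "has_hessian S u G H \<Longrightarrow> T \<subseteq> S \<Longrightarrow> has_hessian T u G H"
  unfolding has_hessian_def by (meson continuous_on_subset subsetD)

lemma has_hessian_scale:
  fixes u :: "real^'n::finite \<Rightarrow> real"
  assumes "has_hessian S u G H" and "\<And>x. x \<in> T \<Longrightarrow> c *\<^sub>R x \<in> S"
  shows "has_hessian T (\<lambda>x. u (c *\<^sub>R x)) (\<lambda>x. c *\<^sub>R G (c *\<^sub>R x)) (\<lambda>x. c\<^sup>2 *\<^sub>R H (c *\<^sub>R x))"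
proof -
  note h = has_hessianD[OF assms(1)]
  have sc: "((\<lambda>x. c *\<^sub>R x) has_derivative (\<lambda>h. c *\<^sub>R h)) (at x)" for x :: "real^'n"
    by (auto intro!: derivative_eq_intros)
  show ?thesis
    unfolding has_hessian_def
  proof (intro conjI ballI allI)
    fix x i assume x: "x \<in> T"
    show "((\<lambda>x. u (c *\<^sub>R x)) has_derivative (\<lambda>h. (c *\<^sub>R G (c *\<^sub>R x)) \<bullet> h)) (at x)"
      using has_derivative_compose[OF sc h(1)[OF assms(2)[OF x]]] by simp
    have "((\<lambda>x. c * G (c *\<^sub>R x) $ i) has_derivative (\<lambda>h. c * (H (c *\<^sub>R x) $ i \<bullet> (c *\<^sub>R h)))) (at x)"
      by (intro has_derivative_mult_right has_derivative_compose[OF sc h(2)[OF assms(2)[OF x]]])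
    then show "((\<lambda>x. (c *\<^sub>R G (c *\<^sub>R x)) $ i) has_derivative (\<lambda>h. (c\<^sup>2 *\<^sub>R H (c *\<^sub>R x)) $ i \<bullet> h)) (at x)"
      by (simp add: power2_eq_square mult_ac)
  next
    show "continuous_on T (\<lambda>x. c\<^sup>2 *\<^sub>R H (c *\<^sub>R x))"
      by (intro continuous_intros continuous_on_compose2[OF h(5)]) (use assms(2) in auto)
  qed
qed

text \<open>The vector in brackets is the gradient of z_i B_j - z_j B_i when \<open>B\<close> has
  derivative \<open>H\<close>, so the left side sums all squares of rotation fields. The Kronecker
  terms contribute \<open>2 * (B \<bullet> z)\<close>, and the terms summed over a free index
  contribute \<open>2 * trace H\<close> and -2n times \<open>B \<bullet> z\<close>.\<close>

lemma sum_rotation_terms: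
  fixes H :: "real^'n^'n::finite" and z B :: "real^'n"
  assumes "norm z = 1"
  shows "(\<Sum>i\<in>UNIV. \<Sum>j\<in>UNIV.
      z $ i * (B $ j *\<^sub>R axis i 1 + z $ i *\<^sub>R H $ j - B $ i *\<^sub>R axis j 1 - z $ j *\<^sub>R H $ i) $ j
    - z $ j * (B $ j *\<^sub>R axis i 1 + z $ i *\<^sub>R H $ j - B $ i *\<^sub>R axis j 1 - z $ j *\<^sub>R H $ i) $ i)
    = 2 * (trace H - quadratic_form H z - (real CARD('n) - 1) * (B \<bullet> z))"
proof -
  have zz: "(\<Sum>i\<in>UNIV. z $ i * z $ i) = 1"
    using assms by (simp add: norm_eq_1 inner_vec_def)
  have ax: "axis i 1 $ j = (if j = i then 1 else 0::real)" for i j :: 'n by (simp add: axis_def)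
  have "(\<Sum>i\<in>UNIV. \<Sum>j\<in>UNIV.
      z $ i * (B $ j *\<^sub>R axis i 1 + z $ i *\<^sub>R H $ j - B $ i *\<^sub>R axis j 1 - z $ j *\<^sub>R H $ i) $ j
    - z $ j * (B $ j *\<^sub>R axis i 1 + z $ i *\<^sub>R H $ j - B $ i *\<^sub>R axis j 1 - z $ j *\<^sub>R H $ i) $ i)
   = (\<Sum>i\<in>UNIV. \<Sum>j\<in>UNIV. (if j = i then z $ i * B $ j else 0) + (if i = j then z $ j * B $ i else 0)
      + (z $ i * z $ i) * H $ j $ j + (z $ j * z $ j) * H $ i $ i
      - z $ i * B $ i - z $ j * B $ j - z $ i * (z $ j * H $ i $ j) - z $ j * (z $ i * H $ j $ i))"
    by (intro sum.cong refl) (simp add: ax algebra_simps)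
  also have "\<dots> = (\<Sum>i\<in>UNIV. z $ i * B $ i) + (\<Sum>i\<in>UNIV. z $ i * B $ i)
      + (\<Sum>i\<in>UNIV. z $ i * z $ i) * (\<Sum>j\<in>UNIV. H $ j $ j) + (\<Sum>i\<in>UNIV. z $ i * z $ i) * (\<Sum>j\<in>UNIV. H $ j $ j)
      - CARD('n) * (\<Sum>i\<in>UNIV. z $ i * B $ i) - CARD('n) * (\<Sum>i\<in>UNIV. z $ i * B $ i)
      - (\<Sum>i\<in>UNIV. \<Sum>j\<in>UNIV. z $ i * (z $ j * H $ i $ j)) - (\<Sum>j\<in>UNIV. \<Sum>i\<in>UNIV. z $ j * (z $ i * H $ j $ i))"
  proof -
    have 1: "(\<Sum>i\<in>UNIV. \<Sum>j\<in>UNIV. (z $ i * z $ i) * H $ j $ j) = (\<Sum>i\<in>UNIV. z $ i * z $ i) * (\<Sum>j\<in>UNIV. H $ j $ j)"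
      by (simp add: sum_product)
    then have 2: "(\<Sum>i\<in>UNIV. \<Sum>j\<in>UNIV. (z $ j * z $ j) * H $ i $ i) = (\<Sum>i\<in>UNIV. z $ i * z $ i) * (\<Sum>j\<in>UNIV. H $ j $ j)"
      by (subst sum.swap)
    have 3: "(\<Sum>i\<in>UNIV. \<Sum>j\<in>UNIV. z $ j * (z $ i * H $ j $ i)) = (\<Sum>j\<in>UNIV. \<Sum>i\<in>UNIV. z $ j * (z $ i * H $ j $ i))"
      by (rule sum.swap)
    show ?thesis
      unfolding sum.distrib sum_subtractf 1 2 3 by (simp add: sum_distrib_left)
  qed
  also have "(\<Sum>j\<in>UNIV. \<Sum>i\<in>UNIV. z $ j * (z $ i * H $ j $ i)) = quadratic_form H z"
    by (simp add: quadratic_form_def inner_vec_def sum_distrib_left mult_ac)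
  also have "(\<Sum>i\<in>UNIV. z $ i * B $ i) = B \<bullet> z" by (simp add: inner_vec_def mult.commute)
  finally show ?thesis by (simp add: zz trace_def algebra_simps)
qed

lemma continuous_on_quadratic_form [continuous_intros]:
  "continuous_on S f \<Longrightarrow> continuous_on S g \<Longrightarrow> continuous_on S (\<lambda>x. quadratic_form (f x) (g x))"
  unfolding quadratic_form_def by (intro continuous_intros)

lemma continuous_on_trace [continuous_intros]:
  "continuous_on S f \<Longrightarrow> continuous_on S (\<lambda>x. trace (f x :: real^'n^'n::finite))"
  unfolding trace_def by (intro continuous_intros)

text \<open>The Laplace-Beltrami operator of the unit sphere in Euclidean terms: the full Laplacian
  minus the second radial derivative minus n - 1 times the first.\<close>

definition sphere_laplacian :: "real^'n \<Rightarrow> real^'n^'n::finite \<Rightarrow> real^'n \<Rightarrow> real" where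
  "sphere_laplacian G H z = trace H - quadratic_form H z - (real CARD('n) - 1) * (G \<bullet> z)"

text \<open>With \<open>L\<^sub>i\<^sub>j = z\<^sub>i \<partial>\<^sub>j - z\<^sub>j \<partial>\<^sub>i\<close>, half the sum of all \<open>L\<^sub>i\<^sub>j\<^sup>2\<close> is the spherical Laplacian, and
  \<open>a L\<^sub>i\<^sub>j\<^sup>2 b - b L\<^sub>i\<^sub>j\<^sup>2 a = L\<^sub>i\<^sub>j (a L\<^sub>i\<^sub>j b - b L\<^sub>i\<^sub>j a)\<close> has mean zero.\<close>

lemma sphere_mean_green:
  fixes a b :: "real^'n::finite \<Rightarrow> real"
  assumes ha: "has_hessian (sphere 0 1) a A HA" and hb: "has_hessian (sphere 0 1) b B HB"
  shows "sphere_mean (\<lambda>z. a z * sphere_laplacian (B z) (HB z) z - b z * sphere_laplacian (A z) (HA z) z) = 0"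
proof -
  note a = has_hessianD[OF ha] and b = has_hessianD[OF hb]
  define L where "L B i j z = z $ i * B z $ j - z $ j * B z $ i"
    for B :: "real^'n \<Rightarrow> real^'n" and i j z
  define DL where "DL B H i j z = B z $ j *\<^sub>R axis i 1 + z $ i *\<^sub>R H z $ j - B z $ i *\<^sub>R axis j 1 - z $ j *\<^sub>R H z $ i"
    for B :: "real^'n \<Rightarrow> real^'n" and H :: "real^'n \<Rightarrow> real^'n^'n" and i j z
  have L: "(L B i j has_derivative (\<lambda>h. DL B HB i j z \<bullet> h)) (at z)"
    if "has_hessian (sphere 0 1) b B HB" "norm z = 1" for B HB b i j z
  proof -
    have v: "((\<lambda>y. y $ k) has_derivative (\<lambda>h. h $ k)) (at y)" for y :: "real^'n" and k
      by (rule bounded_linear_imp_has_derivative[OF bounded_linear_vec_nth])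
    have B: "((\<lambda>y. B y $ k) has_derivative (\<lambda>h. HB z $ k \<bullet> h)) (at z)" for k
      using has_hessianD(2)[OF that(1)] that(2) by simp
    have "(L B i j has_derivative (\<lambda>h. (z $ i * (HB z $ j \<bullet> h) + h $ i * B z $ j) -
        (z $ j * (HB z $ i \<bullet> h) + h $ j * B z $ i))) (at z)"
      unfolding L_def[abs_def] by (intro has_derivative_diff has_derivative_mult v B)
    then show ?thesis
      by (rule has_derivative_eq_rhs)
        (simp add: DL_def fun_eq_iff inner_add_left inner_diff_left inner_axis' algebra_simps)
  qed
  define g where "g i j z = a z * L B i j z - b z * L A i j z" for i j z
  define G where "G i j z = a z *\<^sub>R DL B HB i j z + L B i j z *\<^sub>R A z - b z *\<^sub>R DL A HA i j z - L A i j z *\<^sub>R B z" for i j z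
  have g: "(g i j has_derivative (\<lambda>h. G i j z \<bullet> h)) (at z)" if z: "norm z = 1" for i j z
  proof -
    have "(g i j has_derivative (\<lambda>h. (a z * (DL B HB i j z \<bullet> h) + (A z \<bullet> h) * L B i j z)
       - (b z * (DL A HA i j z \<bullet> h) + (B z \<bullet> h) * L A i j z))) (at z)"
      unfolding g_def[abs_def] using z
      by (intro has_derivative_diff has_derivative_mult L[OF ha] L[OF hb] a(1) b(1)) auto
    then show ?thesis
      by (rule has_derivative_eq_rhs) (simp add: G_def fun_eq_iff inner_add_left inner_diff_left mult_ac)
  qed
  have cG: "continuous_on (sphere 0 1) (G i j)" for i j
    unfolding G_def[abs_def] DL_def L_def by (intro continuous_intros a b)
  \<comment> \<open>The product \<open>L A i j z * L B i j z\<close> arises twice with opposite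
    signs, so only second-order terms remain.\<close>
  have pt: "z $ i * G i j z $ j - z $ j * G i j z $ i =
      a z * (z $ i * DL B HB i j z $ j - z $ j * DL B HB i j z $ i)
    - b z * (z $ i * DL A HA i j z $ j - z $ j * DL A HA i j z $ i)" for i j z
    by (simp add: G_def L_def algebra_simps)
  have "0 = (\<Sum>i\<in>UNIV. \<Sum>j\<in>UNIV. sphere_mean (\<lambda>z. z $ i * G i j z $ j - z $ j * G i j z $ i))"
    by (simp add: sphere_mean_rotation_derivative[OF g cG])
  also have "\<dots> = sphere_mean (\<lambda>z. \<Sum>i\<in>UNIV. \<Sum>j\<in>UNIV. z $ i * G i j z $ j - z $ j * G i j z $ i)"
    by (simp only: sphere_mean_sum continuous_intros cG)
  also have "\<dots> = sphere_mean (\<lambda>z. 2 * (a z * sphere_laplacian (B z) (HB z) z - b z * sphere_laplacian (A z) (HA z) z))"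
  proof (rule sphere_mean_cong)
    fix z :: "real^'n" assume z: "norm z = 1"
    have S: "(\<Sum>i\<in>UNIV. \<Sum>j\<in>UNIV. z $ i * DL B HB i j z $ j - z $ j * DL B HB i j z $ i) =
      2 * sphere_laplacian (B z) (HB z) z" for B HB
      unfolding DL_def sphere_laplacian_def by (rule sum_rotation_terms[OF z])
    have "(\<Sum>i\<in>UNIV. \<Sum>j\<in>UNIV. z $ i * G i j z $ j - z $ j * G i j z $ i) =
      a z * (\<Sum>i\<in>UNIV. \<Sum>j\<in>UNIV. z $ i * DL B HB i j z $ j - z $ j * DL B HB i j z $ i) -
      b z * (\<Sum>i\<in>UNIV. \<Sum>j\<in>UNIV. z $ i * DL A HA i j z $ j - z $ j * DL A HA i j z $ i)"
      unfolding pt sum_subtractf[symmetric] sum_distrib_left ..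
    then show "(\<Sum>i\<in>UNIV. \<Sum>j\<in>UNIV. z $ i * G i j z $ j - z $ j * G i j z $ i) =
      2 * (a z * sphere_laplacian (B z) (HB z) z - b z * sphere_laplacian (A z) (HA z) z)"
      unfolding S by (simp add: algebra_simps)
  qed
  also have "\<dots> = 2 * sphere_mean (\<lambda>z. a z * sphere_laplacian (B z) (HB z) z - b z * sphere_laplacian (A z) (HA z) z)"
    unfolding sphere_laplacian_def by (intro sphere_mean_cmult continuous_intros a b)
  finally show ?thesis by simp
qed

section \<open>Radial flux and products of harmonic functions\<close>

lemma radial_DERIV:
  assumes "has_hessian S u G H" "\<rho> *\<^sub>R z \<in> S"
  shows "((\<lambda>\<rho>. u (\<rho> *\<^sub>R z)) has_real_derivative G (\<rho> *\<^sub>R z) \<bullet> z) (at \<rho>)"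
    and "((\<lambda>\<rho>. G (\<rho> *\<^sub>R z) \<bullet> z) has_real_derivative quadratic_form (H (\<rho> *\<^sub>R z)) z) (at \<rho>)"
proof -
  note h = has_hessianD[OF assms(1)]
  have sc: "((\<lambda>\<rho>. \<rho> *\<^sub>R z) has_derivative (\<lambda>h. h *\<^sub>R z)) (at \<rho>)"
    by (auto intro!: derivative_eq_intros)
  show "((\<lambda>\<rho>. u (\<rho> *\<^sub>R z)) has_real_derivative G (\<rho> *\<^sub>R z) \<bullet> z) (at \<rho>)"
    using has_derivative_compose[OF sc h(1)[OF assms(2)]]
    by (simp add: has_field_derivative_def mult_commute_abs)
  have "((\<lambda>\<rho>. G (\<rho> *\<^sub>R z) $ i) has_real_derivative (H (\<rho> *\<^sub>R z) $ i \<bullet> z)) (at \<rho>)" for i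
    using has_derivative_compose[OF sc h(2)[OF assms(2)]]
    by (simp add: has_field_derivative_def mult_commute_abs)
  then have "((\<lambda>\<rho>. \<Sum>i\<in>UNIV. z $ i * G (\<rho> *\<^sub>R z) $ i) has_real_derivative
      (\<Sum>i\<in>UNIV. z $ i * (H (\<rho> *\<^sub>R z) $ i \<bullet> z))) (at \<rho>)"
    by (intro DERIV_sum DERIV_cmult)
  then show "((\<lambda>\<rho>. G (\<rho> *\<^sub>R z) \<bullet> z) has_real_derivative quadratic_form (H (\<rho> *\<^sub>R z)) z) (at \<rho>)"
    by (simp add: quadratic_form_def inner_vec_def[of "G _"] mult.commute)
qed

text \<open>If \<open>D(\<rho>)\<close> is the mean of \<open>a \<partial>\<^sub>r b - b \<partial>\<^sub>r a\<close> over the sphere of radius \<open>\<rho>\<close>, then Green's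
  identity gives \<open>\<rho> D' + (n - 1) D = 0\<close>, so \<open>\<rho>\<^sup>n\<^sup>-\<^sup>1 D\<close> is constant, hence zero.\<close>

lemma sphere_mean_harmonic_flux:
  fixes a b :: "real^'n::finite \<Rightarrow> real"
  assumes n: "CARD('n) \<ge> 2" and R: "R > 1"
    and ha: "has_hessian (ball 0 R) a A HA" and hb: "has_hessian (ball 0 R) b B HB"
    and tr: "\<And>x. x \<in> ball 0 R \<Longrightarrow> trace (HA x) = 0" "\<And>x. x \<in> ball 0 R \<Longrightarrow> trace (HB x) = 0"
  shows "sphere_mean (\<lambda>z. a z * (B z \<bullet> z) - b z * (A z \<bullet> z)) = 0"
proof -
  note a = has_hessianD[OF ha] and b = has_hessianD[OF hb]
  define U where "U = {-R<..<R}"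
  have U: "\<rho> *\<^sub>R z \<in> ball 0 R" if "\<rho> \<in> U" "norm z = 1" for \<rho> and z :: "real^'n"
    using that by (auto simp: U_def)
  define K where "K \<rho> z = a (\<rho> *\<^sub>R z) * (B (\<rho> *\<^sub>R z) \<bullet> z) - b (\<rho> *\<^sub>R z) * (A (\<rho> *\<^sub>R z) \<bullet> z)" for \<rho> z
  define K' where "K' \<rho> z = a (\<rho> *\<^sub>R z) * quadratic_form (HB (\<rho> *\<^sub>R z)) z
    - b (\<rho> *\<^sub>R z) * quadratic_form (HA (\<rho> *\<^sub>R z)) z" for \<rho> z
  define D where "D \<rho> = sphere_mean (K \<rho>)" for \<rho>
  have cont: "continuous_on (U \<times> sphere 0 1) (\<lambda>p. f (fst p *\<^sub>R snd p))"
    if "continuous_on (ball 0 R) f" for f :: "real^'n \<Rightarrow> 'b::topological_space"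
    by (rule continuous_on_compose2[OF that]) (use U in \<open>auto intro!: continuous_intros\<close>)
  have cont1: "continuous_on (sphere 0 1) (\<lambda>z. f (\<rho> *\<^sub>R z))"
    if "continuous_on (ball 0 R) f" "\<rho> \<in> U" for \<rho> and f :: "real^'n \<Rightarrow> 'b::topological_space"
    by (rule continuous_on_compose2[OF that(1)]) (use U that in \<open>auto intro!: continuous_intros\<close>)
  have D: "(D has_real_derivative sphere_mean (K' \<rho>)) (at \<rho>)" if "\<rho> \<in> U" for \<rho>
    unfolding D_def[abs_def]
  proof (rule sphere_mean_DERIV[OF _ that])
    show "open U" by (simp add: U_def)
  next
    fix \<rho> and z :: "real^'n" assume "\<rho> \<in> U" "norm z = 1"
    then have in_ball: "\<rho> *\<^sub>R z \<in> ball 0 R" by (rule U)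
    have "((\<lambda>\<rho>. K \<rho> z) has_real_derivative
        ((A (\<rho> *\<^sub>R z) \<bullet> z) * (B (\<rho> *\<^sub>R z) \<bullet> z) + quadratic_form (HB (\<rho> *\<^sub>R z)) z * a (\<rho> *\<^sub>R z)) -
        ((B (\<rho> *\<^sub>R z) \<bullet> z) * (A (\<rho> *\<^sub>R z) \<bullet> z) + quadratic_form (HA (\<rho> *\<^sub>R z)) z * b (\<rho> *\<^sub>R z))) (at \<rho>)"
      unfolding K_def
      by (intro DERIV_diff DERIV_mult radial_DERIV[OF ha in_ball] radial_DERIV[OF hb in_ball])
    then show "((\<lambda>\<rho>. K \<rho> z) has_real_derivative K' \<rho> z) (at \<rho>)"
      by (simp add: K'_def mult.commute)
  next
    fix \<rho> assume "\<rho> \<in> U"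
    then show "continuous_on (sphere 0 1) (K \<rho>)"
      unfolding K_def by (intro continuous_intros cont1 a b)
  next
    show "continuous_on (U \<times> sphere 0 1) (\<lambda>(\<rho>, z). K' \<rho> z)"
      unfolding K'_def split_beta by (intro continuous_intros cont a b)
  qed
  have ode: "\<rho> * sphere_mean (K' \<rho>) + (real CARD('n) - 1) * D \<rho> = 0" if \<rho>: "\<rho> \<in> U" "\<rho> > 0" for \<rho>
  proof -
    have sph: "\<rho> *\<^sub>R z \<in> ball 0 R" if "z \<in> sphere 0 1" for z :: "real^'n" using \<rho> that by (intro U) auto
    have c: "continuous_on (sphere 0 1) (K \<rho>)" "continuous_on (sphere 0 1) (K' \<rho>)"
      unfolding K_def K'_def using \<rho> by (intro continuous_intros cont1 a b; simp)+
    \<comment> \<open>For a trace-free Hessian, the rescaled function on the unit sphere has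
      spherical Laplacian equal to minus \<rho>^2 times the second radial derivative minus (n - 1)
      \<rho> times the first. Green's identity thereby links \<open>K'\<close> and
      \<open>K\<close>.\<close>
    have "0 = sphere_mean (\<lambda>z. a (\<rho> *\<^sub>R z) * sphere_laplacian (\<rho> *\<^sub>R B (\<rho> *\<^sub>R z)) (\<rho>\<^sup>2 *\<^sub>R HB (\<rho> *\<^sub>R z)) z
        - b (\<rho> *\<^sub>R z) * sphere_laplacian (\<rho> *\<^sub>R A (\<rho> *\<^sub>R z)) (\<rho>\<^sup>2 *\<^sub>R HA (\<rho> *\<^sub>R z)) z)"
      by (rule sphere_mean_green[symmetric]) (rule has_hessian_scale[OF ha sph] has_hessian_scale[OF hb sph]; assumption)+
    also have "\<dots> = sphere_mean (\<lambda>z. (- \<rho>\<^sup>2) * K' \<rho> z - ((real CARD('n) - 1) * \<rho>) * K \<rho> z)"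
    proof (rule sphere_mean_cong)
      fix z :: "real^'n" assume "norm z = 1"
      then have "trace (\<rho>\<^sup>2 *\<^sub>R HA (\<rho> *\<^sub>R z)) = 0" "trace (\<rho>\<^sup>2 *\<^sub>R HB (\<rho> *\<^sub>R z)) = 0"
        using tr sph by (auto simp: trace_def simp flip: sum_distrib_left)
      moreover have "quadratic_form (c *\<^sub>R H) z = c * quadratic_form H z" for c H
        by (simp add: quadratic_form_def sum_distrib_left mult_ac)
      ultimately show "a (\<rho> *\<^sub>R z) * sphere_laplacian (\<rho> *\<^sub>R B (\<rho> *\<^sub>R z)) (\<rho>\<^sup>2 *\<^sub>R HB (\<rho> *\<^sub>R z)) z
        - b (\<rho> *\<^sub>R z) * sphere_laplacian (\<rho> *\<^sub>R A (\<rho> *\<^sub>R z)) (\<rho>\<^sup>2 *\<^sub>R HA (\<rho> *\<^sub>R z)) z =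
        (- \<rho>\<^sup>2) * K' \<rho> z - ((real CARD('n) - 1) * \<rho>) * K \<rho> z"
        by (simp add: sphere_laplacian_def K_def K'_def algebra_simps)
    qed
    also have "\<dots> = (- \<rho>\<^sup>2) * sphere_mean (K' \<rho>) - ((real CARD('n) - 1) * \<rho>) * D \<rho>"
      unfolding D_def using c
      by (subst sphere_mean_diff) (auto intro!: continuous_intros simp only: sphere_mean_cmult)
    finally have "\<rho> * (\<rho> * sphere_mean (K' \<rho>) + (real CARD('n) - 1) * D \<rho>) = 0"
      by (simp add: power2_eq_square algebra_simps)
    then show ?thesis using \<rho> by simp
  qed
  \<comment> \<open>The exponent \<open>Suc k\<close> is n - 1. It is positive since n \<ge> 2, so
    the power at radius 0 kills \<open>D 0\<close>.\<close>
  obtain k where k: "CARD('n) = Suc (Suc k)" using n by (metis Suc_le_D numeral_2_eq_2 Suc_le_mono)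
  have "1 ^ Suc k * D 1 = 0 ^ Suc k * D 0"
  proof (rule DERIV_isconst_end[where f = "\<lambda>\<rho>. \<rho> ^ Suc k * D \<rho>"])
    show "continuous_on {0..1} (\<lambda>\<rho>. \<rho> ^ Suc k * D \<rho>)"
      by (intro continuous_intros DERIV_continuous_on[where D = "\<lambda>\<rho>. sphere_mean (K' \<rho>)"] has_field_derivative_at_within[OF D])
         (use R in \<open>auto simp: U_def\<close>)
  next
    fix \<rho> :: real assume \<rho>: "0 < \<rho>" "\<rho> < 1"
    then have "\<rho> \<in> U" using R by (auto simp: U_def)
    have "((\<lambda>\<rho>. \<rho> ^ Suc k * D \<rho>) has_real_derivative
      (real (Suc k) * \<rho> ^ k) * D \<rho> + sphere_mean (K' \<rho>) * \<rho> ^ Suc k) (at \<rho>)"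
      by (rule DERIV_mult[OF _ D[OF \<open>\<rho> \<in> U\<close>]]) (use DERIV_pow[of "Suc k" \<rho>] in simp)
    also have "(real (Suc k) * \<rho> ^ k) * D \<rho> + sphere_mean (K' \<rho>) * \<rho> ^ Suc k =
       \<rho> ^ k * (\<rho> * sphere_mean (K' \<rho>) + (real CARD('n) - 1) * D \<rho>)"
      unfolding k by (simp add: algebra_simps)
    also have "\<dots> = 0" using ode[OF \<open>\<rho> \<in> U\<close>] \<rho> by simp
    finally show "((\<lambda>\<rho>. \<rho> ^ Suc k * D \<rho>) has_real_derivative 0) (at \<rho>)" .
  qed simp
  then show ?thesis by (simp add: D_def K_def[abs_def])
qed

text \<open>Along the curve s t = c, the derivative of the mean in \<open>s\<close> is -1/s times
  the flux mean of the two rescaled functions, which vanishes by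
  \<open>sphere_mean_harmonic_flux\<close>.\<close>

lemma sphere_mean_harmonic_product:
  fixes a b :: "real^'n::finite \<Rightarrow> real"
  assumes n: "CARD('n) \<ge> 2" and c: "0 < c" "s \<in> {c<..<1}" "s' \<in> {c<..<1}"
    and ha: "has_hessian (ball 0 1) a A HA" and hb: "has_hessian (ball 0 1) b B HB"
    and tr: "\<And>x. x \<in> ball 0 1 \<Longrightarrow> trace (HA x) = 0" "\<And>x. x \<in> ball 0 1 \<Longrightarrow> trace (HB x) = 0"
  shows "sphere_mean (\<lambda>z. a (s *\<^sub>R z) * b ((c / s) *\<^sub>R z)) = sphere_mean (\<lambda>z. a (s' *\<^sub>R z) * b ((c / s') *\<^sub>R z))"
proof (rule DERIV_isconst3[OF _ c(2,3)])
  note a = has_hessianD[OF ha] and b = has_hessianD[OF hb]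
  let ?U = "{c<..<1}"
  show "c < 1" using c by auto
  fix s assume s: "s \<in> ?U"
  have s1: "s *\<^sub>R z \<in> ball 0 1" "(c / s) *\<^sub>R z \<in> ball 0 1" if "s \<in> ?U" "norm z = 1" for s and z :: "real^'n"
    using that c(1) by (auto simp: field_simps)
  have cont: "continuous_on (?U \<times> sphere 0 1) (\<lambda>p. f (fst p *\<^sub>R snd p))"
      "continuous_on (?U \<times> sphere 0 1) (\<lambda>p. f ((c / fst p) *\<^sub>R snd p))"
    if "continuous_on (ball 0 1) f" for f :: "real^'n \<Rightarrow> 'b::topological_space"
    by (rule continuous_on_compose2[OF that]; use s1 c(1) in \<open>auto intro!: continuous_intros simp del: mem_ball_0\<close>)+
  have cont1: "continuous_on (sphere 0 1) (\<lambda>z. f (s *\<^sub>R z))"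
      "continuous_on (sphere 0 1) (\<lambda>z. f ((c / s) *\<^sub>R z))"
    if "continuous_on (ball 0 1) f" "s \<in> ?U" for s and f :: "real^'n \<Rightarrow> 'b::topological_space"
    by (rule continuous_on_compose2[OF that(1)]; use s1 that in \<open>auto intro!: continuous_intros simp del: mem_ball_0\<close>)+
  define K' where "K' s z = (A (s *\<^sub>R z) \<bullet> z) * b ((c / s) *\<^sub>R z) - (c / s\<^sup>2) * (a (s *\<^sub>R z) * (B ((c / s) *\<^sub>R z) \<bullet> z))" for s z
  have "((\<lambda>s. sphere_mean (\<lambda>z. a (s *\<^sub>R z) * b ((c / s) *\<^sub>R z))) has_real_derivative sphere_mean (K' s)) (at s)"
  proof (rule sphere_mean_DERIV[OF _ s])
    fix s and z :: "real^'n" assume s: "s \<in> ?U" and z: "norm z = 1"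
    have "((\<lambda>s. c / s) has_real_derivative - c / s\<^sup>2) (at s)"
      using s c(1) by (auto intro!: derivative_eq_intros simp: power2_eq_square)
    note DERIV_chain2[OF radial_DERIV(1)[OF hb s1(2)[OF s z]] this]
    from DERIV_mult[OF radial_DERIV(1)[OF ha s1(1)[OF s z]] this]
    show "((\<lambda>s. a (s *\<^sub>R z) * b ((c / s) *\<^sub>R z)) has_real_derivative K' s z) (at s)"
      by (simp add: K'_def mult_ac)
  next
    fix s assume "s \<in> ?U"
    then show "continuous_on (sphere 0 1) (\<lambda>z. a (s *\<^sub>R z) * b ((c / s) *\<^sub>R z))"
      by (intro continuous_intros cont1 a b)
  next
    show "continuous_on (?U \<times> sphere 0 1) (\<lambda>(s, z). K' s z)"
      unfolding K'_def split_beta using c(1) by (intro continuous_intros cont a b) auto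
  qed simp
  moreover have "sphere_mean (K' s) = 0"
  proof -
    \<comment> \<open>The two rescaled functions are harmonic on balls of radii \<open>1 / s\<close>
      and \<open>s / c\<close>, both larger than 1.\<close>
    let ?t = "c / s" and ?R = "min (1 / s) (s / c)"
    have R: "?R > 1" using s c(1) by (auto simp: field_simps)
    have sub: "s *\<^sub>R x \<in> ball 0 1" "?t *\<^sub>R x \<in> ball 0 1" if "x \<in> ball 0 ?R" for x :: "real^'n"
      using that s c(1) by (auto simp: field_simps)
    have "sphere_mean (\<lambda>z. a (s *\<^sub>R z) * ((?t *\<^sub>R B (?t *\<^sub>R z)) \<bullet> z) - b (?t *\<^sub>R z) * ((s *\<^sub>R A (s *\<^sub>R z)) \<bullet> z)) = 0"
    proof (rule sphere_mean_harmonic_flux[OF n R has_hessian_scale[OF ha sub(1)] has_hessian_scale[OF hb sub(2)]])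
      fix x :: "real^'n" assume "x \<in> ball 0 ?R"
      then have "trace (HA (s *\<^sub>R x)) = 0" "trace (HB (?t *\<^sub>R x)) = 0" using tr sub by blast+
      then show "trace (s\<^sup>2 *\<^sub>R HA (s *\<^sub>R x)) = 0" "trace (?t\<^sup>2 *\<^sub>R HB (?t *\<^sub>R x)) = 0"
        by (simp_all add: trace_def flip: sum_distrib_left)
    qed
    moreover have "K' s = (\<lambda>z. - (1 / s) * (a (s *\<^sub>R z) * ((?t *\<^sub>R B (?t *\<^sub>R z)) \<bullet> z) - b (?t *\<^sub>R z) * ((s *\<^sub>R A (s *\<^sub>R z)) \<bullet> z)))"
      using s c(1) by (simp add: fun_eq_iff K'_def power2_eq_square field_simps)
    moreover have "sphere_mean (\<lambda>z. - (1 / s) * (a (s *\<^sub>R z) * ((?t *\<^sub>R B (?t *\<^sub>R z)) \<bullet> z) - b (?t *\<^sub>R z) * ((s *\<^sub>R A (s *\<^sub>R z)) \<bullet> z))) =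
      - (1 / s) * sphere_mean (\<lambda>z. a (s *\<^sub>R z) * ((?t *\<^sub>R B (?t *\<^sub>R z)) \<bullet> z) - b (?t *\<^sub>R z) * ((s *\<^sub>R A (s *\<^sub>R z)) \<bullet> z))"
      using s by (intro sphere_mean_cmult continuous_intros cont1 a b)
    ultimately show ?thesis by (simp only: mult_zero_right)
  qed
  ultimately show "((\<lambda>s. sphere_mean (\<lambda>z. a (s *\<^sub>R z) * b ((c / s) *\<^sub>R z))) has_real_derivative 0) (at s)"
    by simp
qed

section \<open>The Poisson formula\<close>

lemma sphere_mean_has_hessian:
  fixes K :: "real^'n::finite \<Rightarrow> real^'n \<Rightarrow> real"
  assumes U: "open U"
    and K: "\<And>z. norm z = 1 \<Longrightarrow> has_hessian U (\<lambda>x. K x z) (\<lambda>x. G x z) (\<lambda>x. H x z)"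
    and cK: "\<And>x. x \<in> U \<Longrightarrow> continuous_on (sphere 0 1) (K x)"
    and cG: "continuous_on (U \<times> sphere 0 1) (\<lambda>(x, z). G x z)"
    and cH: "continuous_on (U \<times> sphere 0 1) (\<lambda>(x, z). H x z)"
  shows "has_hessian U (\<lambda>x. sphere_mean (K x)) (\<lambda>x. sphere_mean (G x)) (\<lambda>x. sphere_mean (H x))"
proof -
  have sec: "continuous_on (sphere 0 1) (F x)" if "continuous_on (U \<times> sphere 0 1) (\<lambda>(x, z). F x z)" "x \<in> U"
    for F :: "real^'n \<Rightarrow> real^'n \<Rightarrow> 'b::topological_space" and x
    using continuous_on_compose2[OF that(1), of "sphere 0 1" "\<lambda>z. (x, z)"] that(2)
    by (simp add: continuous_on_Pair image_subset_iff)
  have comp: "sphere_mean (\<lambda>z. F x z $ i) = sphere_mean (F x) $ i"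
    if "continuous_on (U \<times> sphere 0 1) (\<lambda>(x, z). F x z)" "x \<in> U"
    for F :: "real^'n \<Rightarrow> real^'n \<Rightarrow> ('b::euclidean_space)^'n" and x i
    by (rule sphere_mean_linear[OF sec[OF that] bounded_linear_vec_nth])
  show ?thesis
    unfolding has_hessian_def
  proof (intro conjI ballI allI)
    fix x i assume x: "x \<in> U"
    show "((\<lambda>x. sphere_mean (K x)) has_derivative (\<lambda>h. sphere_mean (G x) \<bullet> h)) (at x)"
      by (rule sphere_mean_has_derivative[OF U x has_hessianD(1)[OF K] cK cG])
    have "((\<lambda>x. sphere_mean (\<lambda>z. G x z $ i)) has_derivative (\<lambda>h. sphere_mean (\<lambda>z. H x z $ i) \<bullet> h)) (at x)"
      using cH sec[OF cG]
      by (intro sphere_mean_has_derivative[OF U x has_hessianD(2)[OF K]] continuous_intros)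
         (auto simp: split_beta intro!: continuous_intros)
    then have "((\<lambda>x. sphere_mean (\<lambda>z. G x z $ i)) has_derivative (\<lambda>h. sphere_mean (H x) $ i \<bullet> h)) (at x)"
      by (simp only: comp[OF cH x])
    then show "((\<lambda>x. sphere_mean (G x) $ i) has_derivative (\<lambda>h. sphere_mean (H x) $ i \<bullet> h)) (at x)"
      by (rule has_derivative_transform_within_open[OF _ U x]) (rule comp[OF cG])
  qed (rule sphere_mean_continuous_on[OF cH])
qed

section \<open>The Poisson kernel and its derivatives\<close>

text \<open>The power is taken of the squared distance, which is polynomial in \<open>x\<close>. The
  usual surface area constant is absent because means are normalized.\<close>

definition poisson_kernel :: "real^'n::finite \<Rightarrow> real^'n \<Rightarrow> real" where
  "poisson_kernel x z = (1 - x \<bullet> x) * ((x - z) \<bullet> (x - z)) powr (- real CARD('n) / 2)"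

definition poisson_gradient :: "real^'n::finite \<Rightarrow> real^'n \<Rightarrow> real^'n" where
  "poisson_gradient x z =
     (- 2 * ((x - z) \<bullet> (x - z)) powr (- real CARD('n) / 2)) *\<^sub>R x -
     (real CARD('n) * (1 - x \<bullet> x) * ((x - z) \<bullet> (x - z)) powr (- real CARD('n) / 2 - 1)) *\<^sub>R (x - z)"

definition poisson_hessian :: "real^'n::finite \<Rightarrow> real^'n \<Rightarrow> real^'n^'n" where
  "poisson_hessian x z = (let n = real CARD('n); q = (x - z) \<bullet> (x - z); m = 1 - x \<bullet> x in
     \<chi> i. (- 2 * q powr (- n / 2) - n * m * q powr (- n / 2 - 1)) *\<^sub>R axis i 1
       + (2 * n * q powr (- n / 2 - 1) * x $ i + n * (n + 2) * m * q powr (- n / 2 - 2) * (x - z) $ i) *\<^sub>R (x - z)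
       + (2 * n * q powr (- n / 2 - 1) * (x - z) $ i) *\<^sub>R x)"

lemma continuous_on_poisson:
  fixes f g :: "'a::topological_space \<Rightarrow> real^'n::finite"
  assumes "continuous_on S f" "continuous_on S g" "\<And>x. x \<in> S \<Longrightarrow> f x \<noteq> g x"
  shows "continuous_on S (\<lambda>x. poisson_kernel (f x) (g x))"
    "continuous_on S (\<lambda>x. poisson_gradient (f x) (g x))"
    "continuous_on S (\<lambda>x. poisson_hessian (f x) (g x))"
  unfolding poisson_kernel_def poisson_gradient_def poisson_hessian_def Let_def
  by (intro continuous_intros assms(1,2); use assms(3) in simp)+

lemma norm_square_powr_has_derivative:
  fixes x z :: "'a::real_inner"
  assumes "x \<noteq> z"
  shows "((\<lambda>x. ((x - z) \<bullet> (x - z)) powr p) has_derivative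
    (\<lambda>h. 2 * p * ((x - z) \<bullet> (x - z)) powr (p - 1) * ((x - z) \<bullet> h))) (at x)"
proof -
  have q: "(x - z) \<bullet> (x - z) > 0" using assms by simp
  have 1: "((\<lambda>x. (x - z) \<bullet> (x - z)) has_derivative (\<lambda>h. 2 * ((x - z) \<bullet> h))) (at x)"
    by (auto intro!: derivative_eq_intros simp: fun_eq_iff inner_commute)
  have 2: "((\<lambda>t. t powr p) has_derivative (*) (p * ((x - z) \<bullet> (x - z)) powr (p - 1))) (at ((x - z) \<bullet> (x - z)))"
    using has_real_derivative_powr[OF q, of p] by (simp add: has_field_derivative_def)
  from has_derivative_compose[OF 1 2] show ?thesis by (simp add: mult_ac)
qed

lemma poisson_kernel_has_hessian:
  fixes z :: "real^'n::finite"
  assumes "z \<notin> S"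
  shows "has_hessian S (\<lambda>x. poisson_kernel x z) (\<lambda>x. poisson_gradient x z) (\<lambda>x. poisson_hessian x z)"
  unfolding has_hessian_def
proof (intro conjI ballI allI)
  fix x i assume "x \<in> S"
  then have ne: "x \<noteq> z" using assms by auto
  have m: "((\<lambda>x. 1 - x \<bullet> x) has_derivative (\<lambda>h. - 2 * (x \<bullet> h))) (at x)"
    by (auto intro!: derivative_eq_intros simp: fun_eq_iff inner_commute)
  have v: "((\<lambda>y. y $ i) has_derivative (\<lambda>h. h $ i)) (at x)"
    by (rule bounded_linear_imp_has_derivative[OF bounded_linear_vec_nth])
  have vz: "((\<lambda>y. (y - z) $ i) has_derivative (\<lambda>h. h $ i)) (at x)"
    using has_derivative_diff[OF v has_derivative_const[of "z $ i"]] by simp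
  define n where "n = real CARD('n)"
  have q: "((\<lambda>x. ((x - z) \<bullet> (x - z)) powr (- n / 2)) has_derivative
      (\<lambda>h. - n * ((x - z) \<bullet> (x - z)) powr (- n / 2 - 1) * ((x - z) \<bullet> h))) (at x)"
    using norm_square_powr_has_derivative[OF ne, of "- n / 2"] by simp
  have "- n / 2 - 1 - 1 = - n / 2 - 2" "2 * (- n / 2 - 1) = - (n + 2)" by simp_all
  note q' = norm_square_powr_has_derivative[OF ne, of "- n / 2 - 1", unfolded this]
  show "((\<lambda>x. poisson_kernel x z) has_derivative (\<lambda>h. poisson_gradient x z \<bullet> h)) (at x)"
    unfolding poisson_kernel_def n_def[symmetric]
  proof (rule has_derivative_eq_rhs[OF has_derivative_mult[OF m q]], intro ext)
    show "(1 - x \<bullet> x) * (- n * ((x - z) \<bullet> (x - z)) powr (- n / 2 - 1) * ((x - z) \<bullet> h)) +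
        - 2 * (x \<bullet> h) * ((x - z) \<bullet> (x - z)) powr (- n / 2) = poisson_gradient x z \<bullet> h" for h
      unfolding poisson_gradient_def n_def[symmetric] inner_diff_left[of "_ *\<^sub>R _"] inner_scaleR_left
      by algebra
  qed
  have "((\<lambda>x. (- 2 * ((x - z) \<bullet> (x - z)) powr (- n / 2)) * x $ i -
     (n * (1 - x \<bullet> x) * ((x - z) \<bullet> (x - z)) powr (- n / 2 - 1)) * (x - z) $ i)
     has_derivative (\<lambda>h. poisson_hessian x z $ i \<bullet> h)) (at x)"
  proof (rule has_derivative_eq_rhs[OF has_derivative_diff[OF
          has_derivative_mult[OF has_derivative_mult_right[OF q] v]
          has_derivative_mult[OF has_derivative_mult[OF has_derivative_mult_right[OF m] q'] vz]]], intro ext)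
    fix h
    show "- 2 * ((x - z) \<bullet> (x - z)) powr (- n / 2) * h $ i +
         - 2 * (- n * ((x - z) \<bullet> (x - z)) powr (- n / 2 - 1) * ((x - z) \<bullet> h)) * x $ i -
         (n * (1 - x \<bullet> x) * ((x - z) \<bullet> (x - z)) powr (- n / 2 - 1) * h $ i +
          (n * (1 - x \<bullet> x) * (- (n + 2) * ((x - z) \<bullet> (x - z)) powr (- n / 2 - 2) * ((x - z) \<bullet> h)) +
           n * (- 2 * (x \<bullet> h)) * ((x - z) \<bullet> (x - z)) powr (- n / 2 - 1)) * (x - z) $ i) =
         poisson_hessian x z $ i \<bullet> h"
      unfolding poisson_hessian_def Let_def n_def[symmetric] vec_lambda_beta
        inner_add_left[of "_ *\<^sub>R _"] inner_add_left[of "_ + _"] inner_scaleR_left inner_axis' inner_real_def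
      by algebra
  qed
  then show "((\<lambda>x. poisson_gradient x z $ i) has_derivative (\<lambda>h. poisson_hessian x z $ i \<bullet> h)) (at x)"
    by (simp add: poisson_gradient_def n_def)
next
  show "continuous_on S (\<lambda>x. poisson_hessian x z)"
    by (rule continuous_on_poisson) (use assms in \<open>auto intro!: continuous_intros\<close>)
qed

text \<open>With \<open>t\<close> as the common power of \<open>q\<close>, everything is
  \<open>2 * n * t\<close> times a bracket that reduces to \<open>1 - z \<bullet> z\<close>. It
  vanishes because the pole is a unit vector.\<close>

lemma trace_poisson_hessian:
  fixes x z :: "real^'n::finite"
  assumes "norm z = 1" "x \<noteq> z"
  shows "trace (poisson_hessian x z) = 0"
proof -
  define n where "n = real CARD('n)"
  define q where "q = (x - z) \<bullet> (x - z)"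
  define t where "t = q powr (- n / 2 - 1)"
  have "q > 0" using assms by (simp add: q_def)
  then have t: "q powr (- n / 2) = q * t" "q * q powr (- n / 2 - 2) = t"
    using powr_mult_base[of q "- n / 2 - 1"] powr_mult_base[of q "- n / 2 - 2"]
    by (simp_all add: t_def minus_diff_commute)
  have zz: "z \<bullet> z = 1" using assms by (simp add: norm_eq_1)
  have tr: "trace (\<chi> i. a *\<^sub>R axis i 1 + (b * x $ i + c * d $ i) *\<^sub>R d + (f * d $ i) *\<^sub>R x) =
      n * a + b * (\<Sum>i\<in>UNIV. x $ i * d $ i) + c * (\<Sum>i\<in>UNIV. d $ i * d $ i) + f * (\<Sum>i\<in>UNIV. d $ i * x $ i)"
    for a b c f and d :: "real^'n"
    by (simp add: trace_def sum.distrib axis_def n_def sum_distrib_left algebra_simps)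
  have "trace (poisson_hessian x z) = n * (- 2 * q powr (- n / 2) - n * (1 - x \<bullet> x) * t)
    + 2 * n * t * (\<Sum>i\<in>UNIV. x $ i * (x - z) $ i)
    + n * (n + 2) * (1 - x \<bullet> x) * q powr (- n / 2 - 2) * (\<Sum>i\<in>UNIV. (x - z) $ i * (x - z) $ i)
    + 2 * n * t * (\<Sum>i\<in>UNIV. (x - z) $ i * x $ i)"
    unfolding poisson_hessian_def Let_def n_def[symmetric] q_def[symmetric] t_def[symmetric] by (rule tr)
  also have "(\<Sum>i\<in>UNIV. x $ i * (x - z) $ i) = x \<bullet> (x - z)" by (simp add: inner_vec_def)
  also have "(\<Sum>i\<in>UNIV. (x - z) $ i * x $ i) = x \<bullet> (x - z)" by (simp add: inner_vec_def mult.commute)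
  also have "(\<Sum>i\<in>UNIV. (x - z) $ i * (x - z) $ i) = q" by (simp add: inner_vec_def q_def)
  also have "n * (- 2 * q powr (- n / 2) - n * (1 - x \<bullet> x) * t) + 2 * n * t * (x \<bullet> (x - z))
    + n * (n + 2) * (1 - x \<bullet> x) * q powr (- n / 2 - 2) * q + 2 * n * t * (x \<bullet> (x - z))
    = 2 * n * t * (1 - x \<bullet> x + 2 * (x \<bullet> (x - z)) - q)"
    unfolding t(1) t(2)[symmetric] by (simp add: algebra_simps)
  also have "1 - x \<bullet> x + 2 * (x \<bullet> (x - z)) - q = 0"
    by (simp add: q_def inner_diff_left inner_diff_right inner_commute zz)
  finally show ?thesis by simp
qed

text \<open>For unit vectors \<open>s z\<close> is as far from \<open>e\<close> as
  \<open>s e\<close> is from \<open>z\<close>. A mean over poles thus becomes a mean over evaluation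
  points with one fixed pole.\<close>

lemma poisson_kernel_swap:
  assumes "norm z = 1" "norm e = 1"
  shows "poisson_kernel (s *\<^sub>R z) e = poisson_kernel (s *\<^sub>R e) z"
proof -
  have "z \<bullet> z = 1" "e \<bullet> e = 1" using assms by (simp_all add: norm_eq_1)
  then show ?thesis
    by (simp add: poisson_kernel_def inner_diff_left inner_diff_right inner_commute algebra_simps)
qed

lemma poisson_kernel_0: "norm z = 1 \<Longrightarrow> poisson_kernel 0 z = 1"
  by (simp add: poisson_kernel_def norm_eq_1)

lemma poisson_kernel_nonneg: "norm x \<le> 1 \<Longrightarrow> poisson_kernel x z \<ge> 0"
  by (simp add: poisson_kernel_def power_le_one flip: power2_norm_eq_inner)

text \<open>Identities along s t = c > 0 never reach the center; continuity of the means carries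
  them to radius 0.\<close>

lemma continuous_on_const_left_end:
  fixes f :: "real \<Rightarrow> real"
  assumes f: "continuous_on {0..<1} f" and c: "\<And>r. 0 < r \<Longrightarrow> r < 1 \<Longrightarrow> f r = c"
  shows "f 0 = c"
proof -
  have "(f \<longlongrightarrow> f 0) (at 0 within {0..<1})"
    using f unfolding continuous_on_def by (rule bspec) simp
  then have "(f \<longlongrightarrow> f 0) (at 0 within {0<..<1})" by (rule tendsto_within_subset) auto
  then have "((\<lambda>_. c) \<longlongrightarrow> f 0) (at (0::real) within {0<..<1})"
    by (rule Lim_transform_eventually) (auto simp: eventually_at_filter intro!: always_eventually c)
  moreover have "at (0::real) within {0<..<1} \<noteq> bot"
    by (simp add: at_within_eq_bot_iff)
  ultimately show ?thesis using tendsto_unique[OF _ tendsto_const] by metis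
qed

context
  fixes e :: "real^'n::finite"
  assumes n: "CARD('n) \<ge> 2" and e: "norm e = 1"
begin

lemma continuous_on_poisson_axis:
  "continuous_on ({0..<1} \<times> sphere 0 1) (\<lambda>(s, z). poisson_kernel (s *\<^sub>R z) e)"
proof -
  have "norm (s *\<^sub>R z) \<noteq> norm e" if "(s, z) \<in> {0..<1} \<times> sphere 0 1" for s and z :: "real^'n"
    using that e by auto
  then show ?thesis
    unfolding split_beta by (intro continuous_on_poisson continuous_intros) fastforce
qed

lemma continuous_on_poisson_axis_section:
  assumes "s \<in> {0..<1}"
  shows "continuous_on (sphere 0 1) (\<lambda>z. poisson_kernel (s *\<^sub>R z) e)"
  using continuous_on_compose2[OF continuous_on_poisson_axis, of "sphere 0 1" "\<lambda>z. (s, z)"] assms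
  by (simp add: continuous_on_Pair image_subset_iff)

lemma poisson_mean_const:
  fixes v :: "real^'n \<Rightarrow> real"
  assumes hv: "has_hessian (ball 0 1) v G H" and tr: "\<And>x. x \<in> ball 0 1 \<Longrightarrow> trace (H x) = 0"
    and c: "0 < c" "s \<in> {c<..<1}" "s' \<in> {c<..<1}"
  shows "sphere_mean (\<lambda>z. poisson_kernel (s *\<^sub>R z) e * v ((c / s) *\<^sub>R z)) =
    sphere_mean (\<lambda>z. poisson_kernel (s' *\<^sub>R z) e * v ((c / s') *\<^sub>R z))"
proof (rule sphere_mean_harmonic_product[OF n c poisson_kernel_has_hessian hv _ tr])
  show "e \<notin> ball 0 1" using e by simp
  fix x :: "real^'n" assume "x \<in> ball 0 1"
  then have "x \<noteq> e" using e by auto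
  then show "trace (poisson_hessian x e) = 0" using e by (intro trace_poisson_hessian)
qed

text \<open>The product identity with \<open>v = 1\<close> makes the mean independent of
  \<open>s\<close>, and its value is read off at the center, where the kernel is 1.\<close>

lemma sphere_mean_poisson_axis:
  assumes "s \<in> {0..<1}"
  shows "sphere_mean (\<lambda>z. poisson_kernel (s *\<^sub>R z) e) = 1"
proof -
  let ?m = "\<lambda>s. sphere_mean (\<lambda>z. poisson_kernel (s *\<^sub>R z) e)"
  have 0: "?m 0 = 1" by (simp add: poisson_kernel_0 e)
  have const: "?m s = ?m (1/2)" if s: "s \<in> {0<..<1}" for s
  proof -
    have "has_hessian (ball 0 1) (\<lambda>_::real^'n. 1) (\<lambda>_. 0) (\<lambda>_. 0)"
      by (simp add: has_hessian_def)
    \<comment> \<open>Any \<open>c\<close> below both radii serves, since the radius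
      \<open>c / s\<close> does not matter for a constant function.\<close>
    from poisson_mean_const[OF this, of "min s (1/2) / 2" s "1/2"] s show ?thesis
      by (simp add: trace_def min_def split: if_splits)
  qed
  have "continuous_on {0..<1} ?m"
    by (rule sphere_mean_continuous_on[OF continuous_on_poisson_axis])
  then have "?m 0 = ?m (1/2)" by (rule continuous_on_const_left_end) (simp add: const[symmetric])
  then show ?thesis using const[of s] 0 assms by (cases "s = 0") auto
qed

text \<open>Passing from \<open>z\<close> to \<open>s z\<close> costs less than \<eta>/2, so the
  distance to the pole stays at least \<eta>/2. The factor \<open>1 - s\<^sup>2\<close> then makes
  the kernel concentrate at \<open>e\<close> as s -> 1.\<close>

lemma poisson_kernel_far_bound:
  fixes z :: "real^'n"
  assumes "norm z = 1" "\<eta> > 0" "norm (z - e) \<ge> \<eta>" "0 < s" "s < 1" "1 - s < \<eta> / 2"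
  shows "poisson_kernel (s *\<^sub>R z) e \<le> (1 - s\<^sup>2) * ((\<eta> / 2)\<^sup>2) powr (- real CARD('n) / 2)"
proof -
  have "z - e = (s *\<^sub>R z - e) + (1 - s) *\<^sub>R z" by (simp add: algebra_simps)
  then have "norm (z - e) \<le> norm (s *\<^sub>R z - e) + norm ((1 - s) *\<^sub>R z)" by (metis norm_triangle_ineq)
  then have "norm (s *\<^sub>R z - e) \<ge> \<eta> / 2" using assms by simp
  then have "(norm (s *\<^sub>R z - e))\<^sup>2 \<ge> (\<eta> / 2)\<^sup>2" using assms by (intro power_mono) auto
  then have le: "(\<eta> / 2)\<^sup>2 \<le> (s *\<^sub>R z - e) \<bullet> (s *\<^sub>R z - e)" by (simp only: power2_norm_eq_inner)
  have "z \<bullet> z = 1" using assms by (simp add: norm_eq_1)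
  then have eq: "poisson_kernel (s *\<^sub>R z) e =
      (1 - s\<^sup>2) * ((s *\<^sub>R z - e) \<bullet> (s *\<^sub>R z - e)) powr (- real CARD('n) / 2)"
    by (simp add: poisson_kernel_def power2_eq_square)
  show ?thesis
    unfolding eq using assms le
    by (intro mult_left_mono powr_mono2') (auto simp: power_le_one)
qed

text \<open>The mean does not change when \<open>s\<close> grows to 1 with the product of the radii
  fixed at \<open>r * \<rho>\<close>. In this limit the kernel is an approximate identity at
  \<open>e\<close>, while \<open>v\<close> is evaluated at radii that tend to
  \<open>r * \<rho>\<close>.\<close>

lemma poisson_formula_axis:
  fixes v :: "real^'n \<Rightarrow> real"
  assumes hv: "has_hessian (ball 0 1) v G H" and tr: "\<And>x. x \<in> ball 0 1 \<Longrightarrow> trace (H x) = 0"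
    and r: "0 < r" "r < 1" and \<rho>: "0 < \<rho>" "\<rho> < 1"
  shows "sphere_mean (\<lambda>z. poisson_kernel (r *\<^sub>R z) e * v (\<rho> *\<^sub>R z)) = v ((r * \<rho>) *\<^sub>R e)"
proof -
  define c where "c = r * \<rho>"
  define k where "k = sphere_mean (\<lambda>z. poisson_kernel (r *\<^sub>R z) e * v (\<rho> *\<^sub>R z))"
  have c: "0 < c" "c < 1" "r \<in> {c<..<1}" using r \<rho> mult_strict_mono[of r 1 \<rho> 1] by (auto simp: c_def)
  have k: "sphere_mean (\<lambda>z. poisson_kernel (s *\<^sub>R z) e * v ((c / s) *\<^sub>R z)) = k" if "s \<in> {c<..<1}" for s
    using poisson_mean_const[OF hv tr c(1) that c(3)] r by (simp add: k_def c_def)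
  note v = has_hessianD[OF hv]
  have "\<bar>k - v (c *\<^sub>R e)\<bar> \<le> 0 + \<epsilon>" if "\<epsilon> > 0" for \<epsilon>
  proof -
    define \<epsilon>' where "\<epsilon>' = \<epsilon> / 2"
    have \<epsilon>': "\<epsilon>' > 0" using that by (simp add: \<epsilon>'_def)
    have ce: "c *\<^sub>R e \<in> ball 0 1" using c e by simp
    obtain \<delta> where \<delta>: "\<delta> > 0" "\<And>y. y \<in> ball 0 1 \<Longrightarrow> dist y (c *\<^sub>R e) < \<delta> \<Longrightarrow> \<bar>v y - v (c *\<^sub>R e)\<bar> < \<epsilon>'"
      using v(3)[unfolded continuous_on_iff, rule_format, OF ce \<epsilon>'] by (auto simp: dist_real_def)
    \<comment> \<open>For \<open>s\<close> near 1 all points \<open>(c / s) z\<close> lie in this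
      compact ball, on which \<open>v\<close> is bounded.\<close>
    have sub: "cball 0 ((c + 1) / 2) \<subseteq> ball (0::real^'n) 1" using c by auto
    have "bounded (v ` cball 0 ((c + 1) / 2))"
      by (intro compact_imp_bounded compact_continuous_image continuous_on_subset[OF v(3) sub]) auto
    then obtain B where "\<forall>t \<in> v ` cball 0 ((c + 1) / 2). norm t \<le> B"
      by (meson bounded_iff)
    then have B: "\<bar>v y\<bar> \<le> B" if "y \<in> cball 0 ((c + 1) / 2)" for y
      using that by (metis imageI real_norm_def)
    define C where "C = ((\<delta> / 2 / 2)\<^sup>2) powr (- real CARD('n) / 2)"
    have "\<forall>\<^sub>F s in at_left (1::real). s < 1" by (simp add: eventually_at_filter)
    moreover have "\<forall>\<^sub>F s in at_left (1::real). c < s"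
      by (rule order_tendstoD(1)[OF tendsto_ident_at \<open>c < 1\<close>])
    moreover have "\<forall>\<^sub>F s in at_left 1. c / s < (c + 1) / 2"
      by (rule order_tendstoD(2)[where y = "c / 1"]) (use c in \<open>auto intro!: tendsto_eq_intros\<close>)
    moreover have "\<forall>\<^sub>F s in at_left 1. \<bar>c / s - c\<bar> < \<delta> / 2"
      by (rule order_tendstoD(2)[where y = "\<bar>c / 1 - c\<bar>"]) (use \<delta> in \<open>auto intro!: tendsto_eq_intros\<close>)
    moreover have "\<forall>\<^sub>F s in at_left (1::real). 1 - s < \<delta> / 2 / 2"
      by (rule order_tendstoD(2)[where y = "1 - 1"]) (use \<delta> in \<open>auto intro!: tendsto_eq_intros\<close>)
    moreover have "\<forall>\<^sub>F s in at_left 1. ((1 - s\<^sup>2) * C) * (2 * B) < \<epsilon>'"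
      by (rule order_tendstoD(2)[where y = "((1 - 1\<^sup>2) * C) * (2 * B)"])
         (use \<epsilon>' in \<open>auto intro!: tendsto_eq_intros\<close>)
    ultimately have "\<forall>\<^sub>F s in at_left 1. s < 1 \<and> c < s \<and> c / s < (c + 1) / 2 \<and> \<bar>c / s - c\<bar> < \<delta> / 2
        \<and> 1 - s < \<delta> / 2 / 2 \<and> ((1 - s\<^sup>2) * C) * (2 * B) < \<epsilon>'"
      by eventually_elim simp
    \<comment> \<open>One \<open>s\<close> meets all conditions: \<open>c / s\<close> stays in the
      compact ball and close to \<open>c\<close>, and the far part of the kernel, times the
      oscillation bound \<open>2 * B\<close>, is below \<epsilon>'.\<close>
    from eventually_happens'[OF trivial_limit_at_left_real this]
    obtain s where s: "s < 1" "c < s" "c / s < (c + 1) / 2" "\<bar>c / s - c\<bar> < \<delta> / 2"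
        "1 - s < \<delta> / 2 / 2" "((1 - s\<^sup>2) * C) * (2 * B) < \<epsilon>'" by blast
    let ?P = "\<lambda>z. poisson_kernel (s *\<^sub>R z) e" and ?w = "\<lambda>z. v ((c / s) *\<^sub>R z)"
    have inb: "(c / s) *\<^sub>R z \<in> cball 0 ((c + 1) / 2)" if "norm z = 1" for z :: "real^'n"
      using that s c by simp
    have cP: "continuous_on (sphere 0 1) ?P"
      using s c by (intro continuous_on_poisson_axis_section) auto
    have cw: "continuous_on (sphere 0 1) ?w"
      by (rule continuous_on_compose2[OF v(3)]) (use inb sub in \<open>auto intro!: continuous_intros\<close>)
    have mP: "sphere_mean ?P = 1" using s c by (intro sphere_mean_poisson_axis) auto
    \<comment> \<open>Near the pole, continuity of \<open>v\<close> gives \<epsilon>' times the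
      kernel; away from it, smallness of the kernel gives \<epsilon>'. Each of the two terms has
      mean \<epsilon>'.\<close>
    have pt: "\<bar>?P z * ?w z - v (c *\<^sub>R e) * ?P z\<bar> \<le> \<epsilon>' * ?P z + \<epsilon>'" if z: "norm z = 1" for z
    proof -
      have P0: "?P z \<ge> 0" using z s c by (intro poisson_kernel_nonneg) simp
      have eq: "\<bar>?P z * ?w z - v (c *\<^sub>R e) * ?P z\<bar> = ?P z * \<bar>?w z - v (c *\<^sub>R e)\<bar>"
        using P0 by (metis abs_mult abs_of_nonneg mult.commute right_diff_distrib)
      show ?thesis
      proof (cases "norm (z - e) < \<delta> / 2")
        case True
        have "(c / s) *\<^sub>R z - c *\<^sub>R e = (c / s - c) *\<^sub>R z + c *\<^sub>R (z - e)" by (simp add: algebra_simps)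
        then have "dist ((c / s) *\<^sub>R z) (c *\<^sub>R e) \<le> \<bar>c / s - c\<bar> * norm z + c * norm (z - e)"
          unfolding dist_norm using norm_triangle_ineq[of "(c / s - c) *\<^sub>R z" "c *\<^sub>R (z - e)"] c by simp
        also have "c * norm (z - e) \<le> norm (z - e)" using c by (simp add: mult_left_le_one_le)
        finally have "dist ((c / s) *\<^sub>R z) (c *\<^sub>R e) < \<delta>" using True s z by simp
        then have "\<bar>?w z - v (c *\<^sub>R e)\<bar> \<le> \<epsilon>'" using \<delta>(2) inb[OF z] sub by (meson less_imp_le subsetD)
        then show ?thesis unfolding eq using mult_left_mono[OF _ P0] \<epsilon>' by (smt (verit) mult.commute)
      next
        case False
        have "c *\<^sub>R e \<in> cball 0 ((c + 1) / 2)" using c e by simp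
        then have "\<bar>?w z - v (c *\<^sub>R e)\<bar> \<le> 2 * B" using B[OF inb[OF z]] B by (smt (verit))
        moreover have "?P z \<le> (1 - s\<^sup>2) * C"
          unfolding C_def using False \<delta> s c z by (intro poisson_kernel_far_bound) auto
        ultimately have "?P z * \<bar>?w z - v (c *\<^sub>R e)\<bar> \<le> ((1 - s\<^sup>2) * C) * (2 * B)"
          using P0 by (intro mult_mono) (auto intro: order_trans)
        then show ?thesis unfolding eq using s P0 \<epsilon>' by (smt (verit) mult_nonneg_nonneg)
      qed
    qed
    have "k - v (c *\<^sub>R e) = sphere_mean (\<lambda>z. ?P z * ?w z) - sphere_mean (\<lambda>z. v (c *\<^sub>R e) * ?P z)"
      using k[of s] s sphere_mean_cmult[OF cP] mP by simp
    also have "\<dots> = sphere_mean (\<lambda>z. ?P z * ?w z - v (c *\<^sub>R e) * ?P z)"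
      by (rule sphere_mean_diff[symmetric]) (intro continuous_intros cP cw)+
    finally have eq: "k - v (c *\<^sub>R e) = sphere_mean (\<lambda>z. ?P z * ?w z - v (c *\<^sub>R e) * ?P z)" .
    have "sphere_mean (\<lambda>z. \<epsilon>' * ?P z + \<epsilon>') = \<epsilon>' + \<epsilon>'"
      using sphere_mean_add[OF continuous_on_mult_left[OF cP] continuous_on_const, of \<epsilon>' \<epsilon>'] sphere_mean_cmult[OF cP] mP
      by simp
    also have "\<epsilon>' + \<epsilon>' = \<epsilon>" by (simp add: \<epsilon>'_def)
    finally have up: "sphere_mean (\<lambda>z. \<epsilon>' * ?P z + \<epsilon>') = \<epsilon>" .
    have lo: "sphere_mean (\<lambda>z. - (\<epsilon>' * ?P z + \<epsilon>')) = - \<epsilon>"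
      using sphere_mean_cmult[of "\<lambda>z. \<epsilon>' * ?P z + \<epsilon>'" "- 1"] cP up by (simp add: continuous_intros)
    have "k - v (c *\<^sub>R e) \<le> \<epsilon>"
      unfolding eq up[symmetric] using pt
      by (intro sphere_mean_mono continuous_intros cP cw) (simp add: abs_le_iff)
    moreover have "- \<epsilon> \<le> k - v (c *\<^sub>R e)"
      unfolding eq lo[symmetric] using pt
      by (intro sphere_mean_mono continuous_intros cP cw) (smt (verit))
    ultimately show ?thesis by simp
  qed
  then have "\<bar>k - v (c *\<^sub>R e)\<bar> \<le> 0" by (rule field_le_epsilon)
  then show ?thesis by (simp add: k_def c_def)
qed

end

section \<open>The distribution of a coordinate on the sphere\<close>

text \<open>Green's identity against a constant: the spherical Laplacian of a power of
  \<open>z \<bullet> e\<close> has mean zero, which yields a recursion for moments. For k < 2 the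
  truncated exponent \<open>k - 1 - 1\<close> is harmless because its coefficient is 0.\<close>

lemma sphere_mean_axis_laplacian:
  fixes e :: "real^'n::finite"
  assumes e: "norm e = 1"
  shows "sphere_mean (\<lambda>z. real k * real (k - 1) * (z \<bullet> e) ^ (k - 1 - 1) * (1 - (z \<bullet> e)\<^sup>2)
    - (real CARD('n) - 1) * (real k * (z \<bullet> e) ^ (k - 1) * (z \<bullet> e))) = 0"
proof -
  define A where "A x = (real k * (x \<bullet> e) ^ (k - 1)) *\<^sub>R e" for x :: "real^'n"
  define HA where "HA x = (\<chi> i. (real k * real (k - 1) * (x \<bullet> e) ^ (k - 1 - 1) * e $ i) *\<^sub>R e)" for x :: "real^'n"
  have pow: "((\<lambda>x. (x \<bullet> e) ^ j) has_derivative (\<lambda>h. real j * (x \<bullet> e) ^ (j - 1) * (e \<bullet> h))) (at x)" for j and x :: "real^'n"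
    by (auto intro!: derivative_eq_intros simp: fun_eq_iff inner_commute)
  have a: "has_hessian (sphere 0 1) (\<lambda>x. (x \<bullet> e) ^ k) A HA"
    unfolding has_hessian_def
  proof (intro conjI ballI allI)
    fix x i
    show "((\<lambda>x. (x \<bullet> e) ^ k) has_derivative (\<lambda>h. A x \<bullet> h)) (at x)"
      using pow[of k] by (simp add: A_def)
    show "((\<lambda>x. A x $ i) has_derivative (\<lambda>h. HA x $ i \<bullet> h)) (at x)"
      using has_derivative_mult_left[OF has_derivative_mult_right[OF pow[of "k - 1"]], of "real k" "e $ i"]
      by (simp add: A_def HA_def mult_ac)
  next
    show "continuous_on (sphere 0 1) HA" unfolding HA_def by (intro continuous_intros)
  qed
  \<comment> \<open>The constant -1 cancels the minus sign in Green's identity.\<close>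
  have b: "has_hessian (sphere 0 1) (\<lambda>_::real^'n. - 1) (\<lambda>_. 0) (\<lambda>_. 0)"
    by (simp add: has_hessian_def)
  have ee: "e \<bullet> e = 1" using e by (simp add: norm_eq_1)
  have "sphere_laplacian 0 0 z = 0" for z :: "real^'n"
    by (simp add: sphere_laplacian_def trace_def quadratic_form_def)
  then have "sphere_mean (\<lambda>z. sphere_laplacian (A z) (HA z) z) = 0"
    using sphere_mean_green[OF a b] by simp
  also have "(\<lambda>z. sphere_laplacian (A z) (HA z) z) =
    (\<lambda>z. real k * real (k - 1) * (z \<bullet> e) ^ (k - 1 - 1) * (1 - (z \<bullet> e)\<^sup>2)
    - (real CARD('n) - 1) * (real k * (z \<bullet> e) ^ (k - 1) * (z \<bullet> e)))"
  proof
    fix z :: "real^'n"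
    define c where "c = real k * real (k - 1) * (z \<bullet> e) ^ (k - 1 - 1)"
    have HA: "HA z = (\<chi> i. (c * e $ i) *\<^sub>R e)" by (simp add: HA_def c_def)
    have "trace (HA z) = c * (e \<bullet> e)"
      by (simp add: trace_def HA inner_vec_def sum_distrib_left mult_ac)
    moreover have "quadratic_form (HA z) z = c * (z \<bullet> e) * (z \<bullet> e)"
      by (simp add: quadratic_form_def HA inner_vec_def[of z e] sum_distrib_left sum_distrib_right
          inner_commute[of e z] mult_ac)
    ultimately show "sphere_laplacian (A z) (HA z) z = c * (1 - (z \<bullet> e)\<^sup>2)
      - (real CARD('n) - 1) * (real k * (z \<bullet> e) ^ (k - 1) * (z \<bullet> e))"
      by (simp add: sphere_laplacian_def A_def ee inner_commute power2_eq_square algebra_simps)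
  qed
  finally show ?thesis .
qed

lemma sphere_mean_axis_power:
  fixes e :: "real^'n::finite"
  assumes n: "CARD('n) \<ge> 2" and e: "norm e = 1"
  shows "sphere_mean (\<lambda>z. z \<bullet> e) = 0"
    and "(real k + real CARD('n)) * sphere_mean (\<lambda>z. (z \<bullet> e) ^ (k + 2)) = (real k + 1) * sphere_mean (\<lambda>z. (z \<bullet> e) ^ k)"
proof -
  have c: "continuous_on (sphere 0 1) (\<lambda>z. (z \<bullet> e) ^ j)" for j by (intro continuous_intros)
  have "0 = sphere_mean (\<lambda>z. - ((real CARD('n) - 1) * (z \<bullet> e)))"
    using sphere_mean_axis_laplacian[OF e, of 1] by simp
  also have "\<dots> = sphere_mean (\<lambda>z. - (real CARD('n) - 1) * (z \<bullet> e))"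
    by (simp only: mult_minus_left)
  also have "\<dots> = - (real CARD('n) - 1) * sphere_mean (\<lambda>z. z \<bullet> e)"
    by (intro sphere_mean_cmult continuous_intros)
  finally show "sphere_mean (\<lambda>z. z \<bullet> e) = 0" using n by simp
  have "0 = sphere_mean (\<lambda>z. (real k + 2) * (real k + 1) * (z \<bullet> e) ^ k
      - (real k + 2) * (real k + real CARD('n)) * (z \<bullet> e) ^ (k + 2))"
    using sphere_mean_axis_laplacian[OF e, of "k + 2"]
    by (simp add: algebra_simps power2_eq_square)
  also have "\<dots> = (real k + 2) * (real k + 1) * sphere_mean (\<lambda>z. (z \<bullet> e) ^ k)
      - (real k + 2) * (real k + real CARD('n)) * sphere_mean (\<lambda>z. (z \<bullet> e) ^ (k + 2))"
    by (subst sphere_mean_diff) (intro continuous_intros | simp only: sphere_mean_cmult[OF c])+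
  also have "\<dots> = (real k + 2) * ((real k + 1) * sphere_mean (\<lambda>z. (z \<bullet> e) ^ k)
      - (real k + real CARD('n)) * sphere_mean (\<lambda>z. (z \<bullet> e) ^ (k + 2)))"
    by (simp add: algebra_simps)
  finally show "(real k + real CARD('n)) * sphere_mean (\<lambda>z. (z \<bullet> e) ^ (k + 2)) = (real k + 1) * sphere_mean (\<lambda>z. (z \<bullet> e) ^ k)"
    by simp
qed

text \<open>Both parts integrate a derivative whose primitive vanishes at 0 and pi. For m = n - 2
  the recursion has the coefficients of \<open>sphere_mean_axis_power\<close>.\<close>

lemma integral_cos_sin_power:
  shows "integral {0..pi} (\<lambda>t. cos t * sin t ^ m) = 0"
    and "(real k + real m + 2) * integral {0..pi} (\<lambda>t. cos t ^ (k + 2) * sin t ^ m) =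
      (real k + 1) * integral {0..pi} (\<lambda>t. cos t ^ k * sin t ^ m)"
proof -
  have "((\<lambda>t. cos t * sin t ^ m) has_integral sin pi ^ Suc m / (real m + 1) - sin 0 ^ Suc m / (real m + 1)) {0..pi}"
  proof (rule fundamental_theorem_of_calculus)
    fix t
    have "((\<lambda>t. sin t ^ Suc m / (real m + 1)) has_real_derivative
        (1 + real m) * (cos t * sin t ^ m) / (real m + 1)) (at t within {0..pi})"
      by (intro DERIV_cdivide DERIV_power_Suc has_field_derivative_at_within[OF DERIV_sin])
    then show "((\<lambda>t. sin t ^ Suc m / (real m + 1)) has_vector_derivative cos t * sin t ^ m) (at t within {0..pi})"
      by (simp add: add.commute flip: has_real_derivative_iff_has_vector_derivative)
  qed simp
  then show "integral {0..pi} (\<lambda>t. cos t * sin t ^ m) = 0" by (simp add: integral_unique)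
  have "((\<lambda>t. (real k + real m + 2) * (cos t ^ (k + 2) * sin t ^ m) - (real k + 1) * (cos t ^ k * sin t ^ m))
     has_integral cos pi ^ Suc k * sin pi ^ Suc m - cos 0 ^ Suc k * sin 0 ^ Suc m) {0..pi}"
  proof (rule fundamental_theorem_of_calculus)
    fix t :: real
    have s: "sin t * (sin t * y) = y - cos t * (cos t * y)" for y
      by (metis (no_types, lifting) left_diff_distrib mult.assoc mult_1 power2_eq_square sin_squared_eq)
    have "((\<lambda>t. cos t ^ Suc k * sin t ^ Suc m) has_real_derivative
      ((1 + real k) * (- sin t * cos t ^ k)) * sin t ^ Suc m + ((1 + real m) * (cos t * sin t ^ m)) * cos t ^ Suc k) (at t within {0..pi})"
      by (intro DERIV_mult DERIV_power_Suc has_field_derivative_at_within[OF DERIV_sin] has_field_derivative_at_within[OF DERIV_cos])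
    also have "((1 + real k) * (- sin t * cos t ^ k)) * sin t ^ Suc m + ((1 + real m) * (cos t * sin t ^ m)) * cos t ^ Suc k =
       (real k + real m + 2) * (cos t ^ (k + 2) * sin t ^ m) - (real k + 1) * (cos t ^ k * sin t ^ m)"
      by (simp add: algebra_simps s)
    finally show "((\<lambda>t. cos t ^ Suc k * sin t ^ Suc m) has_vector_derivative
      (real k + real m + 2) * (cos t ^ (k + 2) * sin t ^ m) - (real k + 1) * (cos t ^ k * sin t ^ m)) (at t within {0..pi})"
      by (simp only: has_real_derivative_iff_has_vector_derivative)
  qed simp
  then have "0 = integral {0..pi} (\<lambda>t. (real k + real m + 2) * (cos t ^ (k + 2) * sin t ^ m) - (real k + 1) * (cos t ^ k * sin t ^ m))"
    by (simp add: integral_unique)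
  also have "\<dots> = integral {0..pi} (\<lambda>t. (real k + real m + 2) * (cos t ^ (k + 2) * sin t ^ m))
     - integral {0..pi} (\<lambda>t. (real k + 1) * (cos t ^ k * sin t ^ m))"
    by (intro Henstock_Kurzweil_Integration.integral_diff integrable_continuous_real continuous_intros)
  finally show "(real k + real m + 2) * integral {0..pi} (\<lambda>t. cos t ^ (k + 2) * sin t ^ m) =
      (real k + 1) * integral {0..pi} (\<lambda>t. cos t ^ k * sin t ^ m)"
    by simp
qed

text \<open>The constant in front of \<open>cap_measure\<close>; for n \<ge> 2 it is the reciprocal
  of the integral of sin^(n-2) from 0 to pi.\<close>

definition cap_norm :: "nat \<Rightarrow> real" where
  "cap_norm n = 1 / sqrt pi * (Gamma (real n / 2) / Gamma ((real n - 1) / 2))"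

lemma Gamma_plus1_pos: "x > 0 \<Longrightarrow> Gamma (x + 1) = x * Gamma (x :: real)"
  by (rule Gamma_plus1) (auto elim!: nonpos_Ints_cases)

text \<open>Wallis integrals: raising \<open>m\<close> by 2 multiplies both sides by (m + 1)/(m +
  2), and the two starting values come from the Gamma function at 1/2 and 3/2.\<close>

lemma integral_sin_power:
  "integral {0..pi} (\<lambda>t. sin t ^ m) = sqrt pi * Gamma ((real m + 1) / 2) / Gamma ((real m + 2) / 2)"
proof (induction m rule: nat_induct2)
  case 0
  then show ?case by (simp add: Gamma_one_half_real)
next
  case 1
  have "((\<lambda>t. sin t) has_integral - cos pi - (- cos 0)) {0..pi}"
    by (rule fundamental_theorem_of_calculus)
       (auto intro!: derivative_eq_intros simp flip: has_real_derivative_iff_has_vector_derivative)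
  then have "integral {0..pi} sin = 2" by (simp add: integral_unique)
  moreover have "Gamma (3 / 2 :: real) = sqrt pi / 2"
    using Gamma_plus1_pos[of "1/2"] by (simp add: Gamma_one_half_real)
  then have "sqrt pi / Gamma (3 / 2) = 2" by (subst \<open>Gamma (3 / 2) = sqrt pi / 2\<close>) simp
  ultimately show ?case by simp
next
  case (step m)
  let ?S = "\<lambda>m. integral {0..pi} (\<lambda>t. sin t ^ m)"
  have "?S (m + 2) = integral {0..pi} (\<lambda>t. sin t ^ m - cos t ^ 2 * sin t ^ m)"
    by (intro integral_cong) (simp only: power_add sin_squared_eq right_diff_distrib mult_1_right mult.commute)
  also have "\<dots> = ?S m - integral {0..pi} (\<lambda>t. cos t ^ 2 * sin t ^ m)"
    by (intro Henstock_Kurzweil_Integration.integral_diff integrable_continuous_real continuous_intros)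
  also have "integral {0..pi} (\<lambda>t. cos t ^ 2 * sin t ^ m) = ?S m / (real m + 2)"
    using integral_cos_sin_power(2)[where k = 0 and m = m] by (simp add: field_simps power2_eq_square)
  finally have S: "?S (m + 2) = (real m + 1) / (real m + 2) * ?S m" by (simp add: field_simps)
  have G: "Gamma ((real (m + 2) + 1) / 2) = (real m + 1) / 2 * Gamma ((real m + 1) / 2)"
    "Gamma ((real (m + 2) + 2) / 2) = (real m + 2) / 2 * Gamma ((real m + 2) / 2)"
    using Gamma_plus1_pos[of "(real m + 1) / 2"] Gamma_plus1_pos[of "(real m + 2) / 2"]
    by (simp_all add: add_divide_distrib algebra_simps)
  have "Gamma ((real m + 2) / 2) > 0" by (intro Gamma_real_pos) simp
  then show ?case unfolding S step G by (simp add: divide_simps)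
qed

lemma cap_norm_pos: "n \<ge> 2 \<Longrightarrow> cap_norm n > 0"
  by (simp add: cap_norm_def Gamma_real_pos)

lemma cap_norm_integral:
  assumes "n \<ge> 2"
  shows "cap_norm n * integral {0..pi} (\<lambda>t. sin t ^ (n - 2)) = 1"
proof -
  have "real (n - 2) + 1 = real n - 1" "real (n - 2) + 2 = real n" using assms by auto
  moreover have "Gamma (real n / 2) \<noteq> 0" "Gamma ((real n - 1) / 2) \<noteq> 0"
    using assms by (intro less_imp_neq[symmetric] Gamma_real_pos; simp)+
  ultimately show ?thesis by (simp add: integral_sin_power cap_norm_def)
qed

lemma axis_integrable:
  assumes "continuous_on {-1..1} g"
  shows "(\<lambda>t. g (cos t) * sin t ^ m) integrable_on {0..pi}"
  by (intro integrable_continuous_real continuous_intros continuous_on_compose2[OF assms]) auto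

text \<open>This replaces polar coordinates: moments of \<open>z \<bullet> e\<close> and weighted
  moments of the cosine agree for exponents 0 and 1 and obey the same two-step recursion.\<close>

lemma sphere_mean_axis_polynomial:
  fixes e :: "real^'n::finite"
  assumes n: "CARD('n) \<ge> 2" and e: "norm e = 1"
  shows "sphere_mean (\<lambda>z. \<Sum>i\<le>N. a i * (z \<bullet> e) ^ i) =
    cap_norm CARD('n) * integral {0..pi} (\<lambda>t. (\<Sum>i\<le>N. a i * cos t ^ i) * sin t ^ (CARD('n) - 2))"
proof -
  let ?m = "CARD('n) - 2"
  have power: "sphere_mean (\<lambda>z. (z \<bullet> e) ^ k) = cap_norm CARD('n) * integral {0..pi} (\<lambda>t. cos t ^ k * sin t ^ ?m)" for k
  proof (induction k rule: nat_induct2)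
    case 0
    show ?case using cap_norm_integral[OF n] by simp
  next
    case 1
    show ?case using sphere_mean_axis_power(1)[OF n e] integral_cos_sin_power(1)[of ?m] by simp
  next
    case (step k)
    have "real k + real ?m + 2 = real k + real CARD('n)" using n by auto
    then have "(real k + real CARD('n)) * sphere_mean (\<lambda>z. (z \<bullet> e) ^ (k + 2)) =
      (real k + real CARD('n)) * (cap_norm CARD('n) * integral {0..pi} (\<lambda>t. cos t ^ (k + 2) * sin t ^ ?m))"
      using integral_cos_sin_power(2)[of k ?m] unfolding sphere_mean_axis_power(2)[OF n e] step by simp
    moreover have "real k + real CARD('n) \<noteq> 0" using n by linarith
    ultimately show ?case by (simp only: mult_cancel_left) simp
  qed
  have "sphere_mean (\<lambda>z. \<Sum>i\<le>N. a i * (z \<bullet> e) ^ i) = (\<Sum>i\<le>N. a i * sphere_mean (\<lambda>z. (z \<bullet> e) ^ i))"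
    by (subst sphere_mean_sum) (intro continuous_intros sum.cong refl sphere_mean_cmult)+
  also have "\<dots> = cap_norm CARD('n) * (\<Sum>i\<le>N. integral {0..pi} (\<lambda>t. a i * (cos t ^ i * sin t ^ ?m)))"
    by (simp add: power sum_distrib_left mult_ac)
  also have "(\<Sum>i\<le>N. integral {0..pi} (\<lambda>t. a i * (cos t ^ i * sin t ^ ?m))) =
     integral {0..pi} (\<lambda>t. \<Sum>i\<le>N. a i * (cos t ^ i * sin t ^ ?m))"
    by (rule Henstock_Kurzweil_Integration.integral_sum[symmetric])
       (auto intro!: integrable_continuous_real continuous_intros)
  finally show ?thesis by (simp add: sum_distrib_right mult.assoc)
qed

lemma continuous_on_sphere_axis:
  fixes e :: "real^'n::finite"
  assumes "norm e = 1" "continuous_on {-1..1} h"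
  shows "continuous_on (sphere 0 1) (\<lambda>z. h (z \<bullet> e))"
proof (rule continuous_on_compose2[OF assms(2)])
  show "(\<lambda>z. z \<bullet> e) ` sphere 0 1 \<subseteq> {-1..1}"
  proof (intro image_subsetI)
    fix z :: "real^'n" assume "z \<in> sphere 0 1"
    then have "\<bar>z \<bullet> e\<bar> \<le> 1" using Cauchy_Schwarz_ineq2[of z e] assms(1) by simp
    then show "z \<bullet> e \<in> {-1..1}" by auto
  qed
qed (intro continuous_intros)

text \<open>Both sides are positive linear functionals of \<open>g\<close> that send 1 to 1. A
  polynomial within \<epsilon>/2 of \<open>g\<close> therefore changes each side by at most
  \<epsilon>/2.\<close>

lemma sphere_mean_axis:
  fixes e :: "real^'n::finite"
  assumes n: "CARD('n) \<ge> 2" and e: "norm e = 1" and g: "continuous_on {-1..1} g"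
  shows "sphere_mean (\<lambda>z. g (z \<bullet> e)) =
    cap_norm CARD('n) * integral {0..pi} (\<lambda>t. g (cos t) * sin t ^ (CARD('n) - 2))"
proof -
  let ?m = "CARD('n) - 2"
  let ?I = "\<lambda>g. cap_norm CARD('n) * integral {0..pi} (\<lambda>t. g (cos t) * sin t ^ ?m)"
  let ?M = "\<lambda>g. sphere_mean (\<lambda>z. g (z \<bullet> e))"
  have ze: "z \<bullet> e \<in> {-1..1}" if "norm z = 1" for z
    using Cauchy_Schwarz_ineq2[of z e] that e by auto
  have c: "continuous_on (sphere 0 1) (\<lambda>z. f (z \<bullet> e))" if "continuous_on {-1..1} f" for f :: "real \<Rightarrow> real"
    by (rule continuous_on_sphere_axis[OF e that])
  have "\<bar>?M g - ?I g\<bar> \<le> 0 + \<epsilon>" if "\<epsilon> > 0" for \<epsilon>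
  proof -
    have "\<epsilon> / 2 > 0" using that by simp
    from Stone_Weierstrass_real_polynomial_function[OF compact_Icc g this]
    obtain p where p: "real_polynomial_function p" "\<And>x. x \<in> {-1..1} \<Longrightarrow> \<bar>g x - p x\<bar> < \<epsilon> / 2"
      by blast
    obtain a N where pe: "p = (\<lambda>x. \<Sum>i\<le>N. a i * x ^ i)"
      using p(1) by (auto simp: real_polynomial_function_iff_sum)
    have cp: "continuous_on {-1..1} p" unfolding pe by (intro continuous_intros)
    have eq: "?M p = ?I p" unfolding pe by (rule sphere_mean_axis_polynomial[OF n e])
    have pt: "g (z \<bullet> e) - p (z \<bullet> e) \<le> \<epsilon> / 2" "- (\<epsilon> / 2) \<le> g (z \<bullet> e) - p (z \<bullet> e)" if "norm z = 1" for z
      using p(2)[OF ze[OF that]] unfolding abs_less_iff by linarith+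
    have M: "\<bar>?M g - ?M p\<bar> \<le> \<epsilon> / 2"
    proof -
      have "?M g - ?M p = sphere_mean (\<lambda>z. g (z \<bullet> e) - p (z \<bullet> e))"
        by (intro sphere_mean_diff[symmetric] c g cp)
      moreover have "\<dots> \<le> sphere_mean (\<lambda>z::real^'n. \<epsilon> / 2)"
        by (intro sphere_mean_mono continuous_intros c g cp pt)
      moreover have "sphere_mean (\<lambda>z::real^'n. - (\<epsilon> / 2)) \<le> sphere_mean (\<lambda>z. g (z \<bullet> e) - p (z \<bullet> e))"
        by (intro sphere_mean_mono continuous_intros c g cp pt)
      ultimately show ?thesis by (simp add: abs_le_iff)
    qed
    have I: "\<bar>?I g - ?I p\<bar> \<le> \<epsilon> / 2"
    proof -
      have "norm (integral {0..pi} (\<lambda>t. g (cos t) * sin t ^ ?m - p (cos t) * sin t ^ ?m)) \<le>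
          integral {0..pi} (\<lambda>t. \<epsilon> / 2 * sin t ^ ?m)"
      proof (rule integral_norm_bound_integral)
        fix t :: real assume t: "t \<in> {0..pi}"
        have "\<bar>g (cos t) - p (cos t)\<bar> \<le> \<epsilon> / 2" using p(2)[of "cos t"] by simp
        moreover have "sin t ^ ?m \<ge> 0" using t by (simp add: sin_ge_zero)
        ultimately have "\<bar>g (cos t) - p (cos t)\<bar> * sin t ^ ?m \<le> \<epsilon> / 2 * sin t ^ ?m"
          by (rule mult_right_mono)
        then show "norm (g (cos t) * sin t ^ ?m - p (cos t) * sin t ^ ?m) \<le> \<epsilon> / 2 * sin t ^ ?m"
          using \<open>sin t ^ ?m \<ge> 0\<close> by (simp add: abs_mult flip: left_diff_distrib)
      qed (intro Henstock_Kurzweil_Integration.integrable_diff axis_integrable g cp integrable_continuous_real continuous_intros)+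
      also have "integral {0..pi} (\<lambda>t. g (cos t) * sin t ^ ?m - p (cos t) * sin t ^ ?m) =
        integral {0..pi} (\<lambda>t. g (cos t) * sin t ^ ?m) - integral {0..pi} (\<lambda>t. p (cos t) * sin t ^ ?m)"
        by (intro Henstock_Kurzweil_Integration.integral_diff axis_integrable g cp)
      finally have "cap_norm CARD('n) * \<bar>integral {0..pi} (\<lambda>t. g (cos t) * sin t ^ ?m) - integral {0..pi} (\<lambda>t. p (cos t) * sin t ^ ?m)\<bar>
        \<le> cap_norm CARD('n) * (\<epsilon> / 2 * integral {0..pi} (\<lambda>t. sin t ^ ?m))"
        using cap_norm_pos[OF n] by (intro mult_left_mono) auto
      also have "\<dots> = \<epsilon> / 2" using cap_norm_integral[OF n] by (metis mult.commute mult.left_commute mult.right_neutral)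
      finally show ?thesis using cap_norm_pos[OF n] by (simp add: abs_mult flip: right_diff_distrib)
    qed
    show ?thesis using M I eq by linarith
  qed
  then have "\<bar>?M g - ?I g\<bar> \<le> 0" by (rule field_le_epsilon)
  then show ?thesis by simp
qed

section \<open>Measure and angular radius of a cap\<close>

lemma cap_measure_eq: "cap_measure n \<alpha> = cap_norm n * integral {0..\<alpha>} (\<lambda>t. sin t ^ (n - 2))"
  by (simp add: cap_measure_def cap_norm_def)

lemma continuous_on_cap_measure: "continuous_on {0..pi} (cap_measure n)"
  unfolding cap_measure_eq
  by (intro continuous_intros indefinite_integral_continuous_1 integrable_continuous_real)

lemma cap_measure_strict_mono:
  assumes n: "n \<ge> 2" and ab: "0 \<le> a" "a < b" "b \<le> pi"
  shows "cap_measure n a < cap_measure n b"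
proof (rule DERIV_pos_imp_increasing_open[OF \<open>a < b\<close>])
  fix x assume x: "a < x" "x < b"
  then have "x \<in> {0<..<pi}" using ab by auto
  have "((\<lambda>x. integral {0..x} (\<lambda>t. sin t ^ (n - 2))) has_real_derivative sin x ^ (n - 2)) (at x within {0..pi})"
    by (rule integral_has_real_derivative) (use \<open>x \<in> {0<..<pi}\<close> in \<open>auto intro!: continuous_intros\<close>)
  then have "((\<lambda>x. integral {0..x} (\<lambda>t. sin t ^ (n - 2))) has_real_derivative sin x ^ (n - 2)) (at x)"
    using at_within_interior[of x "{0..pi}"] \<open>x \<in> {0<..<pi}\<close> by simp
  from DERIV_cmult[OF this, of "cap_norm n"]
  show "\<exists>y. (cap_measure n has_real_derivative y) (at x) \<and> 0 < y"
    using cap_norm_pos[OF n] sin_gt_zero[of x] \<open>x \<in> {0<..<pi}\<close>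
    by (intro exI[of _ "cap_norm n * sin x ^ (n - 2)"]) (auto simp: cap_measure_eq[abs_def])
qed (rule continuous_on_subset[OF continuous_on_cap_measure]; use ab in auto)

text \<open>Existence is the intermediate value theorem; the uniqueness demanded by
  \<open>THE\<close> is strict monotonicity of the cap measure.\<close>

lemma cap_angle:
  assumes n: "n \<ge> 2" and c: "0 < c" "c < 1"
  shows "0 < cap_angle n c" "cap_angle n c < pi" "cap_measure n (cap_angle n c) = c"
proof -
  have 0: "cap_measure n 0 = 0" by (simp add: cap_measure_eq)
  have 1: "cap_measure n pi = 1" using cap_norm_integral[OF n] by (simp add: cap_measure_eq)
  have "\<exists>\<alpha>\<ge>0. \<alpha> \<le> pi \<and> cap_measure n \<alpha> = c"
    by (rule IVT') (use 0 1 c continuous_on_cap_measure in auto)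
  then obtain \<alpha> where \<alpha>: "0 \<le> \<alpha>" "\<alpha> \<le> pi" "cap_measure n \<alpha> = c" by blast
  then have \<alpha>': "0 < \<alpha>" "\<alpha> < pi" using 0 1 c by (metis less_irrefl order_le_less)+
  have "0 < cap_angle n c \<and> cap_angle n c < pi \<and> cap_measure n (cap_angle n c) = c"
    unfolding cap_angle_def
  proof (rule theI[of _ \<alpha>])
    fix \<beta> assume "0 < \<beta> \<and> \<beta> < pi \<and> cap_measure n \<beta> = c"
    then show "\<beta> = \<alpha>"
      using cap_measure_strict_mono[OF n, of \<alpha> \<beta>] cap_measure_strict_mono[OF n, of \<beta> \<alpha>] \<alpha> \<alpha>'
      by (cases \<alpha> \<beta> rule: linorder_cases) auto
  qed (use \<alpha> \<alpha>' in auto)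
  then show "0 < cap_angle n c" "cap_angle n c < pi" "cap_measure n (cap_angle n c) = c" by auto
qed

lemma cap_measure_complement:
  assumes n: "n \<ge> 2" and \<alpha>: "0 \<le> \<alpha>" "\<alpha> \<le> pi"
  shows "cap_norm n * integral {\<alpha>..pi} (\<lambda>t. sin t ^ (n - 2)) = 1 - cap_measure n \<alpha>"
proof -
  have "integral {0..\<alpha>} (\<lambda>t. sin t ^ (n - 2)) + integral {\<alpha>..pi} (\<lambda>t. sin t ^ (n - 2)) = integral {0..pi} (\<lambda>t. sin t ^ (n - 2))"
    using \<alpha> by (intro Henstock_Kurzweil_Integration.integral_combine integrable_continuous_real continuous_intros)
  then show ?thesis
    using cap_norm_integral[OF n] by (simp add: cap_measure_eq algebra_simps flip: distrib_left)
qed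

section \<open>The harmonic Schwarz lemma along an axis\<close>

text \<open>The Poisson kernel at \<open>r e\<close> divided by \<open>1 - r\<close>, with
  \<open>s\<close> the cosine of the angle to \<open>e\<close>; the factor \<open>1 + r\<close> is
  what remains of \<open>1 - r\<^sup>2\<close>.\<close>

definition cap_kernel :: "nat \<Rightarrow> real \<Rightarrow> real \<Rightarrow> real" where
  "cap_kernel n r s = (1 + r) * (1 + r\<^sup>2 - 2 * r * s) powr (- real n / 2)"

text \<open>The mean of the kernel against a function equal to 2 at angles at least \<beta> and to 0
  elsewhere, written as an angular integral.\<close>

definition far_cap_integral :: "nat \<Rightarrow> real \<Rightarrow> real \<Rightarrow> real" where
  "far_cap_integral n \<beta> r =
     2 * cap_norm n * integral {\<beta>..pi} (\<lambda>t. cap_kernel n r (cos t) * sin t ^ (n - 2))"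

lemma cap_kernel_base_pos:
  fixes r s :: real
  assumes "0 \<le> r" "s \<le> 1" "r < 1 \<or> s < 1"
  shows "1 + r\<^sup>2 - 2 * r * s > 0"
proof -
  have eq: "1 + r\<^sup>2 - 2 * r * s = (1 - r)\<^sup>2 + 2 * r * (1 - s)"
    by (simp add: power2_eq_square algebra_simps)
  have "(1 - r)\<^sup>2 \<ge> 0" "2 * r * (1 - s) \<ge> 0" using assms by auto
  moreover have "(1 - r)\<^sup>2 > 0 \<or> 2 * r * (1 - s) > 0" using assms by (cases "r = 1") auto
  ultimately show ?thesis unfolding eq by linarith
qed

lemma continuous_on_cap_kernel:
  fixes f g :: "'a::topological_space \<Rightarrow> real"
  assumes "continuous_on S f" "continuous_on S g"
    "\<And>x. x \<in> S \<Longrightarrow> 0 \<le> f x \<and> g x \<le> 1 \<and> (f x < 1 \<or> g x < 1)"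
  shows "continuous_on S (\<lambda>x. cap_kernel n (f x) (g x))"
proof -
  have "1 + (f x)\<^sup>2 - 2 * f x * g x \<noteq> 0" if "x \<in> S" for x
    using cap_kernel_base_pos[of "f x" "g x"] assms(3)[OF that] by auto
  then show ?thesis
    unfolding cap_kernel_def by (intro continuous_intros assms(1,2)) auto
qed

lemma cap_kernel_mono:
  assumes "0 \<le> r" "s \<le> s'" "s' \<le> 1" "r < 1 \<or> s' < 1"
  shows "cap_kernel n r s \<le> cap_kernel n r s'"
  unfolding cap_kernel_def
proof (intro mult_left_mono powr_mono2')
  have "r * s \<le> r * s'" using assms by (intro mult_left_mono)
  then show "1 + r\<^sup>2 - 2 * r * s' \<le> 1 + r\<^sup>2 - 2 * r * s" by simp
qed (use assms cap_kernel_base_pos[of r s'] in auto)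

lemma cos_less_1: "0 < t \<Longrightarrow> t \<le> pi \<Longrightarrow> cos t < 1"
  using cos_monotone_0_pi[of 0 t] by simp

lemma far_cap_integrable:
  assumes "0 < \<beta>" "0 \<le> r"
  shows "(\<lambda>t. cap_kernel n r (cos t) * sin t ^ m) integrable_on {\<beta>..pi}"
  using assms by (intro integrable_continuous_real continuous_intros continuous_on_cap_kernel)
    (auto simp: cos_less_1)

lemma continuous_on_far_cap_integral:
  assumes "0 < \<beta>"
  shows "continuous_on {0..1} (far_cap_integral n \<beta>)"
proof -
  have "continuous_on ({0..1} \<times> {\<beta>..pi}) (\<lambda>(r, t). cap_kernel n r (cos t) * sin t ^ (n - 2))"
    unfolding split_beta using assms
    by (intro continuous_intros continuous_on_cap_kernel) (auto simp: cos_less_1)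
  then have "continuous_on {0..1} (\<lambda>r. integral (cbox \<beta> pi) (\<lambda>t. cap_kernel n r (cos t) * sin t ^ (n - 2)))"
    by (intro integral_continuous_on_param) simp
  then show ?thesis unfolding far_cap_integral_def[abs_def] by (intro continuous_intros) simp
qed

text \<open>Room for the sharpness construction: a continuous cutoff has to begin rising at some
  \<beta> < \<alpha>, and the resulting loss can be kept below any given gap.\<close>

lemma far_cap_integral_left_limit:
  assumes \<alpha>: "0 < \<alpha>" "\<alpha> \<le> pi" and C: "far_cap_integral n \<alpha> 1 < C"
  obtains \<beta> where "0 < \<beta>" "\<beta> < \<alpha>" "far_cap_integral n \<beta> 1 < C"
proof -
  define g where "g t = cap_kernel n 1 (cos t) * sin t ^ (n - 2)" for t
  have int: "g integrable_on {\<beta>..pi}" if "\<beta> > 0" for \<beta>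
    unfolding g_def[abs_def] using that by (intro far_cap_integrable) auto
  \<comment> \<open>Starting at \<alpha>/2 keeps every integral away from the singularity of the
    kernel at angle 0.\<close>
  have "continuous_on {\<alpha>/2..\<alpha>} (\<lambda>\<beta>. 2 * cap_norm n * (integral {\<alpha>/2..pi} g - integral {\<alpha>/2..\<beta>} g))"
    using \<alpha> integrable_subinterval_real[OF int[of "\<alpha>/2"]]
    by (intro continuous_intros indefinite_integral_continuous_1) auto
  moreover have "2 * cap_norm n * (integral {\<alpha>/2..pi} g - integral {\<alpha>/2..\<beta>} g) = far_cap_integral n \<beta> 1"
    if "\<beta> \<in> {\<alpha>/2..\<alpha>}" for \<beta>
    using Henstock_Kurzweil_Integration.integral_combine[of "\<alpha>/2" \<beta> pi g] int[of "\<alpha>/2"] that \<alpha>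
    by (simp add: far_cap_integral_def g_def[abs_def])
  ultimately have "continuous_on {\<alpha>/2..\<alpha>} (\<lambda>\<beta>. far_cap_integral n \<beta> 1)"
    by (rule continuous_on_eq)
  then have "((\<lambda>\<beta>. far_cap_integral n \<beta> 1) \<longlongrightarrow> far_cap_integral n \<alpha> 1) (at \<alpha> within {\<alpha>/2..\<alpha>})"
    unfolding continuous_on_def using \<alpha> by auto
  then have ev: "\<forall>\<^sub>F \<beta> in at \<alpha> within {\<alpha>/2..\<alpha>}. far_cap_integral n \<beta> 1 < C"
    using C by (rule order_tendstoD)
  have ev2: "\<forall>\<^sub>F \<beta> in at \<alpha> within {\<alpha>/2..\<alpha>}. \<beta> \<in> {\<alpha>/2..\<alpha>} - {\<alpha>}"
    by (simp add: eventually_at_filter)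
  have "at \<alpha> within {\<alpha>/2..\<alpha>} \<noteq> bot"
    using \<alpha> by (simp add: at_within_Icc_at_left trivial_limit_at_left_real)
  from eventually_happens'[OF this eventually_conj[OF ev ev2]]
  obtain \<beta> where "far_cap_integral n \<beta> 1 < C" "\<beta> \<in> {\<alpha>/2..\<alpha>} - {\<alpha>}" by blast
  then show thesis using \<alpha> by (intro that[of \<beta>]) auto
qed

text \<open>The half angle in the constant is a chord length: \<open>2 - 2 * cos t\<close> is the
  square of \<open>2 * sin (t / 2)\<close>.\<close>

lemma cap_kernel_1_cos:
  assumes "0 < t" "t \<le> pi"
  shows "cap_kernel n 1 (cos t) = 2 * (2 powr (- real n) / sin (t / 2) ^ n)"
proof -
  have s: "sin (t / 2) > 0" using assms by (intro sin_gt_zero) auto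
  have "1 + 1\<^sup>2 - 2 * 1 * cos t = (2 * sin (t / 2)) powr 2"
    using cos_double_sin[of "t / 2"] s by (simp add: power2_eq_square)
  then have "cap_kernel n 1 (cos t) = 2 * (2 * sin (t / 2)) powr (- real n)"
    unfolding cap_kernel_def by (simp add: powr_powr)
  also have "\<dots> = 2 * (2 powr (- real n) * sin (t / 2) powr (- real n))"
    using s by (simp add: powr_mult)
  also have "sin (t / 2) powr (- real n) = 1 / sin (t / 2) ^ n"
    by (simp only: powr_minus_divide powr_realpow[OF s])
  finally show ?thesis by simp
qed

lemma schwarz_const_eq:
  assumes n: "n \<ge> 2" and a: "-1 < a" "a < 1"
  shows "schwarz_const n a = far_cap_integral n (cap_angle n ((a + 1) / 2)) 1"
proof -
  let ?\<alpha> = "cap_angle n ((a + 1) / 2)"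
  have "0 < ?\<alpha>" by (rule cap_angle) (use n a in auto)
  then have "integral {?\<alpha>..pi} (\<lambda>t. cap_kernel n 1 (cos t) * sin t ^ (n - 2)) =
    integral {?\<alpha>..pi} (\<lambda>t. (2 * 2 powr (- real n)) * (sin t ^ (n - 2) / sin (t / 2) ^ n))"
    by (intro integral_cong) (simp add: cap_kernel_1_cos)
  also have "\<dots> = (2 * 2 powr (- real n)) * integral {?\<alpha>..pi} (\<lambda>t. sin t ^ (n - 2) / sin (t / 2) ^ n)"
    by (rule Henstock_Kurzweil_Integration.integral_mult_right)
  finally have "far_cap_integral n ?\<alpha> 1 =
    (4 * 2 powr (- real n)) * cap_norm n * integral {?\<alpha>..pi} (\<lambda>t. sin t ^ (n - 2) / sin (t / 2) ^ n)"
    by (simp add: far_cap_integral_def)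
  \<comment> \<open>One factor 2 is \<open>1 + r\<close> at r = 1, the other is the upper bound of
    \<open>v\<close>; the power 2^(-n) comes from the chord.\<close>
  also have "4 * 2 powr (- real n) = 2 powr (2 - real n)"
    using powr_add[of 2 2 "- real n"] by simp
  finally show ?thesis by (simp add: schwarz_const_def cap_norm_def)
qed

text \<open>The kernel is smallest at the antipode of the pole, and the far cap has positive
  measure. This later gives \<lambda> > 0.\<close>

lemma schwarz_const_pos:
  assumes n: "n \<ge> 2" and a: "-1 < a" "a < 1"
  shows "schwarz_const n a > 0"
proof -
  let ?\<alpha> = "cap_angle n ((a + 1) / 2)"
  have "0 < (a + 1) / 2" "(a + 1) / 2 < 1" using a by auto
  note \<alpha> = cap_angle[OF n this]
  have "cap_norm n * integral {?\<alpha>..pi} (\<lambda>t. sin t ^ (n - 2)) = 1 - (a + 1) / 2"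
    using cap_measure_complement[OF n, of ?\<alpha>] \<alpha> by simp
  then have "0 < cap_norm n * integral {?\<alpha>..pi} (\<lambda>t. sin t ^ (n - 2))" using a by simp
  then have "0 < integral {?\<alpha>..pi} (\<lambda>t. sin t ^ (n - 2))"
    using cap_norm_pos[OF n] by (rule zero_less_mult_pos)
  then have "0 < 2 * cap_norm n * (cap_kernel n 1 (- 1) * integral {?\<alpha>..pi} (\<lambda>t. sin t ^ (n - 2)))"
    using cap_norm_pos[OF n] by (simp add: cap_kernel_def)
  also have "cap_kernel n 1 (- 1) * integral {?\<alpha>..pi} (\<lambda>t. sin t ^ (n - 2)) =
      integral {?\<alpha>..pi} (\<lambda>t. cap_kernel n 1 (- 1) * sin t ^ (n - 2))"
    by simp
  also have "2 * cap_norm n * \<dots> \<le> far_cap_integral n ?\<alpha> 1"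
    unfolding far_cap_integral_def
  proof (intro mult_left_mono integral_le far_cap_integrable)
    fix t assume "t \<in> {?\<alpha>..pi}"
    then show "cap_kernel n 1 (- 1) * sin t ^ (n - 2) \<le> cap_kernel n 1 (cos t) * sin t ^ (n - 2)"
      using \<alpha> by (intro mult_right_mono cap_kernel_mono) (auto simp: cos_less_1 sin_ge_zero)
  qed (use \<alpha> cap_norm_pos[OF n] in \<open>auto intro!: integrable_continuous_real continuous_intros\<close>)
  finally show ?thesis using schwarz_const_eq[OF n a] by simp
qed

section \<open>The lower bound inside the ball\<close>

lemma harmonic_mean_value:
  fixes v :: "real^'n::finite \<Rightarrow> real"
  assumes n: "CARD('n) \<ge> 2"
    and hv: "has_hessian (ball 0 1) v G H" and tr: "\<And>x. x \<in> ball 0 1 \<Longrightarrow> trace (H x) = 0"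
    and \<rho>: "0 < \<rho>" "\<rho> < 1"
  shows "sphere_mean (\<lambda>z. v (\<rho> *\<^sub>R z)) = v 0"
proof -
  define e :: "real^'n" where "e = axis undefined 1"
  have e: "norm e = 1" by (simp add: e_def)
  note v = has_hessianD(3)[OF hv]
  define f where "f r = sphere_mean (\<lambda>z. poisson_kernel (r *\<^sub>R z) e * v (\<rho> *\<^sub>R z)) - v ((r * \<rho>) *\<^sub>R e)" for r
  have "continuous_on ({0..<1} \<times> sphere 0 1) (\<lambda>(r, z). poisson_kernel (r *\<^sub>R z) e * v (\<rho> *\<^sub>R z))"
    using continuous_on_poisson_axis[OF n e] \<rho> unfolding split_beta
    by (intro continuous_intros continuous_on_compose2[OF v]) auto
  moreover have "continuous_on {0..<1} (\<lambda>r. v ((r * \<rho>) *\<^sub>R e))"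
    by (intro continuous_on_compose2[OF v] continuous_intros)
       (use e \<rho> mult_strict_mono[of _ 1 \<rho> 1] in \<open>auto simp: abs_mult\<close>)
  ultimately have "continuous_on {0..<1} f"
    unfolding f_def[abs_def] by (intro continuous_on_diff sphere_mean_continuous_on)
  then have "f 0 = 0"
  proof (rule continuous_on_const_left_end)
    fix r :: real assume "0 < r" "r < 1"
    then show "f r = 0" using poisson_formula_axis[OF n e hv tr _ _ \<rho>, of r] by (simp add: f_def)
  qed
  then show ?thesis by (simp add: f_def poisson_kernel_0 e)
qed

lemma poisson_kernel_axis:
  fixes e z :: "real^'n::finite"
  assumes "norm z = 1" "norm e = 1"
  shows "poisson_kernel (r *\<^sub>R z) e = (1 - r) * cap_kernel CARD('n) r (z \<bullet> e)"
proof -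
  have "z \<bullet> z = 1" "e \<bullet> e = 1" using assms by (simp_all add: norm_eq_1)
  then have "(r *\<^sub>R z - e) \<bullet> (r *\<^sub>R z - e) = 1 + r\<^sup>2 - 2 * r * (z \<bullet> e)"
    "1 - (r *\<^sub>R z) \<bullet> (r *\<^sub>R z) = (1 - r) * (1 + r)"
    by (simp_all add: inner_diff_left inner_diff_right inner_commute power2_eq_square algebra_simps)
  then show ?thesis by (simp add: poisson_kernel_def cap_kernel_def)
qed

text \<open>A bathtub argument: \<kappa> is the kernel on the rim of the cap and \<open>h\<close>
  the positive part of \<kappa> - k. For 0 \<le> v \<le> 2 one has k v \<ge> \<kappa> v - 2 h
  pointwise, with equality when v = 2 on the far cap and 0 elsewhere, and the mean of the right side
  involves \<open>v\<close> only through \<open>v 0\<close>.\<close>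

lemma harmonic_cap_lower_bound:
  fixes v :: "real^'n::finite \<Rightarrow> real"
  assumes n: "CARD('n) \<ge> 2" and e: "norm e = 1"
    and hv: "has_hessian (ball 0 1) v G H" and tr: "\<And>x. x \<in> ball 0 1 \<Longrightarrow> trace (H x) = 0"
    and bd: "\<And>x. x \<in> ball 0 1 \<Longrightarrow> 0 \<le> v x \<and> v x \<le> 2"
    and v0: "v 0 = 1 - a" and a: "-1 < a" "a < 1" and r: "0 < r" "r < 1"
  shows "(1 - r) * far_cap_integral CARD('n) (cap_angle CARD('n) ((a + 1) / 2)) r \<le> v (r *\<^sub>R e)"
proof -
  define N where "N = CARD('n)"
  define \<alpha> where "\<alpha> = cap_angle N ((a + 1) / 2)"
  define k where "k s = cap_kernel N r s" for s
  define \<kappa> where "\<kappa> = k (cos \<alpha>)"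
  define h where "h s = max 0 (\<kappa> - k s)" for s
  note v = has_hessianD(3)[OF hv]
  have N: "N \<ge> 2" using n by (simp add: N_def)
  have "0 < (a + 1) / 2" "(a + 1) / 2 < 1" using a by auto
  note \<alpha> = cap_angle[OF N this, folded \<alpha>_def]
  have ck: "continuous_on {-1..1} k"
    unfolding k_def using r by (intro continuous_on_cap_kernel continuous_intros) auto
  have ch: "continuous_on {-1..1} h"
    unfolding h_def by (intro continuous_intros ck)
  note on_sphere = continuous_on_sphere_axis[OF e]
  \<comment> \<open>\<open>h\<close> is \<kappa> - k on the far cap and 0 on the near one. The far
    cap has measure (1 - a)/2, so the term with \<kappa> will cancel against \<kappa> times
    \<open>v 0\<close>.\<close>
  have mean_h: "2 * sphere_mean (\<lambda>z. h (z \<bullet> e)) = \<kappa> * (1 - a) - far_cap_integral N \<alpha> r"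
  proof -
    let ?f = "\<lambda>t. h (cos t) * sin t ^ (N - 2)"
    have near: "h (cos t) = 0" if "0 \<le> t" "t \<le> \<alpha>" for t
      using that \<alpha> r cap_kernel_mono[of r "cos \<alpha>" "cos t" N] cos_monotone_0_pi_le[of t \<alpha>]
      by (simp add: h_def k_def \<kappa>_def max_def)
    have far: "h (cos t) = \<kappa> - k (cos t)" if "\<alpha> \<le> t" "t \<le> pi" for t
      using that \<alpha> r cap_kernel_mono[of r "cos t" "cos \<alpha>" N] cos_monotone_0_pi_le[of \<alpha> t]
      by (simp add: h_def k_def \<kappa>_def max_def)
    have "integral {0..pi} ?f = integral {0..\<alpha>} ?f + integral {\<alpha>..pi} ?f"
      using \<alpha> by (intro Henstock_Kurzweil_Integration.integral_combine[symmetric] axis_integrable ch) auto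
    also have "integral {0..\<alpha>} ?f = integral {0..\<alpha>} (\<lambda>_. 0)"
      by (intro integral_cong) (simp add: near)
    also have "integral {\<alpha>..pi} ?f = integral {\<alpha>..pi} (\<lambda>t. \<kappa> * sin t ^ (N - 2) - k (cos t) * sin t ^ (N - 2))"
      by (intro integral_cong) (simp add: far left_diff_distrib)
    also have "\<dots> = integral {\<alpha>..pi} (\<lambda>t. \<kappa> * sin t ^ (N - 2)) - integral {\<alpha>..pi} (\<lambda>t. k (cos t) * sin t ^ (N - 2))"
      unfolding k_def using \<alpha> r
      by (intro Henstock_Kurzweil_Integration.integral_diff far_cap_integrable integrable_continuous_real continuous_intros) auto
    finally have "integral {0..pi} ?f =
      \<kappa> * integral {\<alpha>..pi} (\<lambda>t. sin t ^ (N - 2)) - integral {\<alpha>..pi} (\<lambda>t. k (cos t) * sin t ^ (N - 2))"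
      by simp
    then have "2 * sphere_mean (\<lambda>z. h (z \<bullet> e)) = 2 * (cap_norm N *
        (\<kappa> * integral {\<alpha>..pi} (\<lambda>t. sin t ^ (N - 2)) - integral {\<alpha>..pi} (\<lambda>t. k (cos t) * sin t ^ (N - 2))))"
      unfolding sphere_mean_axis[OF n e ch] N_def by simp
    also have "\<dots> = 2 * \<kappa> * (cap_norm N * integral {\<alpha>..pi} (\<lambda>t. sin t ^ (N - 2))) - far_cap_integral N \<alpha> r"
      by (simp add: far_cap_integral_def k_def algebra_simps)
    also have "cap_norm N * integral {\<alpha>..pi} (\<lambda>t. sin t ^ (N - 2)) = (1 - a) / 2"
      using cap_measure_complement[OF N, of \<alpha>] \<alpha> by (simp add: field_simps)
    finally show ?thesis by simp
  qed
  have "(1 - r) * far_cap_integral N \<alpha> r \<le> v ((r * \<rho>) *\<^sub>R e)" if \<rho>: "0 < \<rho>" "\<rho> < 1" for \<rho>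
  proof -
    have in_ball: "\<rho> *\<^sub>R z \<in> ball 0 1" if "norm z = 1" for z :: "real^'n" using that \<rho> by simp
    have cv: "continuous_on (sphere 0 1) (\<lambda>z. v (\<rho> *\<^sub>R z))"
      by (rule continuous_on_compose2[OF v]) (use \<rho> in \<open>auto intro!: continuous_intros\<close>)
    have "\<kappa> * (1 - a) - 2 * sphere_mean (\<lambda>z. h (z \<bullet> e)) = sphere_mean (\<lambda>z. \<kappa> * v (\<rho> *\<^sub>R z) - 2 * h (z \<bullet> e))"
      using sphere_mean_diff[OF continuous_on_mult_left[OF cv] continuous_on_mult_left[OF on_sphere[OF ch]], of \<kappa> 2]
        sphere_mean_cmult[OF cv, of \<kappa>] sphere_mean_cmult[OF on_sphere[OF ch], of 2]
        harmonic_mean_value[OF n hv tr \<rho>] v0 by simp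
    also have "\<dots> \<le> sphere_mean (\<lambda>z. k (z \<bullet> e) * v (\<rho> *\<^sub>R z))"
    proof (intro sphere_mean_mono continuous_intros cv on_sphere ch ck)
      fix z :: "real^'n" assume "norm z = 1"
      then have b: "0 \<le> v (\<rho> *\<^sub>R z)" "v (\<rho> *\<^sub>R z) \<le> 2" using bd[OF in_ball] by auto
      show "\<kappa> * v (\<rho> *\<^sub>R z) - 2 * h (z \<bullet> e) \<le> k (z \<bullet> e) * v (\<rho> *\<^sub>R z)"
      proof (cases "\<kappa> \<le> k (z \<bullet> e)")
        case True
        then show ?thesis using mult_right_mono[OF True b(1)] by (simp add: h_def)
      next
        case False
        then have "(\<kappa> - k (z \<bullet> e)) * v (\<rho> *\<^sub>R z) \<le> (\<kappa> - k (z \<bullet> e)) * 2"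
          using b by (intro mult_left_mono) auto
        then show ?thesis using False by (simp add: h_def algebra_simps)
      qed
    qed
    finally have "far_cap_integral N \<alpha> r \<le> sphere_mean (\<lambda>z. k (z \<bullet> e) * v (\<rho> *\<^sub>R z))"
      unfolding mean_h by simp
    then have "(1 - r) * far_cap_integral N \<alpha> r \<le> (1 - r) * sphere_mean (\<lambda>z. k (z \<bullet> e) * v (\<rho> *\<^sub>R z))"
      using r by (intro mult_left_mono) auto
    also have "\<dots> = sphere_mean (\<lambda>z. (1 - r) * (k (z \<bullet> e) * v (\<rho> *\<^sub>R z)))"
      by (intro sphere_mean_cmult[symmetric] continuous_intros cv on_sphere ck)
    also have "\<dots> = sphere_mean (\<lambda>z. poisson_kernel (r *\<^sub>R z) e * v (\<rho> *\<^sub>R z))"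
      by (intro sphere_mean_cong) (simp add: poisson_kernel_axis e k_def N_def)
    also have "\<dots> = v ((r * \<rho>) *\<^sub>R e)"
      by (rule poisson_formula_axis[OF n e hv tr r \<rho>])
    finally show ?thesis .
  qed
  \<comment> \<open>The bound is free of \<rho>, so \<rho> may now tend to 1 by continuity of
    \<open>v\<close> at the interior point \<open>r e\<close>.\<close>
  then have "\<forall>\<^sub>F \<rho> in at_left 1. (1 - r) * far_cap_integral N \<alpha> r \<le> v ((r * \<rho>) *\<^sub>R e)"
    using eventually_at_left_real[of 0 1] by (auto elim!: eventually_mono)
  moreover have "((\<lambda>\<rho>. v ((r * \<rho>) *\<^sub>R e)) \<longlongrightarrow> v ((r * 1) *\<^sub>R e)) (at_left 1)"
  proof (rule isCont_tendsto_compose[where g = v])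
    have "r *\<^sub>R e \<in> ball 0 1" using r e by simp
    then show "isCont v ((r * 1) *\<^sub>R e)"
      using continuous_on_eq_continuous_at[OF open_ball] v by (metis mult.right_neutral)
  qed (intro tendsto_intros)
  ultimately have "(1 - r) * far_cap_integral N \<alpha> r \<le> v ((r * 1) *\<^sub>R e)"
    by (intro tendsto_lowerbound) auto
  then show ?thesis by (simp add: N_def \<alpha>_def)
qed

section \<open>Boundary estimates\<close>

lemma C2_on_has_hessian:
  fixes u :: "real^'n::finite \<Rightarrow> real"
  assumes S: "open S" and u: "C2_on S u"
  shows "has_hessian S u (\<lambda>x. \<chi> i. partial_deriv i u x) (\<lambda>x. \<chi> i j. partial_deriv j (partial_deriv i u) x)"
proof -
  have D: "(w has_derivative (\<lambda>h. (\<chi> i. partial_deriv i w x) \<bullet> h)) (at x)"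
    if w: "w differentiable_on S" and x: "x \<in> S" for w :: "real^'n \<Rightarrow> real" and x
  proof -
    have "w differentiable at x" using w x S by (metis differentiable_on_eq_differentiable_at)
    then have d: "(w has_derivative frechet_derivative w (at x)) (at x)" by (rule iffD1[OF frechet_derivative_works])
    then interpret linear "frechet_derivative w (at x)" by (rule has_derivative_linear)
    have "frechet_derivative w (at x) h = (\<chi> i. partial_deriv i w x) \<bullet> h" for h
    proof -
      have "frechet_derivative w (at x) h = frechet_derivative w (at x) (\<Sum>i\<in>UNIV. h $ i *\<^sub>R axis i 1)"
        using basis_expansion[of h] by (simp add: scalar_mult_eq_scaleR)
      also have "\<dots> = (\<chi> i. partial_deriv i w x) \<bullet> h"
        by (simp add: sum scale inner_vec_def partial_deriv_def mult.commute)
      finally show ?thesis .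
    qed
    then have "frechet_derivative w (at x) = (\<lambda>h. (\<chi> i. partial_deriv i w x) \<bullet> h)" by (rule ext)
    then show ?thesis using d by (simp only:)
  qed
  have u': "u differentiable_on S" "partial_deriv i u differentiable_on S"
    "continuous_on S (partial_deriv j (partial_deriv i u))" for i j
    using u by (auto simp: C2_on_def C1_on_def)
  show ?thesis
    unfolding has_hessian_def
    using D[OF u'(1)] D[OF u'(2)] u'(3) by (auto intro!: continuous_intros)
qed

lemma has_hessian_C2_on:
  fixes u :: "real^'n::finite \<Rightarrow> real"
  assumes S: "open S" and u: "has_hessian S u G H"
  shows "C2_on S u" and "\<And>x. x \<in> S \<Longrightarrow> laplacian u x = trace (H x)"
proof -
  note h = has_hessianD[OF u]
  have pd: "partial_deriv i w x = d (axis i 1)" if "(w has_derivative d) (at x)" for i w d and x :: "real^'n"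
    using frechet_derivative_at[OF that] by (simp add: partial_deriv_def)
  have 1: "partial_deriv i u x = G x $ i" if "x \<in> S" for i x
    using pd[OF h(1)[OF that]] by (simp add: inner_axis)
  have d1: "(partial_deriv i u has_derivative (\<lambda>h. H x $ i \<bullet> h)) (at x)" if "x \<in> S" for i x
    by (rule has_derivative_transform_within_open[OF h(2)[OF that] S that]) (simp add: 1)
  have 2: "partial_deriv j (partial_deriv i u) x = H x $ i $ j" if "x \<in> S" for i j x
    using pd[OF d1[OF that]] by (simp add: inner_axis)
  have "u differentiable_on S" "partial_deriv i u differentiable_on S" for i
    unfolding differentiable_on_def differentiable_def
    using has_derivative_at_withinI[OF h(1)] has_derivative_at_withinI[OF d1] by blast+
  moreover have "continuous_on S (partial_deriv i u)" for i
    by (rule continuous_on_eq[OF continuous_on_component[OF h(4)]]) (simp add: 1)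
  moreover have "continuous_on S (partial_deriv j (partial_deriv i u))" for i j
    by (rule continuous_on_eq[OF continuous_on_component[OF continuous_on_component[OF h(5)]]]) (simp add: 2)
  ultimately show "C2_on S u" by (auto simp: C2_on_def C1_on_def)
  show "laplacian u x = trace (H x)" if "x \<in> S" for x
    using that by (simp add: laplacian_def trace_def 2)
qed

text \<open>The index type serves two uses: the components of \<open>f\<close> paired with
  \<open>y\<^sub>0\<close>, and, with the type \<open>unit\<close>, multiples of a single
  function.\<close>

lemma has_hessian_affine:
  fixes u :: "'k::finite \<Rightarrow> real^'n::finite \<Rightarrow> real"
  assumes "\<And>k. has_hessian S (u k) (G k) (H k)"
  shows "has_hessian S (\<lambda>x. b + (\<Sum>k\<in>UNIV. c k * u k x)) (\<lambda>x. \<Sum>k\<in>UNIV. c k *\<^sub>R G k x) (\<lambda>x. \<Sum>k\<in>UNIV. c k *\<^sub>R H k x)"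
proof -
  note h = has_hessianD[OF assms]
  show ?thesis
    unfolding has_hessian_def
  proof (intro conjI ballI allI)
    fix x i assume x: "x \<in> S"
    have "((\<lambda>x. b + (\<Sum>k\<in>UNIV. c k * u k x)) has_derivative (\<lambda>h. 0 + (\<Sum>k\<in>UNIV. c k * (G k x \<bullet> h)))) (at x)"
      by (intro has_derivative_add has_derivative_const has_derivative_sum has_derivative_mult_right h(1) x)
    then show "((\<lambda>x. b + (\<Sum>k\<in>UNIV. c k * u k x)) has_derivative (\<lambda>h. (\<Sum>k\<in>UNIV. c k *\<^sub>R G k x) \<bullet> h)) (at x)"
      by (simp add: inner_sum_left)
    have "((\<lambda>x. \<Sum>k\<in>UNIV. c k * G k x $ i) has_derivative (\<lambda>h. \<Sum>k\<in>UNIV. c k * (H k x $ i \<bullet> h))) (at x)"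
      by (intro has_derivative_sum has_derivative_mult_right h(2) x)
    then show "((\<lambda>x. (\<Sum>k\<in>UNIV. c k *\<^sub>R G k x) $ i) has_derivative (\<lambda>h. (\<Sum>k\<in>UNIV. c k *\<^sub>R H k x) $ i \<bullet> h)) (at x)"
      by (simp add: inner_sum_left)
  next
    show "continuous_on S (\<lambda>x. \<Sum>k\<in>UNIV. c k *\<^sub>R H k x)" by (intro continuous_intros h)
  qed
qed

lemma harmonic_on_has_derivative:
  fixes f :: "real^'n::finite \<Rightarrow> real^'m::finite"
  assumes "open S" "harmonic_on S f" "x \<in> S"
  shows "(f has_derivative frechet_derivative f (at x)) (at x)"
proof (rule iffD1[OF frechet_derivative_works])
  have "(\<lambda>x. f x \<bullet> i) differentiable at x" if i: "i \<in> Basis" for i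
  proof -
    obtain k where k: "i = axis k 1" using i by (auto simp: Basis_vec_def)
    have "C2_on S (\<lambda>x. f x $ k)" using assms(2) by (simp add: harmonic_on_def)
    from has_hessianD(1)[OF C2_on_has_hessian[OF assms(1) this] assms(3)]
    show ?thesis by (auto simp: k inner_axis differentiable_def)
  qed
  then show "f differentiable at x"
    by (subst differentiable_componentwise_within) blast
qed

text \<open>A growth bound with variable slope passes to the one-sided derivative. The slope is
  minus the Schwarz quotient in the normal direction and 0 in the tilted tangential one.\<close>

lemma has_derivative_upper_bound:
  fixes \<phi> \<beta> :: "real \<Rightarrow> real"
  assumes t0: "t0 > 0" and d: "(\<phi> has_real_derivative d) (at 0 within {0..t0})"
    and le: "\<And>t. 0 < t \<Longrightarrow> t < t0 \<Longrightarrow> \<phi> t - \<phi> 0 \<le> t * \<beta> t"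
    and \<beta>: "(\<beta> \<longlongrightarrow> b) (at_right 0)"
  shows "d \<le> b"
proof (rule tendsto_le[OF trivial_limit_at_right_real \<beta>])
  have "((\<lambda>t. (\<phi> t - \<phi> 0) / (t - 0)) \<longlongrightarrow> d) (at 0 within {0..t0})"
    using d by (simp add: has_field_derivative_iff)
  then show "((\<lambda>t. (\<phi> t - \<phi> 0) / t) \<longlongrightarrow> d) (at_right 0)"
    using t0 by (simp add: at_within_Icc_at_right)
  show "\<forall>\<^sub>F t in at_right 0. (\<phi> t - \<phi> 0) / t \<le> \<beta> t"
    using eventually_at_right_real[OF t0] by eventually_elim (use le in \<open>simp add: divide_le_eq mult.commute\<close>)
qed

text \<open>The lower bound for \<open>(1 - f (r *\<^sub>R x\<^sub>0) \<bullet> y\<^sub>0) / (1 -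
  r)\<close> when \<open>a\<close> is \<open>f 0 \<bullet> y\<^sub>0\<close>; its limit at r = 1 is
  the Schwarz constant.\<close>

definition schwarz_quotient :: "nat \<Rightarrow> real \<Rightarrow> real \<Rightarrow> real" where
  "schwarz_quotient n a = far_cap_integral n (cap_angle n ((a + 1) / 2))"

lemma schwarz_quotient_tendsto:
  assumes n: "n \<ge> 2" and a: "-1 < a" "a < 1"
  shows "(schwarz_quotient n a \<longlongrightarrow> schwarz_const n a) (at_left 1)"
proof -
  have "0 < (a + 1) / 2" "(a + 1) / 2 < 1" using a by auto
  then have "continuous_on {0..1} (schwarz_quotient n a)"
    unfolding schwarz_quotient_def by (intro continuous_on_far_cap_integral cap_angle n)
  then have "(schwarz_quotient n a \<longlongrightarrow> schwarz_quotient n a 1) (at 1 within {0..1})"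
    unfolding continuous_on_def by (rule bspec) simp
  then show ?thesis
    using schwarz_const_eq[OF n a] by (simp add: schwarz_quotient_def at_within_Icc_at_left)
qed

section \<open>Radial and boundary derivatives of a map of balls\<close>

context
  fixes f :: "real^'n::finite \<Rightarrow> real^'m::finite" and x\<^sub>0 :: "real^'n" and y\<^sub>0 :: "real^'m"
  assumes n: "CARD('n) \<ge> 2" and f: "harmonic_ball_map f x\<^sub>0 y\<^sub>0"
begin

lemma ball_map_facts:
  shows "norm x\<^sub>0 = 1" "norm y\<^sub>0 = 1" "x \<in> ball 0 1 \<Longrightarrow> norm (f x) < 1" "harmonic_on (ball 0 1) f"
    "continuous_on (insert x\<^sub>0 (ball 0 1)) (f(x\<^sub>0 := y\<^sub>0))"
  using f by (auto simp: harmonic_ball_map_def image_subset_iff)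

lemma ball_map_inner_bound:
  assumes "x \<in> ball 0 1" shows "\<bar>f x \<bullet> y\<^sub>0\<bar> < 1"
  using Cauchy_Schwarz_ineq2[of "f x" y\<^sub>0] ball_map_facts(2) ball_map_facts(3)[OF assms] by simp

lemma ball_map_axis_bound:
  assumes r: "0 < r" "r < 1"
  shows "f (r *\<^sub>R x\<^sub>0) \<bullet> y\<^sub>0 \<le> 1 - (1 - r) * schwarz_quotient CARD('n) (f 0 \<bullet> y\<^sub>0) r"
proof -
  let ?H = "\<lambda>k x. \<chi> i j. partial_deriv j (partial_deriv i (\<lambda>x. f x $ k)) x"
  have C2: "C2_on (ball 0 1) (\<lambda>x. f x $ k)" and lap: "x \<in> ball 0 1 \<Longrightarrow> laplacian (\<lambda>x. f x $ k) x = 0" for k x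
    using ball_map_facts(4) by (auto simp: harmonic_on_def)
  have eq: "(\<lambda>x. 1 - f x \<bullet> y\<^sub>0) = (\<lambda>x. 1 + (\<Sum>k\<in>UNIV. - (y\<^sub>0 $ k) * f x $ k))"
    by (simp add: inner_vec_def sum_negf mult.commute)
  have hv: "has_hessian (ball 0 1) (\<lambda>x. 1 - f x \<bullet> y\<^sub>0)
     (\<lambda>x. \<Sum>k\<in>UNIV. - (y\<^sub>0 $ k) *\<^sub>R (\<chi> i. partial_deriv i (\<lambda>x. f x $ k) x)) (\<lambda>x. \<Sum>k\<in>UNIV. - (y\<^sub>0 $ k) *\<^sub>R ?H k x)"
    unfolding eq by (rule has_hessian_affine[OF C2_on_has_hessian[OF open_ball C2]])
  have "(1 - r) * schwarz_quotient CARD('n) (f 0 \<bullet> y\<^sub>0) r \<le> 1 - f (r *\<^sub>R x\<^sub>0) \<bullet> y\<^sub>0"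
    unfolding schwarz_quotient_def
  proof (rule harmonic_cap_lower_bound[OF n ball_map_facts(1) hv])
    fix x :: "real^'n" assume x: "x \<in> ball 0 1"
    have "trace (\<Sum>k\<in>UNIV. - (y\<^sub>0 $ k) *\<^sub>R ?H k x) = (\<Sum>k\<in>UNIV. - (y\<^sub>0 $ k) * laplacian (\<lambda>x. f x $ k) x)"
      by (simp add: trace_def laplacian_def sum_distrib_left sum_negf) (rule sum.swap)
    then show "trace (\<Sum>k\<in>UNIV. - (y\<^sub>0 $ k) *\<^sub>R ?H k x) = 0" by (simp add: lap[OF x])
    show "0 \<le> 1 - f x \<bullet> y\<^sub>0 \<and> 1 - f x \<bullet> y\<^sub>0 \<le> 2"
      using ball_map_inner_bound[OF x] by auto
  qed (use r ball_map_inner_bound[of 0] in auto)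
  then show ?thesis by simp
qed

lemma radial_deriv_lower_bound:
  assumes r: "0 < r" "r < 1"
  obtains s where "r < s" "s < 1" "schwarz_quotient CARD('n) (f 0 \<bullet> y\<^sub>0) r \<le> norm (radial_deriv f x\<^sub>0 s)"
proof -
  define \<phi> where "\<phi> t = (f(x\<^sub>0 := y\<^sub>0)) (t *\<^sub>R x\<^sub>0) \<bullet> y\<^sub>0" for t
  have x0: "x\<^sub>0 \<noteq> 0" using ball_map_facts(1) by auto
  have ne: "t *\<^sub>R x\<^sub>0 \<noteq> x\<^sub>0" if "t < 1" for t
    using that x0 by (metis less_irrefl scaleR_cancel_right scaleR_one)
  have inb: "t *\<^sub>R x\<^sub>0 \<in> ball 0 1" if "0 < t" "t < 1" for t using that ball_map_facts(1) by simp
  have deriv: "(\<phi> has_real_derivative radial_deriv f x\<^sub>0 s \<bullet> y\<^sub>0) (at s)" if s: "0 < s" "s < 1" for s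
  proof -
    let ?D = "frechet_derivative f (at (s *\<^sub>R x\<^sub>0))"
    have D: "(f has_derivative ?D) (at (s *\<^sub>R x\<^sub>0))"
      by (rule harmonic_on_has_derivative[OF open_ball ball_map_facts(4) inb[OF s]])
    have "((\<lambda>t. t *\<^sub>R x\<^sub>0) has_derivative (\<lambda>h. h *\<^sub>R x\<^sub>0)) (at s)"
      by (auto intro!: derivative_eq_intros)
    from has_derivative_inner_left[OF has_derivative_compose[OF this D], of y\<^sub>0]
    have "((\<lambda>t. f (t *\<^sub>R x\<^sub>0) \<bullet> y\<^sub>0) has_derivative (\<lambda>h. h * (radial_deriv f x\<^sub>0 s \<bullet> y\<^sub>0))) (at s)"
      by (simp add: radial_deriv_def linear_scale[OF has_derivative_linear[OF D]])
    then have "((\<lambda>t. f (t *\<^sub>R x\<^sub>0) \<bullet> y\<^sub>0) has_real_derivative radial_deriv f x\<^sub>0 s \<bullet> y\<^sub>0) (at s)"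
      by (simp add: has_field_derivative_def mult_commute_abs)
    then show ?thesis
      by (rule has_field_derivative_transform_within_open[where S = "{..<1}"])
         (use s ne in \<open>auto simp: \<phi>_def\<close>)
  qed
  \<comment> \<open>At t = 1 only continuity of \<phi> is known, from the extension of
    \<open>f\<close>; the mean value theorem asks for no more at an end point.\<close>
  have "\<exists>l s. r < s \<and> s < 1 \<and> (\<phi> has_real_derivative l) (at s) \<and> \<phi> 1 - \<phi> r = (1 - r) * l"
  proof (rule MVT)
    show "continuous_on {r..1} \<phi>"
      unfolding \<phi>_def using r ball_map_facts(1)
      by (intro continuous_intros continuous_on_compose2[OF ball_map_facts(5)]) (auto simp: le_less)
    show "\<phi> differentiable (at s)" if "r < s" "s < 1" for s
      using deriv[of s] that r by (auto simp: differentiable_def has_field_derivative_def)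
  qed (use r in auto)
  then obtain l s where s: "r < s" "s < 1" "(\<phi> has_real_derivative l) (at s)" "\<phi> 1 - \<phi> r = (1 - r) * l"
    by blast
  have l: "l = radial_deriv f x\<^sub>0 s \<bullet> y\<^sub>0"
    using s deriv[of s] r by (intro DERIV_unique[OF s(3)]) auto
  have "\<phi> 1 = 1" using ball_map_facts(2) by (simp add: \<phi>_def norm_eq_1)
  moreover have "\<phi> r \<le> 1 - (1 - r) * schwarz_quotient CARD('n) (f 0 \<bullet> y\<^sub>0) r"
    using ball_map_axis_bound[OF r] ne[of r] r by (simp add: \<phi>_def)
  ultimately have "(1 - r) * schwarz_quotient CARD('n) (f 0 \<bullet> y\<^sub>0) r \<le> (1 - r) * l"
    using s(4) by linarith
  then have "schwarz_quotient CARD('n) (f 0 \<bullet> y\<^sub>0) r \<le> l" using r by simp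
  also have "l \<le> norm (radial_deriv f x\<^sub>0 s)"
    using norm_cauchy_schwarz[of "radial_deriv f x\<^sub>0 s" y\<^sub>0] ball_map_facts(2) by (simp add: l)
  finally show thesis using that s by blast
qed

lemma inner_f0_bound: "-1 < f 0 \<bullet> y\<^sub>0" "f 0 \<bullet> y\<^sub>0 < 1"
  using ball_map_inner_bound[of 0] by auto

text \<open>The mean value theorem yields some radius beyond each \<open>r\<close>, not all of them,
  so the estimate concerns the upper limit. A \<open>C\<close> strictly between the two sides would
  bound all late radial derivatives, contrary to this radius.\<close>

lemma Limsup_radial_deriv_lower_bound:
  "ereal (schwarz_const CARD('n) (f 0 \<bullet> y\<^sub>0)) \<le> Limsup (at_left 1) (\<lambda>r. ereal (norm (radial_deriv f x\<^sub>0 r)))"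
proof (rule ccontr)
  let ?D = "schwarz_const CARD('n) (f 0 \<bullet> y\<^sub>0)" and ?L = "Limsup (at_left 1) (\<lambda>r. ereal (norm (radial_deriv f x\<^sub>0 r)))"
  assume "\<not> ereal ?D \<le> ?L"
  then have "?L < ereal ?D" by simp
  then obtain C where C: "?L < ereal C" "C < ?D" using ereal_dense2 less_ereal.simps(1) by metis
  have "\<forall>\<^sub>F r in at_left 1. ereal (norm (radial_deriv f x\<^sub>0 r)) < ereal C"
    using C(1) by (rule Limsup_lessD)
  then obtain b where b: "b < 1" "\<And>r. b < r \<Longrightarrow> r < 1 \<Longrightarrow> norm (radial_deriv f x\<^sub>0 r) < C"
    by (auto simp: eventually_at_left_field)
  have "\<forall>\<^sub>F r in at_left 1. C < schwarz_quotient CARD('n) (f 0 \<bullet> y\<^sub>0) r"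
    using schwarz_quotient_tendsto[OF n inner_f0_bound] C(2) by (rule order_tendstoD)
  moreover have "\<forall>\<^sub>F r in at_left 1. r \<in> {max 0 b<..<1}"
    using b(1) by (intro eventually_at_left_real) simp
  ultimately have "\<forall>\<^sub>F r in at_left 1. C < schwarz_quotient CARD('n) (f 0 \<bullet> y\<^sub>0) r \<and> r \<in> {max 0 b<..<1}"
    by eventually_elim simp
  from eventually_happens'[OF trivial_limit_at_left_real this]
  obtain r where r: "C < schwarz_quotient CARD('n) (f 0 \<bullet> y\<^sub>0) r" "0 < r" "b < r" "r < 1" by auto
  obtain s where "r < s" "s < 1" "schwarz_quotient CARD('n) (f 0 \<bullet> y\<^sub>0) r \<le> norm (radial_deriv f x\<^sub>0 s)"
    using radial_deriv_lower_bound[OF r(2,4)] .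
  with b(2)[of s] r show False by simp
qed

lemma boundary_derivative_bound:
  assumes f': "has_boundary_derivative f x\<^sub>0 y\<^sub>0 f'"
  shows "\<exists>l>0. adjoint f' y\<^sub>0 = l *\<^sub>R x\<^sub>0 \<and> schwarz_const CARD('n) (f 0 \<bullet> y\<^sub>0) \<le> l"
proof -
  define F where "F = f(x\<^sub>0 := y\<^sub>0)"
  let ?S = "insert x\<^sub>0 (ball 0 1)" and ?D = "schwarz_const CARD('n) (f 0 \<bullet> y\<^sub>0)"
  have F': "(F has_derivative f') (at x\<^sub>0 within ?S)"
    using f' by (simp add: has_boundary_derivative_def F_def)
  define p where "p = adjoint f' y\<^sub>0"
  have lin: "linear f'" by (rule has_derivative_linear[OF F'])
  have p: "p \<bullet> h = f' h \<bullet> y\<^sub>0" for h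
    using adjoint_works[OF lin, of h y\<^sub>0] by (simp add: p_def inner_commute)
  have Fx0: "F x\<^sub>0 \<bullet> y\<^sub>0 = 1" using ball_map_facts(2) by (simp add: F_def norm_eq_1)
  \<comment> \<open>A bound for \<open>f \<bullet> y\<^sub>0\<close> along a segment entering the
    ball bounds \<open>p\<close> in that direction.\<close>
  have dir: "p \<bullet> h \<le> b"
    if t0: "t0 > 0" and seg: "\<And>t. 0 < t \<Longrightarrow> t < t0 \<Longrightarrow> x\<^sub>0 + t *\<^sub>R h \<in> ball 0 1"
      and le: "\<And>t. 0 < t \<Longrightarrow> t < t0 \<Longrightarrow> f (x\<^sub>0 + t *\<^sub>R h) \<bullet> y\<^sub>0 - 1 \<le> t * \<beta> t"
      and \<beta>: "(\<beta> \<longlongrightarrow> b) (at_right 0)" for h t0 \<beta> b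
  proof -
    \<comment> \<open>The one-sided derivative lives on a closed interval; halving keeps its right
      end where \<open>seg\<close> applies.\<close>
    have t1: "t0 / 2 > 0" using t0 by simp
    have line: "((\<lambda>t. x\<^sub>0 + t *\<^sub>R h) has_derivative (\<lambda>s. s *\<^sub>R h)) (at 0 within {0..t0/2})"
      by (auto intro!: derivative_eq_intros)
    have "(\<lambda>t. x\<^sub>0 + t *\<^sub>R h) ` {0..t0/2} \<subseteq> ?S"
      using seg t0 by (auto simp: le_less simp del: mem_ball_0)
    then have "(F has_derivative f') (at (x\<^sub>0 + 0 *\<^sub>R h) within (\<lambda>t. x\<^sub>0 + t *\<^sub>R h) ` {0..t0/2})"
      using has_derivative_subset[OF F'] by simp
    from has_derivative_inner_left[OF has_derivative_in_compose[OF line this], of y\<^sub>0]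
    have "((\<lambda>t. F (x\<^sub>0 + t *\<^sub>R h) \<bullet> y\<^sub>0) has_real_derivative p \<bullet> h) (at 0 within {0..t0/2})"
      by (simp add: has_field_derivative_def p linear_scale[OF lin] mult_commute_abs)
    then show "p \<bullet> h \<le> b"
    proof (rule has_derivative_upper_bound[OF t1 _ _ \<beta>])
      fix t assume t: "0 < t" "t < t0 / 2"
      then have "x\<^sub>0 + t *\<^sub>R h \<noteq> x\<^sub>0" using seg[of t] ball_map_facts(1) by auto
      then show "F (x\<^sub>0 + t *\<^sub>R h) \<bullet> y\<^sub>0 - F (x\<^sub>0 + 0 *\<^sub>R h) \<bullet> y\<^sub>0 \<le> t * \<beta> t"
        using le[of t] t Fx0 by (simp add: F_def)
    qed
  qed
  define l where "l = p \<bullet> x\<^sub>0"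
  \<comment> \<open>Along the inward normal, the estimate on the axis is read with r = 1 -
    t.\<close>
  have "p \<bullet> (- x\<^sub>0) \<le> - ?D"
  proof (rule dir[of 1 _ "\<lambda>t. - schwarz_quotient CARD('n) (f 0 \<bullet> y\<^sub>0) (1 - t)"])
    fix t :: real assume t: "0 < t" "t < 1"
    have eq: "x\<^sub>0 + t *\<^sub>R - x\<^sub>0 = (1 - t) *\<^sub>R x\<^sub>0" by (simp add: algebra_simps)
    show "x\<^sub>0 + t *\<^sub>R - x\<^sub>0 \<in> ball 0 1" unfolding eq using t ball_map_facts(1) by simp
    show "f (x\<^sub>0 + t *\<^sub>R - x\<^sub>0) \<bullet> y\<^sub>0 - 1 \<le> t * - schwarz_quotient CARD('n) (f 0 \<bullet> y\<^sub>0) (1 - t)"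
      unfolding eq using ball_map_axis_bound[of "1 - t"] t by simp
  next
    have "filterlim (\<lambda>t::real. 1 - t) (at_left 1) (at_right 0)"
      unfolding filterlim_at by (auto intro!: tendsto_eq_intros simp: eventually_at_filter)
    from filterlim_compose[OF schwarz_quotient_tendsto[OF n inner_f0_bound] this]
    show "((\<lambda>t. - schwarz_quotient CARD('n) (f 0 \<bullet> y\<^sub>0) (1 - t)) \<longlongrightarrow> - ?D) (at_right 0)"
      by (rule tendsto_minus)
  qed simp
  then have lD: "?D \<le> l" by (simp add: l_def)
  then have l: "l > 0" using schwarz_const_pos[OF n inner_f0_bound] by linarith
  define q where "q = p - l *\<^sub>R x\<^sub>0"
  have xx: "x\<^sub>0 \<bullet> x\<^sub>0 = 1" using ball_map_facts(1) by (simp add: norm_eq_1)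
  have qx: "q \<bullet> x\<^sub>0 = 0" by (simp add: q_def l_def inner_diff_left xx)
  have "q = 0"
  proof (rule ccontr)
    assume "q \<noteq> 0"
    \<comment> \<open>The tangential direction \<open>q\<close> leaves the ball and must be tilted
      inward by \<epsilon> times \<open>x\<^sub>0\<close>. This \<epsilon> makes
      \<open>l * \<epsilon>\<close> half of \<open>q \<bullet> q\<close>, so
      \<open>p \<bullet> h\<close> stays positive.\<close>
    define \<epsilon> where "\<epsilon> = (q \<bullet> q) / (2 * l)"
    have \<epsilon>: "\<epsilon> > 0" using \<open>q \<noteq> 0\<close> l by (simp add: \<epsilon>_def)
    define h where "h = q - \<epsilon> *\<^sub>R x\<^sub>0"
    have hx: "x\<^sub>0 \<bullet> h = - \<epsilon>" using qx by (simp add: h_def inner_diff_right xx inner_commute)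
    then have hh: "h \<bullet> h > 0" using \<epsilon> by (metis inner_gt_zero_iff inner_zero_right neg_less_0_iff_less less_irrefl)
    \<comment> \<open>The squared norm is 1 - 2 t \<epsilon> + t^2 \<open>(h \<bullet> h)\<close>,
      and for these \<open>t\<close> the quadratic term is less than t \<epsilon>.\<close>
    have seg: "x\<^sub>0 + t *\<^sub>R h \<in> ball 0 1" if t: "0 < t" "t < \<epsilon> / (h \<bullet> h)" for t
    proof -
      have "t * (h \<bullet> h) < \<epsilon>" using t(2) hh by (simp add: less_divide_eq)
      then have "t * (t * (h \<bullet> h)) < t * (2 * \<epsilon>)" using t(1) \<epsilon> by (intro mult_strict_left_mono) auto
      moreover have "(norm (x\<^sub>0 + t *\<^sub>R h))\<^sup>2 = 1 + t * (t * (h \<bullet> h)) - t * (2 * \<epsilon>)"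
        unfolding power2_norm_eq_inner using hx by (simp add: inner_add_left inner_add_right xx inner_commute)
      ultimately have "(norm (x\<^sub>0 + t *\<^sub>R h))\<^sup>2 < 1\<^sup>2" by simp
      then show ?thesis using power2_less_imp_less[of "norm (x\<^sub>0 + t *\<^sub>R h)" 1] by simp
    qed
    have "p \<bullet> h \<le> 0"
    proof (rule dir[of "\<epsilon> / (h \<bullet> h)" h "\<lambda>_. 0" 0])
      show "f (x\<^sub>0 + t *\<^sub>R h) \<bullet> y\<^sub>0 - 1 \<le> t * 0" if "0 < t" "t < \<epsilon> / (h \<bullet> h)" for t
        using ball_map_inner_bound[OF seg[OF that]] by auto
    qed (use \<epsilon> hh seg in auto)
    moreover have "p \<bullet> h = q \<bullet> q / 2"
    proof -
      have "p = q + l *\<^sub>R x\<^sub>0" by (simp add: q_def)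
      then have "p \<bullet> h = q \<bullet> q - l * \<epsilon>"
        using qx inner_commute[of x\<^sub>0 q] by (simp add: h_def inner_add_left inner_diff_right xx)
      then show ?thesis using l by (simp add: \<epsilon>_def)
    qed
    ultimately show False using \<open>q \<noteq> 0\<close> by (metis half_gt_zero inner_gt_zero_iff not_le)
  qed
  then show ?thesis using l lD by (intro exI[of _ l]) (simp add: q_def p_def)
qed

end

section \<open>Sharpness\<close>

lemma sphere_mean_poisson:
  fixes x :: "real^'n::finite"
  assumes n: "CARD('n) \<ge> 2" and x: "norm x < 1"
  shows "sphere_mean (poisson_kernel x) = 1"
proof -
  obtain e where e: "norm e = 1" "x = norm x *\<^sub>R e"
  proof (cases "x = 0")
    case True
    then show thesis using that[of "axis undefined 1"] by simp
  next
    case False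
    then show thesis using that[of "x /\<^sub>R norm x"] by simp
  qed
  have "poisson_kernel x z = poisson_kernel (norm x *\<^sub>R z) e" if "norm z = 1" for z
    using poisson_kernel_swap[OF that e(1), of "norm x"] e(2) by simp
  then have "sphere_mean (poisson_kernel x) = sphere_mean (\<lambda>z. poisson_kernel (norm x *\<^sub>R z) e)"
    by (rule sphere_mean_cong)
  also have "\<dots> = 1" using x by (intro sphere_mean_poisson_axis[OF n e(1)]) auto
  finally show ?thesis .
qed

text \<open>A positive bound uniform in the pole gives strict inequalities for the Poisson integral,
  as a map into the open ball requires.\<close>

lemma poisson_kernel_lower_bound:
  fixes x z :: "real^'n::finite"
  assumes "norm x < 1" "norm z = 1"
  shows "(1 - x \<bullet> x) * 4 powr (- real CARD('n) / 2) \<le> poisson_kernel x z"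
  unfolding poisson_kernel_def
proof (intro mult_left_mono powr_mono2')
  have "norm (x - z) \<le> 2" using norm_triangle_ineq4[of x z] assms by simp
  then have "(norm (x - z))\<^sup>2 \<le> 2\<^sup>2" by (intro power_mono) auto
  then show "(x - z) \<bullet> (x - z) \<le> 4" by (simp add: power2_norm_eq_inner)
  show "0 < (x - z) \<bullet> (x - z)" using assms by auto
  have "(norm x)\<^sup>2 \<le> 1" using assms by (simp add: power_le_one)
  then show "0 \<le> 1 - x \<bullet> x" by (simp add: power2_norm_eq_inner)
qed simp

text \<open>The mean has to be exact, since it fixes the value at the center. A ramp equal to 1 on
  the whole far cap has too large a mean, one supported in the cap too small a mean, and a convex
  combination of the two hits the target.\<close>

lemma cap_cutoff_exists:
  assumes n: "n \<ge> 2" and \<alpha>: "0 < \<alpha>" "\<alpha> < pi" and \<beta>: "0 < \<beta>" "\<beta> < \<alpha>"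
  obtains g where "continuous_on {-1..1} g" "\<And>s. 0 \<le> g s \<and> g s \<le> 1" "\<And>s. s \<ge> cos \<beta> \<Longrightarrow> g s = 0"
    "cap_norm n * integral {0..pi} (\<lambda>t. g (cos t) * sin t ^ (n - 2)) = 1 - cap_measure n \<alpha>"
proof -
  define ramp where "ramp u w s = max 0 (min 1 ((u - s) / (u - w)))" for u w s :: real
  have ramp: "0 \<le> ramp u w s" "ramp u w s \<le> 1" "s \<ge> u \<Longrightarrow> ramp u w s = 0" "s \<le> w \<Longrightarrow> ramp u w s = 1"
    if "w < u" for u w s :: real
    using that by (auto simp: ramp_def divide_nonpos_pos le_divide_eq min_def max_def divide_simps)
  have cont: "continuous_on X (ramp u w)" if "w < u" for u w X
    unfolding ramp_def using that by (intro continuous_intros) auto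
  define I where "I g = cap_norm n * integral {0..pi} (\<lambda>t. g (cos t) * sin t ^ (n - 2))" for g :: "real \<Rightarrow> real"
  define c where "c = 1 - cap_measure n \<alpha>"
  have c: "c = cap_norm n * integral {\<alpha>..pi} (\<lambda>t. sin t ^ (n - 2))"
    unfolding c_def using cap_measure_complement[OF n, of \<alpha>] \<alpha> by simp
  have split: "I g = cap_norm n * integral {0..\<alpha>} (\<lambda>t. g (cos t) * sin t ^ (n - 2)) +
      cap_norm n * integral {\<alpha>..pi} (\<lambda>t. g (cos t) * sin t ^ (n - 2))" if "continuous_on {-1..1} g" for g
  proof -
    have "integral {0..\<alpha>} (\<lambda>t. g (cos t) * sin t ^ (n - 2)) + integral {\<alpha>..pi} (\<lambda>t. g (cos t) * sin t ^ (n - 2)) =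
       integral {0..pi} (\<lambda>t. g (cos t) * sin t ^ (n - 2))"
      using \<alpha> by (intro Henstock_Kurzweil_Integration.integral_combine axis_integrable that) auto
    then show ?thesis unfolding I_def by (simp flip: distrib_left)
  qed
  have sub: "(\<lambda>t. g (cos t) * sin t ^ (n - 2)) integrable_on X"
    if "continuous_on {-1..1} g" "X = {0..\<alpha>} \<or> X = {\<alpha>..pi}" for g X
    using integrable_subinterval_real[OF axis_integrable[OF that(1), of "n - 2"]] that(2) \<alpha> by auto
  have pow: "(\<lambda>t::real. sin t ^ (n - 2)) integrable_on {u..w}" for u w
    by (intro integrable_continuous_real continuous_intros)
  have cos: "cos \<alpha> < cos \<beta>" "-1 < cos \<alpha>"
    using cos_monotone_0_pi[of \<beta> \<alpha>] cos_monotone_0_pi[of \<alpha> pi] \<alpha> \<beta> by auto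
  define g1 where "g1 = ramp (cos \<beta>) (cos \<alpha>)"
  define g2 where "g2 = ramp (cos \<alpha>) (-1)"
  have c1: "continuous_on {-1..1} g1" and c2: "continuous_on {-1..1} g2"
    unfolding g1_def g2_def by (intro cont cos)+
  have I1: "c \<le> I g1"
  proof -
    have "integral {\<alpha>..pi} (\<lambda>t. g1 (cos t) * sin t ^ (n - 2)) = integral {\<alpha>..pi} (\<lambda>t. sin t ^ (n - 2))"
      using \<alpha> by (intro integral_cong) (simp add: g1_def ramp(4)[OF cos(1)] cos_monotone_0_pi_le)
    moreover have "integral {0..\<alpha>} (\<lambda>t. g1 (cos t) * sin t ^ (n - 2)) \<ge> 0"
      using \<alpha> by (intro integral_nonneg sub c1) (auto simp: g1_def ramp[OF cos(1)] sin_ge_zero)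
    ultimately show ?thesis
      unfolding split[OF c1] c using cap_norm_pos[OF n] by simp
  qed
  have I2: "I g2 \<le> c"
  proof -
    have "integral {0..\<alpha>} (\<lambda>t. g2 (cos t) * sin t ^ (n - 2)) = integral {0..\<alpha>} (\<lambda>t. 0)"
      using \<alpha> by (intro integral_cong) (simp add: g2_def ramp(3)[OF cos(2)] cos_monotone_0_pi_le)
    moreover have "integral {\<alpha>..pi} (\<lambda>t. g2 (cos t) * sin t ^ (n - 2)) \<le> integral {\<alpha>..pi} (\<lambda>t. sin t ^ (n - 2))"
      using \<alpha> by (intro integral_le sub c2 pow)
        (auto simp: g2_def ramp[OF cos(2)] sin_ge_zero intro!: mult_left_le_one_le)
    ultimately show ?thesis
      unfolding split[OF c2] c using cap_norm_pos[OF n] by simp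
  qed
  obtain \<theta> where \<theta>: "0 \<le> \<theta>" "\<theta> \<le> 1" "\<theta> * I g1 + (1 - \<theta>) * I g2 = c"
  proof (cases "I g1 = I g2")
    case True
    then show thesis using that[of 0] I1 I2 by simp
  next
    case False
    then have "I g1 > I g2" using I1 I2 by linarith
    then show thesis
      using that[of "(c - I g2) / (I g1 - I g2)"] I1 I2 by (simp add: divide_simps) (simp add: algebra_simps)
  qed
  define g where "g s = \<theta> * g1 s + (1 - \<theta>) * g2 s" for s
  show thesis
  proof (rule that[of g])
    show "continuous_on {-1..1} g" unfolding g_def by (intro continuous_intros c1 c2)
    show "0 \<le> g s \<and> g s \<le> 1" for s
      using \<theta> convex_bound_le[of "g1 s" 1 "g2 s" \<theta> "1 - \<theta>"]
      by (auto simp: g_def g1_def g2_def ramp[OF cos(1)] ramp[OF cos(2)])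
    show "g s = 0" if "s \<ge> cos \<beta>" for s
      using that cos by (simp add: g_def g1_def g2_def ramp(3)[OF cos(1)] ramp(3)[OF cos(2)])
    have "I g = cap_norm n * integral {0..pi} (\<lambda>t. \<theta> * (g1 (cos t) * sin t ^ (n - 2)) + (1 - \<theta>) * (g2 (cos t) * sin t ^ (n - 2)))"
      by (simp add: I_def g_def algebra_simps)
    also have "integral {0..pi} (\<lambda>t. \<theta> * (g1 (cos t) * sin t ^ (n - 2)) + (1 - \<theta>) * (g2 (cos t) * sin t ^ (n - 2))) =
       \<theta> * integral {0..pi} (\<lambda>t. g1 (cos t) * sin t ^ (n - 2)) + (1 - \<theta>) * integral {0..pi} (\<lambda>t. g2 (cos t) * sin t ^ (n - 2))"
      using axis_integrable[OF c1, of "n - 2"] axis_integrable[OF c2, of "n - 2"]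
      by (subst Henstock_Kurzweil_Integration.integral_add)
         (auto intro: integrable_on_mult_right)
    finally show "cap_norm n * integral {0..pi} (\<lambda>t. g (cos t) * sin t ^ (n - 2)) = 1 - cap_measure n \<alpha>"
      using \<theta>(3) by (simp add: I_def c_def algebra_simps)
  qed
qed

text \<open>The left side will be the normal derivative of the constructed map. Since
  \<open>g\<close> is at most 1 and vanishes up to angle \<beta>, it cannot exceed the integral over
  the full far cap at \<beta>.\<close>

lemma far_cap_extremal:
  fixes e :: "real^'n::finite"
  assumes n: "CARD('n) \<ge> 2" and e: "norm e = 1"
    and g: "continuous_on {-1..1} g" "\<And>s. 0 \<le> g s \<and> g s \<le> 1"
    and \<beta>: "0 < \<beta>" "\<beta> < pi" and g0: "\<And>s. s \<ge> cos \<beta> \<Longrightarrow> g s = 0"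
  shows "2 * sphere_mean (\<lambda>z. g (z \<bullet> e) * cap_kernel CARD('n) 1 (z \<bullet> e)) \<le> far_cap_integral CARD('n) \<beta> 1"
    and "continuous_on {-1..1} (\<lambda>s. g s * cap_kernel CARD('n) 1 s)"
proof -
  let ?n = "CARD('n)"
  let ?k = "\<lambda>s. g s * cap_kernel ?n 1 s"
  have cb: "cos \<beta> < 1" "-1 < cos \<beta>"
    using cos_less_1[of \<beta>] cos_monotone_0_pi[of \<beta> pi] \<beta> by auto
  \<comment> \<open>The kernel at r = 1 is singular only at s = 1, in the region where
    \<open>g\<close> vanishes.\<close>
  show ck: "continuous_on {-1..1} ?k"
  proof (rule continuous_on_closed_cover[of "{..cos \<beta>}" _ _ "{cos \<beta>..}"])
    show "continuous_on ({-1..1} \<inter> {..cos \<beta>}) ?k"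
      using cb by (intro continuous_intros continuous_on_cap_kernel continuous_on_subset[OF g(1)]) auto
    show "continuous_on ({-1..1} \<inter> {cos \<beta>..}) ?k"
      by (rule continuous_on_eq[of _ "\<lambda>_. 0"]) (auto simp: g0)
  qed auto
  let ?f = "\<lambda>t. ?k (cos t) * sin t ^ (?n - 2)"
  have "integral {0..pi} ?f = integral {0..\<beta>} ?f + integral {\<beta>..pi} ?f"
    using \<beta> by (intro Henstock_Kurzweil_Integration.integral_combine[symmetric] axis_integrable ck) auto
  also have "integral {0..\<beta>} ?f = integral {0..\<beta>} (\<lambda>t. 0)"
    using \<beta> by (intro integral_cong) (simp add: g0 cos_monotone_0_pi_le)
  also have "integral {\<beta>..pi} ?f \<le> integral {\<beta>..pi} (\<lambda>t. cap_kernel ?n 1 (cos t) * sin t ^ (?n - 2))"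
  proof (intro integral_le far_cap_integrable)
    show "?f integrable_on {\<beta>..pi}"
      using integrable_subinterval_real[OF axis_integrable[OF ck, of "?n - 2"]] \<beta> by auto
    fix t assume "t \<in> {\<beta>..pi}"
    then have "sin t ^ (?n - 2) \<ge> 0" "cap_kernel ?n 1 (cos t) \<ge> 0"
      using \<beta> by (auto simp: sin_ge_zero cap_kernel_def)
    then show "?f t \<le> cap_kernel ?n 1 (cos t) * sin t ^ (?n - 2)"
      using g(2)[of "cos t"] by (intro mult_right_mono mult_left_le_one_le) auto
  qed (use \<beta> in auto)
  finally have "integral {0..pi} ?f \<le> integral {\<beta>..pi} (\<lambda>t. cap_kernel ?n 1 (cos t) * sin t ^ (?n - 2))"
    by simp
  then show "2 * sphere_mean (\<lambda>z. ?k (z \<bullet> e)) \<le> far_cap_integral ?n \<beta> 1"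
    unfolding sphere_mean_axis[OF n e ck] far_cap_integral_def using cap_norm_pos[OF n] by simp
qed

lemma has_hessian_cmult:
  assumes "has_hessian S u G H"
  shows "has_hessian S (\<lambda>x. c * u x) (\<lambda>x. c *\<^sub>R G x) (\<lambda>x. c *\<^sub>R H x)"
  using has_hessian_affine[OF assms, where b = 0 and c = "\<lambda>_ :: unit. c"] by (simp add: UNIV_unit)

text \<open>Off \<open>T\<close> the integrand never meets its singularity with a nonzero factor.
  The Poisson integral is therefore smooth across the part of the sphere outside \<open>T\<close>,
  and not merely inside the ball.\<close>

lemma poisson_integral_has_hessian:
  fixes g :: "real^'n::finite \<Rightarrow> real"
  assumes T: "closed T" "closed T'" "sphere 0 1 \<subseteq> T \<union> T'" "T \<subseteq> sphere 0 1"
    and g: "continuous_on (sphere 0 1) g" "\<And>z. z \<in> T' \<Longrightarrow> g z = 0"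
  shows "has_hessian (- T) (\<lambda>x. sphere_mean (\<lambda>z. g z * poisson_kernel x z))
      (\<lambda>x. sphere_mean (\<lambda>z. g z *\<^sub>R poisson_gradient x z)) (\<lambda>x. sphere_mean (\<lambda>z. g z *\<^sub>R poisson_hessian x z))"
    and "\<And>x. x \<notin> T \<Longrightarrow> continuous_on (sphere 0 1) (\<lambda>z. g z * poisson_kernel x z)"
    and "\<And>x. x \<notin> T \<Longrightarrow> continuous_on (sphere 0 1) (\<lambda>z. g z *\<^sub>R poisson_gradient x z)"
    and "\<And>x. x \<notin> T \<Longrightarrow> trace (sphere_mean (\<lambda>z. g z *\<^sub>R poisson_hessian x z)) = 0"
proof -
  \<comment> \<open>\<open>F\<close> stands for the kernel, its gradient and its Hessian. A singular
    pair x = z with \<open>x\<close> outside \<open>T\<close> forces \<open>z\<close> into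
    \<open>T'\<close>, where \<open>g\<close> is 0.\<close>
  have cont: "continuous_on ((- T) \<times> sphere 0 1) (\<lambda>p. g (snd p) *\<^sub>R F (fst p) (snd p))"
    if F: "\<And>(S :: ((real^'n) \<times> (real^'n)) set) f h. continuous_on S f \<Longrightarrow> continuous_on S h \<Longrightarrow> (\<And>x. x \<in> S \<Longrightarrow> f x \<noteq> h x) \<Longrightarrow>
      continuous_on S (\<lambda>x. F (f x) (h x))"
    for F :: "real^'n \<Rightarrow> real^'n \<Rightarrow> 'b::real_normed_vector"
  proof (rule continuous_on_closed_cover[of "UNIV \<times> T" _ _ "UNIV \<times> T'"])
    show "continuous_on ((- T) \<times> sphere 0 1 \<inter> UNIV \<times> T) (\<lambda>p. g (snd p) *\<^sub>R F (fst p) (snd p))"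
      by (intro continuous_on_scaleR continuous_on_compose2[OF g(1)] F continuous_on_fst continuous_on_snd continuous_on_id) auto
    show "continuous_on ((- T) \<times> sphere 0 1 \<inter> UNIV \<times> T') (\<lambda>p. g (snd p) *\<^sub>R F (fst p) (snd p))"
      by (rule continuous_on_eq[of _ "\<lambda>_. 0"]) (auto simp: g(2))
  qed (use T in \<open>auto intro!: closed_Times\<close>)
  have sec: "continuous_on (sphere 0 1) (\<lambda>z. g z *\<^sub>R F x z)"
    if "continuous_on ((- T) \<times> sphere 0 1) (\<lambda>p. g (snd p) *\<^sub>R F (fst p) (snd p))" "x \<notin> T"
    for F :: "real^'n \<Rightarrow> real^'n \<Rightarrow> 'b::real_normed_vector" and x
    using continuous_on_compose2[OF that(1), of "sphere 0 1" "\<lambda>z. (x, z)"] that(2)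
    by (simp add: continuous_on_Pair image_subset_iff)
  have cP: "continuous_on ((- T) \<times> sphere 0 1) (\<lambda>p. g (snd p) *\<^sub>R poisson_kernel (fst p) (snd p))"
    by (rule cont[OF continuous_on_poisson(1)])
  have cG: "continuous_on ((- T) \<times> sphere 0 1) (\<lambda>p. g (snd p) *\<^sub>R poisson_gradient (fst p) (snd p))"
    by (rule cont[OF continuous_on_poisson(2)])
  have cH: "continuous_on ((- T) \<times> sphere 0 1) (\<lambda>p. g (snd p) *\<^sub>R poisson_hessian (fst p) (snd p))"
    by (rule cont[OF continuous_on_poisson(3)])
  show sP: "continuous_on (sphere 0 1) (\<lambda>z. g z * poisson_kernel x z)" if "x \<notin> T" for x
    using sec[OF cP that] by simp
  show "continuous_on (sphere 0 1) (\<lambda>z. g z *\<^sub>R poisson_gradient x z)" if "x \<notin> T" for x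
    by (rule sec[OF cG that])
  show "has_hessian (- T) (\<lambda>x. sphere_mean (\<lambda>z. g z * poisson_kernel x z))
      (\<lambda>x. sphere_mean (\<lambda>z. g z *\<^sub>R poisson_gradient x z)) (\<lambda>x. sphere_mean (\<lambda>z. g z *\<^sub>R poisson_hessian x z))"
  proof (rule sphere_mean_has_hessian)
    show "open (- T)" using T by auto
    fix z :: "real^'n" assume z: "norm z = 1"
    show "has_hessian (- T) (\<lambda>x. g z * poisson_kernel x z) (\<lambda>x. g z *\<^sub>R poisson_gradient x z) (\<lambda>x. g z *\<^sub>R poisson_hessian x z)"
    proof (cases "z \<in> T")
      case True
      then show ?thesis by (intro has_hessian_cmult poisson_kernel_has_hessian) auto
    next
      case False
      then have "g z = 0" using T z g by auto
      then show ?thesis by (simp add: has_hessian_def)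
    qed
  qed (use sP cG cH in \<open>auto simp: split_beta\<close>)
  show "trace (sphere_mean (\<lambda>z. g z *\<^sub>R poisson_hessian x z)) = 0" if x: "x \<notin> T" for x
  proof -
    have "linear (trace :: real^'n^'n \<Rightarrow> real)"
      by (intro linearI) (simp_all add: trace_def sum.distrib sum_distrib_left)
    then have bl: "bounded_linear (trace :: real^'n^'n \<Rightarrow> real)" by (simp add: linear_conv_bounded_linear)
    have "trace (sphere_mean (\<lambda>z. g z *\<^sub>R poisson_hessian x z)) = sphere_mean (\<lambda>z. trace (g z *\<^sub>R poisson_hessian x z))"
      by (rule sphere_mean_linear[OF sec[OF cH x] bl, symmetric])
    also have "\<dots> = sphere_mean (\<lambda>z::real^'n. 0)"
    proof (rule sphere_mean_cong)
      fix z :: "real^'n" assume z: "norm z = 1"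
      show "trace (g z *\<^sub>R poisson_hessian x z) = 0"
      proof (cases "z \<in> T")
        case True
        then have "trace (poisson_hessian x z) = 0" using x z by (intro trace_poisson_hessian) auto
        then show ?thesis using linear_scale[OF \<open>linear trace\<close>, of "g z" "poisson_hessian x z"] by simp
      next
        case False
        then have "g z = 0" using T z g by auto
        then show ?thesis by (simp add: trace_def)
      qed
    qed
    finally show ?thesis by simp
  qed
qed

lemma schwarz_const_sharp:
  assumes n: "CARD('n::finite) \<ge> 2" and a: "-1 < a" "a < 1" and C: "schwarz_const CARD('n) a < C"
  obtains f :: "real^'n \<Rightarrow> real^'m::finite" and x\<^sub>0 y\<^sub>0 l where
    "harmonic_ball_map f x\<^sub>0 y\<^sub>0" "f 0 \<bullet> y\<^sub>0 = a" "l < C"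
    "has_boundary_derivative f x\<^sub>0 y\<^sub>0 (\<lambda>h. (l * (x\<^sub>0 \<bullet> h)) *\<^sub>R y\<^sub>0)"
    "((\<lambda>r. norm (radial_deriv f x\<^sub>0 r)) \<longlongrightarrow> l) (at_left 1)"
proof -
  let ?n = "CARD('n)"
  define e :: "real^'n" where "e = axis undefined 1"
  define y :: "real^'m" where "y = axis undefined 1"
  have e: "norm e = 1" and y: "norm y = 1" by (simp_all add: e_def y_def)
  have ee: "e \<bullet> e = 1" and yy: "y \<bullet> y = 1" using e y by (simp_all add: norm_eq_1)
  define \<alpha> where "\<alpha> = cap_angle ?n ((a + 1) / 2)"
  have "0 < (a + 1) / 2" "(a + 1) / 2 < 1" using a by auto
  note \<alpha> = cap_angle[OF n this, folded \<alpha>_def]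
  have "far_cap_integral ?n \<alpha> 1 < C" using C schwarz_const_eq[OF n a] by (simp add: \<alpha>_def)
  then obtain \<beta> where \<beta>: "0 < \<beta>" "\<beta> < \<alpha>" "far_cap_integral ?n \<beta> 1 < C"
    using far_cap_integral_left_limit[of \<alpha> ?n C] \<alpha> by (metis less_imp_le)
  have \<beta>pi: "\<beta> < pi" using \<beta> \<alpha> by simp
  obtain g where g: "continuous_on {-1..1} g" "\<And>s. 0 \<le> g s \<and> g s \<le> 1" "\<And>s. s \<ge> cos \<beta> \<Longrightarrow> g s = 0"
    "cap_norm ?n * integral {0..pi} (\<lambda>t. g (cos t) * sin t ^ (?n - 2)) = 1 - cap_measure ?n \<alpha>"
    using cap_cutoff_exists[OF n \<alpha>(1,2) \<beta>(1,2)] by blast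
  note on_sphere = continuous_on_sphere_axis[OF e]
  have mean_g: "sphere_mean (\<lambda>z. g (z \<bullet> e)) = (1 - a) / 2"
    using g(4) \<alpha>(3) sphere_mean_axis[OF n e g(1)] by (simp add: field_simps)
  \<comment> \<open>Boundary points at angle at least \<beta> from \<open>e\<close>. On the rest of
    the sphere \<open>g\<close> vanishes, and \<open>e\<close> lies outside this closed set.\<close>
  define T where "T = sphere 0 1 \<inter> {z. z \<bullet> e \<le> cos \<beta>}"
  have T: "closed T" "closed {z. z \<bullet> e \<ge> cos \<beta>}" "sphere 0 1 \<subseteq> T \<union> {z. z \<bullet> e \<ge> cos \<beta>}" "T \<subseteq> sphere 0 1"
    unfolding T_def by (auto intro!: closed_Int closed_Collect_le continuous_intros)
  define w where "w x = sphere_mean (\<lambda>z. g (z \<bullet> e) * poisson_kernel x z)" for x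
  define W where "W x = sphere_mean (\<lambda>z. g (z \<bullet> e) *\<^sub>R poisson_gradient x z)" for x
  define WH where "WH x = sphere_mean (\<lambda>z. g (z \<bullet> e) *\<^sub>R poisson_hessian x z)" for x
  note P = poisson_integral_has_hessian[OF T on_sphere[OF g(1)], folded w_def[abs_def] W_def[abs_def] WH_def[abs_def]]
  have hw: "has_hessian (- T) w W WH" by (rule P(1)) (simp add: g(3))
  have cP: "continuous_on (sphere 0 1) (\<lambda>z. g (z \<bullet> e) * poisson_kernel x z)" if "x \<notin> T" for x
    by (rule P(2)) (simp_all add: g(3) that)
  have cG: "continuous_on (sphere 0 1) (\<lambda>z. g (z \<bullet> e) *\<^sub>R poisson_gradient x z)" if "x \<notin> T" for x
    by (rule P(3)) (simp_all add: g(3) that)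
  have trW: "trace (WH x) = 0" if "x \<notin> T" for x
    unfolding WH_def by (rule P(4)) (simp_all add: g(3) that)
  have ball_T: "x \<notin> T" if "norm x < 1" for x using that by (auto simp: T_def)
  have e_T: "e \<notin> T" using cos_less_1[of \<beta>] \<beta> \<beta>pi by (auto simp: T_def ee)
  have range: "0 < w x \<and> w x < 1" if x: "norm x < 1" for x
  proof -
    define m where "m = (1 - x \<bullet> x) * 4 powr (- real ?n / 2)"
    have "(norm x)\<^sup>2 < 1" using x by (simp add: power_less_one_iff)
    then have m: "m > 0" by (simp add: m_def power2_norm_eq_inner)
    have cK: "continuous_on (sphere 0 1) (poisson_kernel x)"
      using x by (intro continuous_on_poisson continuous_intros) auto
    note cg = on_sphere[OF g(1)]
    have mP: "m \<le> poisson_kernel x z" if "norm z = 1" for z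
      unfolding m_def by (rule poisson_kernel_lower_bound[OF x that])
    have "0 < m * ((1 - a) / 2)" using m a by simp
    also have "\<dots> = sphere_mean (\<lambda>z. m * g (z \<bullet> e))" by (simp add: sphere_mean_cmult[OF cg] mean_g)
    also have "\<dots> \<le> w x"
      unfolding w_def
      by (intro sphere_mean_mono continuous_intros cg cK) (metis mP g(2) mult.commute mult_left_mono)
    finally have "0 < w x" .
    \<comment> \<open>Because the kernel has mean 1, \<open>1 - w x\<close> is the Poisson integral
      of 1 - g. Its boundary mean is (1 + a)/2 > 0, so the lower bound for the kernel applies
      again.\<close>
    moreover have "w x < 1"
    proof -
      have "w x + m * ((1 + a) / 2) = w x + (sphere_mean (\<lambda>z::real^'n. m) - sphere_mean (\<lambda>z. m * g (z \<bullet> e)))"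
        by (simp add: sphere_mean_cmult[OF cg] mean_g field_simps)
      also have "\<dots> = sphere_mean (\<lambda>z. g (z \<bullet> e) * poisson_kernel x z + (m - m * g (z \<bullet> e)))"
        unfolding w_def
        by (subst sphere_mean_add, (intro continuous_intros cg cK)+, subst sphere_mean_diff, (intro continuous_intros cg)+) (rule refl)
      also have "\<dots> \<le> sphere_mean (poisson_kernel x)"
      proof (intro sphere_mean_mono continuous_intros cg cK)
        fix z :: "real^'n" assume "norm z = 1"
        then have "(1 - g (z \<bullet> e)) * m \<le> (1 - g (z \<bullet> e)) * poisson_kernel x z"
          using mP g(2) by (intro mult_left_mono) auto
        then show "g (z \<bullet> e) * poisson_kernel x z + (m - m * g (z \<bullet> e)) \<le> poisson_kernel x z"
          by (simp add: algebra_simps)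
      qed
      also have "\<dots> = 1" by (rule sphere_mean_poisson[OF n x])
      finally have "w x + m * ((1 + a) / 2) \<le> 1" .
      moreover have "m * ((1 + a) / 2) > 0" using m a by simp
      ultimately show ?thesis by linarith
    qed
    ultimately show ?thesis by simp
  qed
  \<comment> \<open>The factor \<open>1 - x \<bullet> x\<close> vanishes at \<open>e\<close>; hence
    the formula for \<open>f\<close> already takes the value \<open>y\<close> there.\<close>
  have we: "w e = 0" by (simp add: w_def poisson_kernel_def ee)
  have w0: "w 0 = (1 - a) / 2"
    unfolding w_def mean_g[symmetric] by (rule sphere_mean_cong) (simp add: poisson_kernel_0)
  define k where "k s = g s * cap_kernel ?n 1 s" for s
  note ext = far_cap_extremal[OF n e g(1,2) \<beta>(1) \<beta>pi g(3), folded k_def]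
  define l where "l = 2 * sphere_mean (\<lambda>z. k (z \<bullet> e))"
  have lC: "l < C" using ext(1) \<beta>(3) by (simp add: l_def)
  have l0: "l \<ge> 0"
  proof -
    have "0 \<le> k s" for s
      unfolding k_def cap_kernel_def using g(2)[of s] by (intro mult_nonneg_nonneg) auto
    then have "sphere_mean (\<lambda>z::real^'n. 0) \<le> sphere_mean (\<lambda>z. k (z \<bullet> e))"
      by (intro sphere_mean_mono on_sphere ext(2) continuous_on_const)
    then show ?thesis by (simp add: l_def)
  qed
  \<comment> \<open>At \<open>e\<close> the second term of the Poisson gradient carries the factor
    \<open>1 - e \<bullet> e = 0\<close>. What remains is a multiple of \<open>e\<close>, so the
    boundary gradient is exactly normal.\<close>
  have We: "- 2 *\<^sub>R W e = l *\<^sub>R e"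
  proof -
    have "W e = sphere_mean (\<lambda>z. (- k (z \<bullet> e)) *\<^sub>R e)"
      unfolding W_def
    proof (rule sphere_mean_cong)
      fix z :: "real^'n" assume "norm z = 1"
      then have "z \<bullet> z = 1" by (simp add: norm_eq_1)
      then have "(e - z) \<bullet> (e - z) = 2 - 2 * (z \<bullet> e)"
        by (simp add: inner_diff_left inner_diff_right ee inner_commute)
      then show "g (z \<bullet> e) *\<^sub>R poisson_gradient e z = (- k (z \<bullet> e)) *\<^sub>R e"
        by (simp add: poisson_gradient_def ee k_def cap_kernel_def)
    qed
    also have "\<dots> = sphere_mean (\<lambda>z. - k (z \<bullet> e)) *\<^sub>R e"
      by (rule sphere_mean_linear[OF continuous_on_minus[OF on_sphere[OF ext(2)]] bounded_linear_scaleR_left])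
    also have "sphere_mean (\<lambda>z. - k (z \<bullet> e)) = - sphere_mean (\<lambda>z. k (z \<bullet> e))"
      using sphere_mean_cmult[OF on_sphere[OF ext(2)], of "- 1"] by simp
    finally show ?thesis by (simp add: l_def)
  qed
  define f where "f x = (1 - 2 * w x) *\<^sub>R y" for x
  have fe: "f(e := y) = f" by (auto simp: f_def we)
  have df: "(f has_derivative (\<lambda>h. ((- 2 *\<^sub>R W x) \<bullet> h) *\<^sub>R y)) (at x)" if "x \<notin> T" for x
  proof -
    have "(w has_derivative (\<lambda>h. W x \<bullet> h)) (at x)" using has_hessianD(1)[OF hw] that by simp
    then show ?thesis unfolding f_def[abs_def] by (auto intro!: derivative_eq_intros)
  qed
  have "harmonic_ball_map f e y"
    unfolding harmonic_ball_map_def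
  proof (intro conjI)
    show "f ` ball 0 1 \<subseteq> ball 0 1" using range by (auto simp: f_def y abs_less_iff)
    show "harmonic_on (ball 0 1) f"
      unfolding harmonic_on_def
    proof
      fix k
      have "has_hessian (ball 0 1) w W WH"
        using ball_T by (intro has_hessian_subset[OF hw]) auto
      from has_hessian_affine[OF this, where b = "y $ k" and c = "\<lambda>_ :: unit. - 2 * y $ k"]
      have h: "has_hessian (ball 0 1) (\<lambda>x. f x $ k) (\<lambda>x. (- 2 * y $ k) *\<^sub>R W x) (\<lambda>x. (- 2 * y $ k) *\<^sub>R WH x)"
        by (simp add: UNIV_unit f_def algebra_simps)
      have "trace ((- 2 * y $ k) *\<^sub>R WH x) = (- 2 * y $ k) * trace (WH x)" for x
        by (simp add: trace_def sum_distrib_left)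
      then show "C2_on (ball 0 1) (\<lambda>x. f x $ k) \<and> (\<forall>x\<in>ball 0 1. laplacian (\<lambda>x. f x $ k) x = 0)"
        using has_hessian_C2_on[OF open_ball h] trW ball_T by simp
    qed
    show "continuous_on (insert e (ball 0 1)) (f(e := y))"
      unfolding fe using e_T ball_T
      by (intro continuous_at_imp_continuous_on ballI) (auto intro: has_derivative_continuous[OF df])
  qed (simp_all add: e y)
  moreover have "f 0 \<bullet> y = a" by (simp add: f_def w0 yy field_simps)
  moreover have "has_boundary_derivative f e y (\<lambda>h. (l * (e \<bullet> h)) *\<^sub>R y)"
    unfolding has_boundary_derivative_def fe
    using has_derivative_at_withinI[OF df[OF e_T]] unfolding We by simp
  moreover have "((\<lambda>r. norm (radial_deriv f e r)) \<longlongrightarrow> l) (at_left 1)"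
  proof -
    have eq: "norm (radial_deriv f e r) = \<bar>(- 2 *\<^sub>R W (r *\<^sub>R e)) \<bullet> e\<bar>" if "0 < r" "r < 1" for r
    proof -
      have "r *\<^sub>R e \<notin> T" using ball_T[of "r *\<^sub>R e"] that e by simp
      then have "radial_deriv f e r = ((- 2 *\<^sub>R W (r *\<^sub>R e)) \<bullet> e) *\<^sub>R y"
        unfolding radial_deriv_def by (subst frechet_derivative_at[OF df, symmetric]) simp_all
      then show ?thesis by (simp only: norm_scaleR y mult_1_right)
    qed
    \<comment> \<open>Smoothness across the sphere at \<open>e\<close> makes the interior radial
      derivatives converge to the boundary one.\<close>
    have "isCont W e"
      using has_hessianD(4)[OF hw] T(1) e_T continuous_on_eq_continuous_at[of "- T" W] by auto
    then have "((\<lambda>r. W (r *\<^sub>R e)) \<longlongrightarrow> W e) (at_left 1)"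
      by (rule isCont_tendsto_compose) (auto intro!: tendsto_eq_intros)
    then have "((\<lambda>r. \<bar>(- 2 *\<^sub>R W (r *\<^sub>R e)) \<bullet> e\<bar>) \<longlongrightarrow> \<bar>(- 2 *\<^sub>R W e) \<bullet> e\<bar>) (at_left 1)"
      by (intro tendsto_intros)
    also have "\<bar>(- 2 *\<^sub>R W e) \<bullet> e\<bar> = l" unfolding We using l0 by (simp add: ee)
    finally show ?thesis
      by (rule Lim_transform_eventually)
         (use eventually_at_left_real[of 0 1] eq in \<open>auto elim!: eventually_mono\<close>)
  qed
  ultimately show thesis using that lC by blast
qed

theorem theorem4p4:
  assumes "CARD('n::finite) \<ge> 2"
  shows
    "(\<forall>(f :: real^'n \<Rightarrow> real^'m::finite) x\<^sub>0 y\<^sub>0. harmonic_ball_map f x\<^sub>0 y\<^sub>0 \<longrightarrow>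
        ereal (schwarz_const CARD('n) (f 0 \<bullet> y\<^sub>0))
          \<le> Limsup (at_left 1) (\<lambda>r. ereal (norm (radial_deriv f x\<^sub>0 r))) \<and>
        (\<forall>f'. has_boundary_derivative f x\<^sub>0 y\<^sub>0 f' \<longrightarrow>
           (\<exists>l>0. adjoint f' y\<^sub>0 = l *\<^sub>R x\<^sub>0 \<and> schwarz_const CARD('n) (f 0 \<bullet> y\<^sub>0) \<le> l))) \<and>
     (\<forall>a\<in>{-1<..<1}. \<forall>C > schwarz_const CARD('n) a.
        \<not> (\<forall>(f :: real^'n \<Rightarrow> real^'m) x\<^sub>0 y\<^sub>0. harmonic_ball_map f x\<^sub>0 y\<^sub>0 \<and> f 0 \<bullet> y\<^sub>0 = a \<longrightarrow>
             ereal C \<le> Limsup (at_left 1) (\<lambda>r. ereal (norm (radial_deriv f x\<^sub>0 r)))) \<and>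
        \<not> (\<forall>(f :: real^'n \<Rightarrow> real^'m) x\<^sub>0 y\<^sub>0 f'.
             harmonic_ball_map f x\<^sub>0 y\<^sub>0 \<and> f 0 \<bullet> y\<^sub>0 = a \<and> has_boundary_derivative f x\<^sub>0 y\<^sub>0 f' \<longrightarrow>
             (\<exists>l>0. adjoint f' y\<^sub>0 = l *\<^sub>R x\<^sub>0 \<and> C \<le> l)))"
proof (intro conjI allI impI ballI)
  fix f :: "real^'n \<Rightarrow> real^'m" and x\<^sub>0 y\<^sub>0
  assume f: "harmonic_ball_map f x\<^sub>0 y\<^sub>0"
  show "ereal (schwarz_const CARD('n) (f 0 \<bullet> y\<^sub>0)) \<le> Limsup (at_left 1) (\<lambda>r. ereal (norm (radial_deriv f x\<^sub>0 r)))"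
    by (rule Limsup_radial_deriv_lower_bound[OF assms f])
  fix f' assume "has_boundary_derivative f x\<^sub>0 y\<^sub>0 f'"
  then show "\<exists>l>0. adjoint f' y\<^sub>0 = l *\<^sub>R x\<^sub>0 \<and> schwarz_const CARD('n) (f 0 \<bullet> y\<^sub>0) \<le> l"
    by (rule boundary_derivative_bound[OF assms f])
next
  fix a C :: real assume a: "a \<in> {-1<..<1}" and C: "schwarz_const CARD('n) a < C"
  then have a': "-1 < a" "a < 1" by auto
  \<comment> \<open>A single map defeats \<open>C\<close> in both estimates: its radial derivative
    has norm tending to \<open>l\<close>, and its boundary derivative has multiplier
    \<open>l\<close>.\<close>
  obtain f :: "real^'n \<Rightarrow> real^'m" and x\<^sub>0 y\<^sub>0 l where f: "harmonic_ball_map f x\<^sub>0 y\<^sub>0" "f 0 \<bullet> y\<^sub>0 = a" "l < C"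
    "has_boundary_derivative f x\<^sub>0 y\<^sub>0 (\<lambda>h. (l * (x\<^sub>0 \<bullet> h)) *\<^sub>R y\<^sub>0)"
    "((\<lambda>r. norm (radial_deriv f x\<^sub>0 r)) \<longlongrightarrow> l) (at_left 1)"
    by (rule schwarz_const_sharp[OF assms a' C, where 'm = 'm]) blast
  show "\<not> (\<forall>(f :: real^'n \<Rightarrow> real^'m) x\<^sub>0 y\<^sub>0. harmonic_ball_map f x\<^sub>0 y\<^sub>0 \<and> f 0 \<bullet> y\<^sub>0 = a \<longrightarrow>
             ereal C \<le> Limsup (at_left 1) (\<lambda>r. ereal (norm (radial_deriv f x\<^sub>0 r))))"
  proof
    assume "\<forall>(f :: real^'n \<Rightarrow> real^'m) x\<^sub>0 y\<^sub>0. harmonic_ball_map f x\<^sub>0 y\<^sub>0 \<and> f 0 \<bullet> y\<^sub>0 = a \<longrightarrow>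
             ereal C \<le> Limsup (at_left 1) (\<lambda>r. ereal (norm (radial_deriv f x\<^sub>0 r)))"
    then have "ereal C \<le> Limsup (at_left 1) (\<lambda>r. ereal (norm (radial_deriv f x\<^sub>0 r)))" using f by blast
    also have "\<dots> = ereal l"
      using f(5) by (intro lim_imp_Limsup trivial_limit_at_left_real) simp
    finally show False using f(3) by simp
  qed
  show "\<not> (\<forall>(f :: real^'n \<Rightarrow> real^'m) x\<^sub>0 y\<^sub>0 f'.
             harmonic_ball_map f x\<^sub>0 y\<^sub>0 \<and> f 0 \<bullet> y\<^sub>0 = a \<and> has_boundary_derivative f x\<^sub>0 y\<^sub>0 f' \<longrightarrow>
             (\<exists>l>0. adjoint f' y\<^sub>0 = l *\<^sub>R x\<^sub>0 \<and> C \<le> l))"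
  proof
    let ?f' = "\<lambda>h. (l * (x\<^sub>0 \<bullet> h)) *\<^sub>R y\<^sub>0"
    assume "\<forall>(f :: real^'n \<Rightarrow> real^'m) x\<^sub>0 y\<^sub>0 f'.
             harmonic_ball_map f x\<^sub>0 y\<^sub>0 \<and> f 0 \<bullet> y\<^sub>0 = a \<and> has_boundary_derivative f x\<^sub>0 y\<^sub>0 f' \<longrightarrow>
             (\<exists>l>0. adjoint f' y\<^sub>0 = l *\<^sub>R x\<^sub>0 \<and> C \<le> l)"
    then obtain l' where l': "adjoint ?f' y\<^sub>0 = l' *\<^sub>R x\<^sub>0" "C \<le> l'" using f by blast
    have "linear ?f'" using f(4) has_derivative_linear unfolding has_boundary_derivative_def by blast
    \<comment> \<open>Pairing with \<open>x\<^sub>0\<close> shows that the multiplier can only be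
      \<open>l\<close>.\<close>
    from adjoint_works[OF this, of x\<^sub>0 y\<^sub>0] have "l' * (x\<^sub>0 \<bullet> x\<^sub>0) = l * (x\<^sub>0 \<bullet> x\<^sub>0) * (y\<^sub>0 \<bullet> y\<^sub>0)"
      by (simp add: l'(1))
    moreover have "x\<^sub>0 \<bullet> x\<^sub>0 = 1" "y\<^sub>0 \<bullet> y\<^sub>0 = 1" using f(1) by (auto simp: harmonic_ball_map_def norm_eq_1)
    ultimately show False using l'(2) f(3) by simp
  qed
qed

end
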